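(* Let $d$ be a multiradial distance on a homogeneous group $\mathbb G$ and let $\Sigma\subset\mathbb G$ be an $n$-dimensional ($n\ge1$) $C^1$ smooth embedded horizontal submanifold. Then $$\mathcal H^n_d\llcorner\Sigma=\mathcal S^n_d\llcorner\Sigma,$$ where $\mathcal S^n_d=\omega_d(n,n)\,\mathcal S^n_0$ and $\mathcal H^n_d=\omega_d(n,n)\,\mathcal H^n_0$.
   Context: Homogeneous groups. A homogeneous group is a finite dimensional real vector space $\mathbb G=H^1\oplus\cdots\oplus H^\iota$, $H^\iota\neq\{0\}$, with a nilpotent Lie bracket satisfying $[H^i,H^j]\subset H^{i+j}$ ($H^k=\{0\}$ for $k>\iota$), with group law given by the Baker-Campbell-Hausdorff formula $xy=x+y+\frac12[x,y]+\cdots$ (so the identity is $0$ and $x^{-1}=-x$), and with the linear dilations $\delta_r$, $r>0$, $\delta_r x=r^ix$ for $x\in H^i$. Put $q=\dim\mathbb G$, $h_j=\dim H^j$, $m_j=h_1+\cdots+h_j$, $m_0=0$. $\mathrm{Lie}(\mathbb G)$ is the Lie algebra of left invariant vector fields; $\mathbb G$ is identified with $T_0\mathbb G$, and then $\exp X=X(0)$. A scalar product on $\mathbb G$ making the $H^j$ mutually orthogonal is fixed, with norm $|\cdot|$. A homogeneous distance $d$ is a left invariant distance with $d(\delta_rx,\delta_ry)=r\,d(x,y)$. A homogeneous distance $d$ is multiradial if there is a continuous $\varphi:[0,+\infty)^\iota\to[0,+\infty)$, monotone nondecreasing in each single variable, with $\varphi(x)\to+\infty$ as $|x|\to+\infty$,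 such that $d(x,0)=\varphi(|x_1|,\dots,|x_\iota|)$ for all $x\in\mathbb G$, where $x_j\in H^j$ is the component of $x$ in $H^j$. Horizontal submanifolds. Fix an orthonormal basis $(e_1,\dots,e_q)$ such that $(e_i)_{m_{j-1}<i\le m_j}$ is a basis of $H^j$ for each $j$; let $X_i\in\mathrm{Lie}(\mathbb G)$ with $X_i(0)=e_i$, and $d_i=j$ if $m_{j-1}<i\le m_j$. For $I=(i_1<\cdots<i_k)$ put $X_I=X_{i_1}\wedge\cdots\wedge X_{i_k}$, $d(X_I)=d_{i_1}+\cdots+d_{i_k}$, and $\pi_M(\sum_I c_IX_I)=\sum_{d(X_I)=M}c_IX_I$. For $p\in\Sigma$ let $\xi$ be the left invariant $n$-vector field with $\xi(p)=t_1\wedge\cdots\wedge t_n$, $(t_i)$ a basis of $T_p\Sigma$; let $d_\Sigma(p)=\max\{M:\pi_M(\xi)\neq0\}$, and with $M=d_\Sigma(p)$ let $\mathcal A_p\Sigma=\{X\in\mathrm{Lie}(\mathbb G):X\wedge\pi_M(\xi)=0\}$, $A_p\Sigma=\exp\mathcal A_p\Sigma$. The point $p$ is horizontal if $\mathcal A_p\Sigma$ is a Lie subalgebra and $A_p\Sigma$ is a horizontal subgroup, that is, a Lie subgroup which is a linear subspace contained in $H^1$. $\Sigma$ is horizontal if all of its points are horizontal. Measures. With diameters with respect to $d$, $\mathcal S^n_0(E)$ (resp. $\mathcal H^n_0(E)$) is $\sup_{\delta>0}\inf\{\sum_{j}2^{-n}\mathrm{diam}(B_j)^n: E\subset\bigcup_{j\in\mathbb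 N}B_j,\ \mathrm{diam}(B_j)\le\delta\}$, where the $B_j$ range over closed $d$-balls (resp. over all closed sets). The constant is $\omega_d(n,n)=\mathcal H^n_{|\cdot|}(\{x\in V:d(x,0)\le1\})$ for any $n$-dimensional linear subspace $V\subset H^1$ (independent of $V$ since $d$ is multiradial), where $\mathcal H^n_{|\cdot|}$ is the $n$-dimensional Hausdorff measure of $|\cdot|$, normalized to agree with Lebesgue measure on $n$-dimensional subspaces. For a measure $\mu$, $\mu\llcorner\Sigma(E)=\mu(E\cap\Sigma)$. *)

theory Defs
  imports "HOL-Analysis.Analysis" "HOL-Algebra.Group"
begin

section \<open>Homogeneous groups\<close>

text \<open>
  The vector space and its fixed scalar product are those of the type \<open>'a :: euclidean_space\<close>.
  The group law is the field \<open>mult\<close> inherited from \<open>monoid\<close>.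
\<close>

record 'a homgroup = "'a monoid" +
  layer :: "nat \<Rightarrow> 'a set"
  step :: nat
  bracket :: "'a \<Rightarrow> 'a \<Rightarrow> 'a"

fun nested_bracket :: "('a \<Rightarrow> 'a \<Rightarrow> 'a) \<Rightarrow> 'a::zero list \<Rightarrow> 'a" where
  "nested_bracket br [] = 0"
| "nested_bracket br [x] = x"
| "nested_bracket br (x # y # zs) = br x (nested_bracket br (y # zs))"

text \<open>
  The Baker-Campbell-Hausdorff series in Dynkin's form,
  \[ \sum_{k\ge 1} \frac{(-1)^{k-1}}{k} \sum_{r_i+s_i>0}
     \frac{[x^{r_1}y^{s_1}\cdots x^{r_k}y^{s_k}]}{\sum_i (r_i+s_i)\,\prod_i r_i!\,s_i!}, \]
  with right-nested brackets, truncated at words of length \<open>N\<close>. When \<open>N\<close> is the step of the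
  group the omitted terms vanish.
\<close>

definition dynkin_indices :: "nat \<Rightarrow> nat \<Rightarrow> (nat \<times> nat) list set" where
  "dynkin_indices N k = {rs. length rs = k \<and> (\<forall>(r, s) \<in> set rs. r + s > 0)
     \<and> (\<Sum>(r, s)\<leftarrow>rs. r + s) \<le> N}"

definition dynkin_word :: "'a \<Rightarrow> 'a \<Rightarrow> (nat \<times> nat) list \<Rightarrow> 'a list" where
  "dynkin_word x y rs = concat (map (\<lambda>(r, s). replicate r x @ replicate s y) rs)"

definition bch :: "('a \<Rightarrow> 'a \<Rightarrow> 'a) \<Rightarrow> nat \<Rightarrow> 'a::real_vector \<Rightarrow> 'a \<Rightarrow> 'a" where
  "bch br N x y = (\<Sum>k = 1..N. \<Sum>rs \<in> dynkin_indices N k.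
     ((-1) ^ (k - 1) / (real k * real (\<Sum>(r, s)\<leftarrow>rs. r + s)
        * (\<Prod>(r, s)\<leftarrow>rs. fact r * fact s)))
     *\<^sub>R nested_bracket br (dynkin_word x y rs))"

text \<open>
  Layers are indexed by all naturals, with \<open>H\<^sup>j = 0\<close> outside \<open>1, \<dots>, \<iota>\<close>; the sum of the layers is
  direct because they are orthogonal, and the bracket is nilpotent because it is graded.
  That the law is a group law follows from the Baker-Campbell-Hausdorff formula, but is kept as
  part of the structure.
\<close>

locale homogeneous_group = group G
  for G :: "('a::euclidean_space, 'm) homgroup_scheme" (structure) +
  assumes carrier_UNIV: "carrier G = UNIV"
    and layer_subspace: "\<And>j. subspace (layer G j)"
    and layer_outside: "\<And>j. j \<notin> {1..step G} \<Longrightarrow> layer G j = {0}"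
    and layer_step: "layer G (step G) \<noteq> {0}"
    and layer_span: "span (\<Union>j\<in>{1..step G}. layer G j) = UNIV"
    and layer_orthogonal: "\<And>i j x y. \<lbrakk>i \<noteq> j; x \<in> layer G i; y \<in> layer G j\<rbrakk> \<Longrightarrow> inner x y = 0"
    and bracket_bilinear: "bilinear (bracket G)"
    and bracket_alternating: "\<And>x. bracket G x x = 0"
    and bracket_jacobi: "\<And>x y z. bracket G x (bracket G y z) + bracket G y (bracket G z x)
                          + bracket G z (bracket G x y) = 0"
    and bracket_graded: "\<And>i j x y. \<lbrakk>x \<in> layer G i; y \<in> layer G j\<rbrakk> \<Longrightarrow> bracket G x y \<in> layer G (i + j)"
    and mult_bch: "\<And>x y. x \<otimes> y = bch (bracket G) (step G) x y"

definition component :: "('a::euclidean_space, 'm) homgroup_scheme \<Rightarrow> 'a \<Rightarrow> nat \<Rightarrow> 'a" where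
  "component G x = (THE c. (\<forall>j. c j \<in> layer G j) \<and> x = (\<Sum>j = 1..step G. c j))"

definition dilation :: "('a::euclidean_space, 'm) homgroup_scheme \<Rightarrow> real \<Rightarrow> 'a \<Rightarrow> 'a" where
  "dilation G r x = (\<Sum>j = 1..step G. r ^ j *\<^sub>R component G x j)"


section \<open>Homogeneous and multiradial distances\<close>

definition homogeneous_distance ::
  "('a::euclidean_space, 'm) homgroup_scheme \<Rightarrow> ('a \<Rightarrow> 'a \<Rightarrow> real) \<Rightarrow> bool" where
  "homogeneous_distance G d \<longleftrightarrow> Metric_space UNIV d
     \<and> (\<forall>x y z. d (z \<otimes>\<^bsub>G\<^esub> x) (z \<otimes>\<^bsub>G\<^esub> y) = d x y)
     \<and> (\<forall>r>0. \<forall>x y. d (dilation G r x) (dilation G r y) = r * d x y)"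

text \<open>\<open>[0,\<infinity>)\<^sup>N\<close>, realised inside \<open>nat \<Rightarrow> real\<close> (product topology) by coordinates \<open>1, \<dots>, N\<close>.\<close>

definition orthant :: "nat \<Rightarrow> (nat \<Rightarrow> real) set" where
  "orthant N = {x. (\<forall>j\<in>{1..N}. 0 \<le> x j) \<and> (\<forall>j. j \<notin> {1..N} \<longrightarrow> x j = 0)}"

definition multiradial ::
  "('a::euclidean_space, 'm) homgroup_scheme \<Rightarrow> ('a \<Rightarrow> 'a \<Rightarrow> real) \<Rightarrow> bool" where
  "multiradial G d \<longleftrightarrow> homogeneous_distance G d
     \<and> (\<exists>\<phi>. continuous_on (orthant (step G)) \<phi>
        \<and> (\<forall>x \<in> orthant (step G). 0 \<le> \<phi> x)
        \<and> (\<forall>x \<in> orthant (step G). \<forall>j \<in> {1..step G}. \<forall>s \<ge> x j. \<phi> x \<le> \<phi> (x(j := s)))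
        \<and> filterlim \<phi> at_top
            (inf (filtercomap (\<lambda>x. L2_set x {1..step G}) at_top) (principal (orthant (step G))))
        \<and> (\<forall>x. d x 0 = \<phi> (\<lambda>j. norm (component G x j))))"


section \<open>Left invariant vector fields\<close>

definition left_invariant_fields :: "('a::euclidean_space, 'm) homgroup_scheme \<Rightarrow> ('a \<Rightarrow> 'a) set"
  where "left_invariant_fields G =
    {X. \<forall>p x. X (p \<otimes>\<^bsub>G\<^esub> x) = frechet_derivative (\<lambda>y. p \<otimes>\<^bsub>G\<^esub> y) (at x) (X x)}"

definition field_bracket :: "('a::euclidean_space \<Rightarrow> 'a) \<Rightarrow> ('a \<Rightarrow> 'a) \<Rightarrow> 'a \<Rightarrow> 'a" where
  "field_bracket X Y p = frechet_derivative Y (at p) (X p) - frechet_derivative X (at p) (Y p)"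

definition lie_subalgebra ::
  "('a::euclidean_space, 'm) homgroup_scheme \<Rightarrow> ('a \<Rightarrow> 'a) set \<Rightarrow> bool" where
  "lie_subalgebra G A \<longleftrightarrow> A \<subseteq> left_invariant_fields G \<and> (\<lambda>_. 0) \<in> A
     \<and> (\<forall>X\<in>A. \<forall>Y\<in>A. (\<lambda>p. X p + Y p) \<in> A)
     \<and> (\<forall>c. \<forall>X\<in>A. (\<lambda>p. c *\<^sub>R X p) \<in> A)
     \<and> (\<forall>X\<in>A. \<forall>Y\<in>A. field_bracket X Y \<in> A)"

text \<open>The numbers \<open>m\<^sub>j\<close>, and orthonormal bases \<open>e 1, \<dots>, e q\<close> adapted to the layers.\<close>

definition layer_sum_dim :: "('a::euclidean_space, 'm) homgroup_scheme \<Rightarrow> nat \<Rightarrow> nat" where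
  "layer_sum_dim G j = (\<Sum>i = 1..j. dim (layer G i))"

definition graded_orthonormal_basis ::
  "('a::euclidean_space, 'm) homgroup_scheme \<Rightarrow> (nat \<Rightarrow> 'a) \<Rightarrow> bool" where
  "graded_orthonormal_basis G e \<longleftrightarrow>
     (\<forall>i\<in>{1..DIM('a)}. \<forall>k\<in>{1..DIM('a)}. inner (e i) (e k) = (if i = k then 1 else 0))
     \<and> (\<forall>j\<in>{1..step G}. span (e ` {layer_sum_dim G (j - 1)<..layer_sum_dim G j}) = layer G j)"

definition index_degree :: "('a::euclidean_space, 'm) homgroup_scheme \<Rightarrow> nat \<Rightarrow> nat" where
  "index_degree G i =
     (THE j. j \<in> {1..step G} \<and> layer_sum_dim G (j - 1) < i \<and> i \<le> layer_sum_dim G j)"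

definition basis_field ::
  "('a::euclidean_space, 'm) homgroup_scheme \<Rightarrow> (nat \<Rightarrow> 'a) \<Rightarrow> nat \<Rightarrow> 'a \<Rightarrow> 'a" where
  "basis_field G e i = (THE X. X \<in> left_invariant_fields G \<and> X 0 = e i)"


section \<open>Multivectors\<close>

text \<open>
  The exterior algebra of the vector space with basis \<open>e 1, \<dots>, e q\<close>. A multivector is
  the family of its coefficients: \<open>a K\<close> is the coefficient of \<open>e k\<^sub>1 \<and> \<dots> \<and> e k\<^sub>r\<close> for
  \<open>K = {k\<^sub>1 < \<dots> < k\<^sub>r} \<subseteq> {1..q}\<close>. The sign in the product is that of the permutation sorting
  \<open>I\<close> followed by \<open>J\<close>.
\<close>

type_synonym multivector = "nat set \<Rightarrow> real"

definition wedge :: "multivector \<Rightarrow> multivector \<Rightarrow> multivector" where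
  "wedge a b K = (\<Sum>I \<in> Pow K.
     (-1) ^ card {(i, j). i \<in> I \<and> j \<in> K - I \<and> j < i} * a I * b (K - I))"

definition mv_one :: multivector where
  "mv_one K = (if K = {} then 1 else 0)"

definition mv_of_vector :: "(nat \<Rightarrow> 'a::euclidean_space) \<Rightarrow> 'a \<Rightarrow> multivector" where
  "mv_of_vector e v K = (\<Sum>i = 1..DIM('a). if K = {i} then inner v (e i) else 0)"

definition wedge_list :: "(nat \<Rightarrow> 'a::euclidean_space) \<Rightarrow> 'a list \<Rightarrow> multivector" where
  "wedge_list e vs = foldr wedge (map (mv_of_vector e) vs) mv_one"

text \<open>
  The tangent spaces are all identified with the ambient vector space, so a field of
  multivectors is a function into \<open>multivector\<close>. \<open>nvector_field G e n c\<close> is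
  \<open>\<Sum>\<^sub>I c\<^sub>I X\<^sub>I\<close> over the multi-indices \<open>I\<close> of length \<open>n\<close>, and composing with \<open>degree_part G M\<close> gives
  its projection \<open>\<pi>\<^sub>M\<close>.
\<close>

definition basis_nvector ::
  "('a::euclidean_space, 'm) homgroup_scheme \<Rightarrow> (nat \<Rightarrow> 'a) \<Rightarrow> nat set \<Rightarrow> 'a \<Rightarrow> multivector" where
  "basis_nvector G e I x = wedge_list e (map (\<lambda>i. basis_field G e i x) (sorted_list_of_set I))"

definition nvector_field ::
  "('a::euclidean_space, 'm) homgroup_scheme \<Rightarrow> (nat \<Rightarrow> 'a) \<Rightarrow> nat \<Rightarrow> (nat set \<Rightarrow> real)
   \<Rightarrow> 'a \<Rightarrow> multivector" where
  "nvector_field G e n c x K =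
     (\<Sum>I \<in> {I. I \<subseteq> {1..DIM('a)} \<and> card I = n}. c I * basis_nvector G e I x K)"

definition degree_part ::
  "('a::euclidean_space, 'm) homgroup_scheme \<Rightarrow> nat \<Rightarrow> (nat set \<Rightarrow> real) \<Rightarrow> nat set \<Rightarrow> real" where
  "degree_part G M c I = (if (\<Sum>i\<in>I. index_degree G i) = M then c I else 0)"


section \<open>Horizontal submanifolds\<close>

definition C1_on :: "'a::euclidean_space set \<Rightarrow> ('a \<Rightarrow> 'a) \<Rightarrow> bool" where
  "C1_on U f \<longleftrightarrow> (\<exists>D :: 'a \<Rightarrow> 'a \<Rightarrow>\<^sub>L 'a.
     (\<forall>x\<in>U. (f has_derivative blinfun_apply (D x)) (at x)) \<and> continuous_on U D)"

text \<open>Embedded submanifolds via slice charts: \<open>\<Phi>\<close> is a \<open>C\<^sup>1\<close> diffeomorphism with inverse \<open>\<Psi>\<close>.\<close>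

definition C1_embedded_submanifold :: "nat \<Rightarrow> 'a::euclidean_space set \<Rightarrow> bool" where
  "C1_embedded_submanifold n S \<longleftrightarrow> (\<forall>p\<in>S. \<exists>U \<Phi> \<Psi> W.
     open U \<and> p \<in> U \<and> open (\<Phi> ` U) \<and> C1_on U \<Phi> \<and> C1_on (\<Phi> ` U) \<Psi> \<and> (\<forall>x\<in>U. \<Psi> (\<Phi> x) = x)
     \<and> subspace W \<and> dim W = n \<and> \<Phi> ` (U \<inter> S) = \<Phi> ` U \<inter> W)"

definition tangent_space :: "'a::euclidean_space set \<Rightarrow> 'a \<Rightarrow> 'a set" where
  "tangent_space S p = {v. \<exists>\<gamma> :: real \<Rightarrow> 'a. \<gamma> 0 = p \<and> (\<forall>\<^sub>F t in at 0. \<gamma> t \<in> S)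
     \<and> (\<gamma> has_vector_derivative v) (at 0)}"

text \<open>
  The left invariant field \<open>\<xi>\<close> with coefficients \<open>c\<close> satisfies \<open>\<xi>(p) = t\<^sub>1 \<and> \<dots> \<and> t\<^sub>n\<close> for a basis of
  the tangent space; another basis only multiplies \<open>c\<close> by a nonzero factor.
\<close>

definition tangent_coeffs ::
  "('a::euclidean_space, 'm) homgroup_scheme \<Rightarrow> (nat \<Rightarrow> 'a) \<Rightarrow> nat \<Rightarrow> 'a set \<Rightarrow> 'a
   \<Rightarrow> (nat set \<Rightarrow> real) \<Rightarrow> bool" where
  "tangent_coeffs G e n S p c \<longleftrightarrow> (\<exists>ts. length ts = n \<and> distinct ts \<and> independent (set ts)
     \<and> span (set ts) = tangent_space S p \<and> nvector_field G e n c p = wedge_list e ts)"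

definition max_degree ::
  "('a::euclidean_space, 'm) homgroup_scheme \<Rightarrow> (nat \<Rightarrow> 'a) \<Rightarrow> nat \<Rightarrow> (nat set \<Rightarrow> real) \<Rightarrow> nat" where
  "max_degree G e n c = Max {M. nvector_field G e n (degree_part G M c) \<noteq> (\<lambda>_ _. 0)}"

definition homogeneous_tangent_algebra ::
  "('a::euclidean_space, 'm) homgroup_scheme \<Rightarrow> (nat \<Rightarrow> 'a) \<Rightarrow> nat \<Rightarrow> (nat set \<Rightarrow> real)
   \<Rightarrow> ('a \<Rightarrow> 'a) set" where
  "homogeneous_tangent_algebra G e n c = {X \<in> left_invariant_fields G. \<forall>x.
     wedge (mv_of_vector e (X x)) (nvector_field G e n (degree_part G (max_degree G e n c) c) x)
       = (\<lambda>_. 0)}"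

text \<open>A subgroup that is a linear subspace is closed, hence automatically a Lie subgroup.\<close>

definition horizontal_subgroup :: "('a::euclidean_space, 'm) homgroup_scheme \<Rightarrow> 'a set \<Rightarrow> bool"
  where "horizontal_subgroup G A \<longleftrightarrow> subgroup A G \<and> subspace A \<and> A \<subseteq> layer G 1"

text \<open>In the identification of the group with its tangent space at \<open>0\<close>, \<open>exp X = X 0\<close>.\<close>

definition horizontal_point ::
  "('a::euclidean_space, 'm) homgroup_scheme \<Rightarrow> (nat \<Rightarrow> 'a) \<Rightarrow> nat \<Rightarrow> 'a set \<Rightarrow> 'a \<Rightarrow> bool" where
  "horizontal_point G e n S p \<longleftrightarrow> (\<exists>c. tangent_coeffs G e n S p c
     \<and> lie_subalgebra G (homogeneous_tangent_algebra G e n c)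
     \<and> horizontal_subgroup G ((\<lambda>X. X 0) ` homogeneous_tangent_algebra G e n c))"

definition horizontal_submanifold ::
  "('a::euclidean_space, 'm) homgroup_scheme \<Rightarrow> (nat \<Rightarrow> 'a) \<Rightarrow> nat \<Rightarrow> 'a set \<Rightarrow> bool" where
  "horizontal_submanifold G e n S \<longleftrightarrow>
     C1_embedded_submanifold n S \<and> (\<forall>p\<in>S. horizontal_point G e n S p)"


section \<open>Hausdorff and spherical measures\<close>

text \<open>All measures here are outer measures, defined on arbitrary subsets.\<close>

definition ediam :: "('a \<Rightarrow> 'a \<Rightarrow> real) \<Rightarrow> 'a set \<Rightarrow> ennreal" where
  "ediam d B = (SUP x\<in>B. SUP y\<in>B. ennreal (d x y))"

definition covering_measure ::
  "('a \<Rightarrow> 'a \<Rightarrow> real) \<Rightarrow> nat \<Rightarrow> 'a set set \<Rightarrow> 'a set \<Rightarrow> ennreal" where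
  "covering_measure d n \<F> E = (SUP \<delta>\<in>{0::real<..}.
     INF B\<in>{B :: nat \<Rightarrow> 'a set. range B \<subseteq> \<F> \<and> E \<subseteq> (\<Union>j. B j) \<and> (\<forall>j. ediam d (B j) \<le> ennreal \<delta>)}.
       \<Sum>j. ennreal (1 / 2 ^ n) * ediam d (B j) ^ n)"

definition hausdorff0 ::
  "('a::topological_space \<Rightarrow> 'a \<Rightarrow> real) \<Rightarrow> nat \<Rightarrow> 'a set \<Rightarrow> ennreal" where
  "hausdorff0 d n = covering_measure d n {B. closed B}"

definition spherical0 :: "('a \<Rightarrow> 'a \<Rightarrow> real) \<Rightarrow> nat \<Rightarrow> 'a set \<Rightarrow> ennreal" where
  "spherical0 d n = covering_measure d n {Metric_space.mcball UNIV d x r | x r. r > 0}"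

text \<open>
  The volume of the Euclidean unit ball is the factor that makes the measure agree with
  Lebesgue measure on \<open>n\<close>-dimensional subspaces (isodiametric inequality).
\<close>

definition euclidean_hausdorff :: "nat \<Rightarrow> 'a::euclidean_space set \<Rightarrow> ennreal" where
  "euclidean_hausdorff n E = ennreal (unit_ball_vol (real n)) * hausdorff0 dist n E"

text \<open>
  \<open>\<omega>\<^sub>d(n,n)\<close>, through an arbitrary \<open>n\<close>-dimensional \<open>V \<subseteq> H\<^sup>1\<close>: the value does not depend on \<open>V\<close> when \<open>d\<close>
  is multiradial. If there is no such \<open>V\<close> the value is unspecified, but then there is no nonempty
  \<open>n\<close>-dimensional horizontal submanifold either.
\<close>

definition omega ::
  "('a::euclidean_space, 'm) homgroup_scheme \<Rightarrow> ('a \<Rightarrow> 'a \<Rightarrow> real) \<Rightarrow> nat \<Rightarrow> ennreal" where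
  "omega G d n = euclidean_hausdorff n
     {x \<in> (SOME V. subspace V \<and> dim V = n \<and> V \<subseteq> layer G 1). d x 0 \<le> 1}"

definition hausdorff_measure ::
  "('a::euclidean_space, 'm) homgroup_scheme \<Rightarrow> ('a \<Rightarrow> 'a \<Rightarrow> real) \<Rightarrow> nat \<Rightarrow> 'a set \<Rightarrow> ennreal" where
  "hausdorff_measure G d n E = omega G d n * hausdorff0 d n E"

definition spherical_measure ::
  "('a::euclidean_space, 'm) homgroup_scheme \<Rightarrow> ('a \<Rightarrow> 'a \<Rightarrow> real) \<Rightarrow> nat \<Rightarrow> 'a set \<Rightarrow> ennreal" where
  "spherical_measure G d n E = omega G d n * spherical0 d n E"

definition measure_restriction :: "('a set \<Rightarrow> ennreal) \<Rightarrow> 'a set \<Rightarrow> 'a set \<Rightarrow> ennreal" where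
  "measure_restriction \<mu> S E = \<mu> (E \<inter> S)"

end

theory Submission
  imports Defs
begin

text \<open>
  Both constructions carry the same factor, so the statement is \<open>\<H>\<^sup>n\<^sub>0 = \<S>\<^sup>n\<^sub>0\<close> on subsets of \<open>\<Sigma>\<close>, and only
  \<open>\<S>\<^sup>n\<^sub>0 \<le> \<H>\<^sup>n\<^sub>0\<close> needs an argument. At a horizontal point the left translated tangent space lies in \<open>H\<^sup>1\<close>,
  because the top-degree part of each of its vectors belongs to the homogeneous tangent algebra. Hence a \<open>C\<^sup>1\<close> chart
  of \<open>\<Sigma>\<close> sends segments to horizontal curves with almost constant control; after dilation such a curve ends
  near that constant, and on \<open>H\<^sup>1\<close> the distance to \<open>0\<close> is a multiple of the Euclidean norm since \<open>d\<close> is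
  multiradial. So small pieces of \<open>\<Sigma>\<close> with the distance \<open>d\<close> are \<open>(1 + \<epsilon>)\<close>-bilipschitz to subsets of a rescaled
  Euclidean \<open>n\<close>-space, where the two measures agree by the isodiametric inequality (here from
  Prekopa-Leindler) and Vitali's covering lemma.
\<close>

section \<open>The isodiametric inequality in coordinate subspaces\<close>

text \<open>The set \<open>E\<close> is arbitrary, so no volume can be attached to the pieces of a
  Hausdorff cover of it. Each piece B, of diameter D, has to be replaced by balls of total mass
  barely above (D/2)^n, and these must be centred in B, since only points of B can be pulled back
  through the chart. Disjoint tiny balls centred in B do this: their union has almost the same
  diameter as B, so the isodiametric inequality bounds the sum of the n-th powers of their radii.
  The bound is sharp because on H^1 the unit ball of \<open>d\<close> is a Euclidean ball. The scale
  on which the chart estimate holds with error \<epsilon> varies from point to point, and continuity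
  of the outer measures along increasing sequences of arbitrary sets is not at hand; Caratheodory's
  decomposition into separated annuli closes this gap. Prekopa-Leindler is multiplicative and its
  form does not change with the dimension, so it passes through Fubini one coordinate at a time. It
  is applied to a set K and its reflection, because (K - K)/2 lies in the ball of radius r when K
  has diameter at most 2r.\<close>

lemma emeasure_le_of_initial_segments:
  fixes A :: "real set"
  assumes A: "A \<in> sets borel" "A \<noteq> {}"
    and le: "\<And>a. a \<in> A \<Longrightarrow> emeasure lborel (A \<inter> {..a}) \<le> M"
  shows "emeasure lborel A \<le> M"
proof -
  have "\<exists>c. range c \<subseteq> A \<and> (\<forall>x\<in>A. \<exists>n::nat. x \<le> c n)"
  proof (cases "bdd_above A")
    case True
    show ?thesis
    proof (cases "Sup A \<in> A")
      case True
      then show ?thesis using \<open>bdd_above A\<close>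
        by (intro exI[of _ "\<lambda>_. Sup A"]) (auto intro: cSup_upper)
    next
      case False
      have "\<exists>y\<in>A. Sup A - 1 / real (Suc n) < y" for n
        by (rule less_cSupE[OF _ A(2), of "Sup A - 1 / real (Suc n)"]) auto
      then obtain c where c: "\<And>n. c n \<in> A" "\<And>n. Sup A - 1 / real (Suc n) < c n" by metis
      have "\<exists>n. x \<le> c n" if "x \<in> A" for x
      proof -
        have "x \<le> Sup A" using that True by (rule cSup_upper)
        moreover have "x \<noteq> Sup A" using that False by auto
        ultimately have "x < Sup A" by simp
        then obtain n where "1 / real (Suc n) < Sup A - x"
          using nat_approx_posE[of "Sup A - x"] by auto
        then have "x \<le> c n" using c(2)[of n] by linarith
        then show ?thesis ..
      qed
      then show ?thesis using c(1) by blast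
    qed
  next
    case False
    then have "\<exists>y\<in>A. real n < y" for n
      unfolding bdd_above_def by (auto simp: not_le)
    then obtain c where c: "\<And>n. c n \<in> A" "\<And>n. real n < c n" by metis
    have "\<exists>n. x \<le> c n" for x
    proof -
      obtain n where "x \<le> real n" using real_arch_simple by blast
      then show ?thesis using c(2)[of n] by (intro exI[of _ n]) simp
    qed
    then show ?thesis using c(1) by blast
  qed
  then obtain c where c: "\<And>n::nat. c n \<in> A" "\<And>x. x \<in> A \<Longrightarrow> \<exists>n. x \<le> c n" by blast
  \<comment> \<open>Running maxima of the cofinal sequence are still points of \<open>A\<close>, but
    increasing, so continuity from below applies.\<close>
  define m where "m n = Max (c ` {..n})" for n
  have m: "m n \<in> A" for n
  proof -
    have "m n \<in> c ` {..n}" unfolding m_def by (intro Max_in) auto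
    then show ?thesis using c by auto
  qed
  have mc: "c n \<le> m n" for n unfolding m_def by (intro Max_ge) auto
  have inc: "mono m" unfolding m_def by (intro monoI Max_mono) auto
  have "A = (\<Union>n. A \<inter> {..m n})"
  proof (intro equalityI subsetI)
    fix x assume "x \<in> A"
    then obtain n where "x \<le> c n" using c(2) by blast
    then have "x \<le> m n" using mc[of n] by simp
    then show "x \<in> (\<Union>n. A \<inter> {..m n})" using \<open>x \<in> A\<close> by blast
  qed auto
  moreover have "(SUP n. emeasure lborel (A \<inter> {..m n})) = emeasure lborel (\<Union>n. A \<inter> {..m n})"
  proof (intro SUP_emeasure_incseq)
    show "incseq (\<lambda>n. A \<inter> {..m n})"
    proof (rule incseq_SucI)
      fix n
      have "m n \<le> m (Suc n)" using inc by (rule monoD) simp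
      then show "A \<inter> {..m n} \<subseteq> A \<inter> {..m (Suc n)}" by auto
    qed
  qed (use A(1) in auto)
  ultimately have "emeasure lborel A = (SUP n. emeasure lborel (A \<inter> {..m n}))" by simp
  also have "\<dots> \<le> M" using le m by (intro SUP_least) auto
  finally show ?thesis .
qed

lemma emeasure_lborel_uminus:
  fixes A :: "'a::euclidean_space set"
  assumes "A \<in> sets borel"
  shows "emeasure lborel (uminus ` A) = emeasure lborel A"
proof -
  have "uminus ` A = uminus -` A" by (force simp: image_iff)
  moreover have "emeasure lborel (uminus -` A) = emeasure (distr lborel borel uminus) A"
    using assms by (subst emeasure_distr) auto
  moreover have "distr lborel borel uminus = (lborel :: 'a measure)"
    using lborel_affine[of "-1" "0::'a"] by (simp add: density_1)
  ultimately show ?thesis by simp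
qed

text \<open>For \<open>a \<in> A\<close> and \<open>b \<in> B\<close>, half the sum of
  \<open>A \<inter> {..a}\<close> and b, and half the sum of a and \<open>B \<inter> {b..}\<close>,
  lie in \<open>C\<close> on the two sides of \<open>(a + b) / 2\<close>. They overlap in at most
  one point, so their measures, which are half the original ones, add up. Then a and b are driven to
  the ends of the two sets.\<close>

lemma brunn_minkowski_real:
  fixes A B C :: "real set"
  assumes [measurable]: "A \<in> sets borel" "B \<in> sets borel" "C \<in> sets borel"
    and ne: "A \<noteq> {}" "B \<noteq> {}"
    and mid: "\<And>a b. a \<in> A \<Longrightarrow> b \<in> B \<Longrightarrow> (a + b) / 2 \<in> C"
  shows "emeasure lborel A + emeasure lborel B \<le> 2 * emeasure lborel C"
proof -
  have half: "emeasure lborel X = 2 * emeasure lborel ((\<lambda>x. 2 * x - t) -` X)"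
    if [measurable]: "X \<in> sets borel" for X :: "real set" and t
  proof -
    have "emeasure lborel X = emeasure (density (distr lborel borel (\<lambda>x. - t + 2 * x)) (\<lambda>_. ennreal \<bar>2\<bar>)) X"
      using lborel_real_affine[of 2 "-t"] by simp
    also have "\<dots> = 2 * emeasure lborel ((\<lambda>x. - t + 2 * x) -` X)"
      by (simp add: emeasure_density nn_integral_cmult emeasure_distr)
    also have "(\<lambda>x. - t + 2 * x) = (\<lambda>x. 2 * x - t)" by auto
    finally show ?thesis .
  qed
  have key: "emeasure lborel (A \<inter> {..a}) + emeasure lborel (B \<inter> {b..}) \<le> 2 * emeasure lborel C"
    if "a \<in> A" "b \<in> B" for a b
  proof -
    let ?X = "(\<lambda>x. 2 * x - b) -` (A \<inter> {..a})" and ?Y = "(\<lambda>x. 2 * x - a) -` (B \<inter> {b<..})"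
    have [measurable]: "?X \<in> sets borel" "?Y \<in> sets borel"
      by (rule measurable_sets_borel[of _ borel]; measurable)+
    \<comment> \<open>Dropping the null point \<open>b\<close> makes \<open>?X\<close> and
      \<open>?Y\<close> disjoint: the midpoint \<open>(a + b) / 2\<close> then belongs to
      \<open>?X\<close> only.\<close>
    have "emeasure lborel (B \<inter> {b..}) \<le> emeasure lborel (B \<inter> {b<..})"
    proof -
      have "emeasure lborel (B \<inter> {b..}) \<le> emeasure lborel ((B \<inter> {b<..}) \<union> {b})"
        by (intro emeasure_mono) auto
      also have "\<dots> \<le> emeasure lborel (B \<inter> {b<..}) + emeasure lborel {b}"
        by (intro emeasure_subadditive) auto
      finally show ?thesis by simp
    qed
    then have "emeasure lborel (A \<inter> {..a}) + emeasure lborel (B \<inter> {b..})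
        \<le> emeasure lborel (A \<inter> {..a}) + emeasure lborel (B \<inter> {b<..})"
      by (intro add_mono) auto
    also have "\<dots> = 2 * (emeasure lborel ?X + emeasure lborel ?Y)"
      using half[of "A \<inter> {..a}" b] half[of "B \<inter> {b<..}" a] by (simp add: distrib_left)
    also have "emeasure lborel ?X + emeasure lborel ?Y = emeasure lborel (?X \<union> ?Y)"
      by (intro plus_emeasure) auto
    also have "\<dots> \<le> emeasure lborel C"
    proof (intro emeasure_mono)
      show "?X \<union> ?Y \<subseteq> C"
      proof
        fix x assume "x \<in> ?X \<union> ?Y"
        then show "x \<in> C"
          using mid[of "2 * x - b" b] mid[of a "2 * x - a"] that by auto
      qed
    qed auto
    finally show ?thesis by (auto simp: mult_left_mono)
  qed
  \<comment> \<open>The passage to the limit in one of the two sets, the measure of the other being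
    carried along as \<open>\<alpha>\<close>. Finiteness of \<open>\<gamma>\<close> permits
    subtracting \<open>\<alpha>\<close>.\<close>
  have step: "\<alpha> + emeasure lborel D \<le> \<gamma>"
    if "D \<in> sets borel" "D \<noteq> {}" "\<gamma> \<noteq> \<infinity>"
      "\<And>b. b \<in> D \<Longrightarrow> \<alpha> + emeasure lborel (D \<inter> {..b}) \<le> \<gamma>" for \<alpha> \<gamma> :: ennreal and D :: "real set"
  proof -
    obtain b where b: "b \<in> D" using \<open>D \<noteq> {}\<close> by auto
    have "\<alpha> \<le> \<gamma>" by (rule order_trans[OF _ that(4)[OF b]]) simp
    then have fin: "\<alpha> \<noteq> \<infinity>" using that(3) by (auto simp: top_unique)
    have "emeasure lborel D \<le> \<gamma> - \<alpha>"
    proof (rule emeasure_le_of_initial_segments[OF that(1,2)])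
      fix b assume "b \<in> D"
      have "emeasure lborel (D \<inter> {..b}) = (\<alpha> + emeasure lborel (D \<inter> {..b})) - \<alpha>"
        using fin by simp
      also have "\<dots> \<le> \<gamma> - \<alpha>" by (intro ennreal_minus_mono that(4) \<open>b \<in> D\<close> order_refl)
      finally show "emeasure lborel (D \<inter> {..b}) \<le> \<gamma> - \<alpha>" .
    qed
    then have "\<alpha> + emeasure lborel D \<le> \<alpha> + (\<gamma> - \<alpha>)" by (rule add_left_mono)
    also have "\<dots> = \<gamma>" using \<open>\<alpha> \<le> \<gamma>\<close> by (rule add_diff_inverse_ennreal)
    finally show ?thesis .
  qed
  show ?thesis
  proof (cases "emeasure lborel C = \<infinity>")
    case True
    then show ?thesis by (simp add: ennreal_mult_eq_top_iff)
  next
    case False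
    then have fin: "2 * emeasure lborel C \<noteq> \<infinity>" by (simp add: ennreal_mult_eq_top_iff)
    \<comment> \<open>Reflection turns the final segments of \<open>B\<close> into initial ones, so
      that the same limit argument serves both sets.\<close>
    have "uminus ` B = uminus -` B" by (force simp: image_iff)
    moreover have "uminus -` B \<in> sets borel"
      by (rule measurable_sets_borel[of _ borel]; measurable)
    ultimately have sB: "uminus ` B \<in> sets borel" by simp
    have sA: "A \<in> sets borel" by measurable
    have "emeasure lborel (A \<inter> {..a}) + emeasure lborel (uminus ` B) \<le> 2 * emeasure lborel C"
      if "a \<in> A" for a
    proof (rule step[OF sB _ fin])
      fix b' assume "b' \<in> uminus ` B"
      then obtain b where b: "b' = - b" "b \<in> B" by auto
      have "uminus ` B \<inter> {..b'} = uminus ` (B \<inter> {b..})" using b by auto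
      then have "emeasure lborel (uminus ` B \<inter> {..b'}) = emeasure lborel (B \<inter> {b..})"
        by (simp add: emeasure_lborel_uminus)
      then show "emeasure lborel (A \<inter> {..a}) + emeasure lborel (uminus ` B \<inter> {..b'}) \<le> 2 * emeasure lborel C"
        using key[OF that b(2)] by simp
    qed (use ne in auto)
    then have "emeasure lborel (uminus ` B) + emeasure lborel (A \<inter> {..a}) \<le> 2 * emeasure lborel C"
      if "a \<in> A" for a using that by (simp add: add.commute)
    then have "emeasure lborel (uminus ` B) + emeasure lborel A \<le> 2 * emeasure lborel C"
      by (rule step[OF sA ne(1) fin])
    then show ?thesis by (simp add: emeasure_lborel_uminus add.commute)
  qed
qed

text \<open>Cavalieri's principle, by Fubini on the region under the graph. Only levels in (0, 1)
  are kept; at these the superlevel sets of functions with supremum 1 are nonempty, as the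
  Brunn-Minkowski inequality demands.\<close>

lemma nn_integral_layer_cake:
  fixes f :: "real \<Rightarrow> ennreal"
  assumes [measurable]: "f \<in> borel_measurable borel" and le: "\<And>x. f x \<le> 1"
  shows "(\<integral>\<^sup>+x. f x \<partial>lborel) = (\<integral>\<^sup>+t. indicator {0<..<1} t * emeasure lborel {x. ennreal t < f x} \<partial>lborel)"
proof -
  have "(\<integral>\<^sup>+t. indicator {0<..<1} t * emeasure lborel {x. ennreal t < f x} \<partial>lborel)
      = (\<integral>\<^sup>+t. (\<integral>\<^sup>+x. indicator {0<..<1} t * indicator {z. ennreal (fst z) < f (snd z)} (t, x) \<partial>lborel) \<partial>lborel)"
    by (intro nn_integral_cong) (auto simp: nn_integral_cmult nn_integral_indicator[symmetric] simp del: nn_integral_indicator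
        intro!: arg_cong2[where f="(*)"] nn_integral_cong split: split_indicator)
  also have "\<dots> = (\<integral>\<^sup>+x. (\<integral>\<^sup>+t. indicator {0<..<1} t * indicator {z. ennreal (fst z) < f (snd z)} (t, x) \<partial>lborel) \<partial>lborel)"
    by (intro lborel_pair.Fubini') measurable
  also have "\<dots> = (\<integral>\<^sup>+x. f x \<partial>lborel)"
  proof (intro nn_integral_cong)
    fix x
    obtain r where r: "f x = ennreal r" "0 \<le> r" "r \<le> 1"
      using le[of x] by (cases "f x") (auto simp: top_unique)
    have "(\<integral>\<^sup>+t. indicator {0<..<1} t * indicator {z. ennreal (fst z) < f (snd z)} (t, x) \<partial>lborel)
        = (\<integral>\<^sup>+t. indicator ({0<..<r} \<inter> {..<1}) t \<partial>lborel)"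
      using r by (intro nn_integral_cong) (auto split: split_indicator simp: ennreal_less_iff)
    also have "{0<..<r} \<inter> {..<1} = {0<..<r}" using r by auto
    finally show "(\<integral>\<^sup>+t. indicator {0<..<1} t * indicator {z. ennreal (fst z) < f (snd z)} (t, x) \<partial>lborel) = f x"
      using r by simp
  qed
  finally show ?thesis by simp
qed

text \<open>Midpoints of the superlevel sets of \<open>f\<close> and \<open>g\<close> at level t lie
  in that of \<open>h\<close>, so Brunn-Minkowski holds level by level and is integrated over t. The
  function \<open>h\<close> may exceed 1 and is cut off at 1 before its levels are
  integrated.\<close>

lemma prekopa_leindler_normalized:
  fixes f g h :: "real \<Rightarrow> ennreal"
  assumes [measurable]: "f \<in> borel_measurable borel" "g \<in> borel_measurable borel" "h \<in> borel_measurable borel"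
    and f: "\<And>x. f x \<le> 1" "\<And>t. t < 1 \<Longrightarrow> \<exists>x. t < f x"
    and g: "\<And>x. g x \<le> 1" "\<And>t. t < 1 \<Longrightarrow> \<exists>x. t < g x"
    and mid: "\<And>x y. min (f x) (g y) \<le> h ((x + y) / 2)"
  shows "(\<integral>\<^sup>+x. f x \<partial>lborel) + (\<integral>\<^sup>+x. g x \<partial>lborel) \<le> 2 * (\<integral>\<^sup>+x. h x \<partial>lborel)"
proof -
  define k where "k x = min 1 (h x)" for x
  have [measurable]: "k \<in> borel_measurable borel" unfolding k_def by measurable
  have k: "k x \<le> 1" for x by (simp add: k_def)
  have *: "emeasure lborel {x. ennreal t < f x} + emeasure lborel {x. ennreal t < g x}
      \<le> 2 * emeasure lborel {x. ennreal t < k x}" if "0 < t" "t < 1" for t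
  proof (rule brunn_minkowski_real)
    show "{x. ennreal t < f x} \<noteq> {}" "{x. ennreal t < g x} \<noteq> {}"
      using f(2)[of t] g(2)[of t] that by auto
    fix a b assume "a \<in> {x. ennreal t < f x}" "b \<in> {x. ennreal t < g x}"
    then have "ennreal t < min (f a) (g b)" by simp
    also note mid[of a b]
    finally show "(a + b) / 2 \<in> {x. ennreal t < k x}" using that by (simp add: k_def)
  qed measurable
  have "(\<integral>\<^sup>+x. f x \<partial>lborel) + (\<integral>\<^sup>+x. g x \<partial>lborel)
     = (\<integral>\<^sup>+t. indicator {0<..<1} t * emeasure lborel {x. ennreal t < f x}
          + indicator {0<..<1} t * emeasure lborel {x. ennreal t < g x} \<partial>lborel)"
    by (subst (1 2) nn_integral_layer_cake) (auto simp: f g nn_integral_add)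
  also have "\<dots> \<le> (\<integral>\<^sup>+t. 2 * (indicator {0<..<1} t * emeasure lborel {x. ennreal t < k x}) \<partial>lborel)"
    by (intro nn_integral_mono) (auto split: split_indicator simp: *)
  also have "\<dots> = 2 * (\<integral>\<^sup>+x. k x \<partial>lborel)"
    by (subst (2) nn_integral_layer_cake) (auto simp: k nn_integral_cmult)
  also have "\<dots> \<le> 2 * (\<integral>\<^sup>+x. h x \<partial>lborel)"
    by (intro mult_left_mono nn_integral_mono) (auto simp: k_def)
  finally show ?thesis .
qed

section \<open>The multiplicative Prekopa-Leindler inequality\<close>

lemma ennreal_am_gm:
  fixes P Q R :: ennreal
  assumes "P + Q \<le> 2 * R"
  shows "P * Q \<le> R\<^sup>2"
proof (cases "R = \<infinity>")
  case True
  then show ?thesis by (simp add: power2_eq_square ennreal_mult_eq_top_iff)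
next
  case False
  then obtain r where r: "R = ennreal r" "0 \<le> r" by (cases R) auto
  have "P + Q < \<infinity>" using assms r by (metis ennreal_mult_less_top ennreal_numeral_less_top ennreal_less_top infinity_ennreal_def le_less_trans)
  then obtain p q where pq: "P = ennreal p" "0 \<le> p" "Q = ennreal q" "0 \<le> q"
    by (cases P; cases Q) auto
  have "ennreal (p + q) \<le> ennreal (2 * r)"
    using assms pq r by (simp add: ennreal_plus ennreal_mult)
  then have "p + q \<le> 2 * r" using r by (subst (asm) ennreal_le_iff) auto
  then have "(p + q)\<^sup>2 \<le> (2 * r)\<^sup>2" using pq by (intro power_mono) auto
  moreover have "4 * (p * q) \<le> (p + q)\<^sup>2"
    using zero_le_power2[of "p - q"] by (simp add: power2_eq_square algebra_simps)
  ultimately have "p * q \<le> r\<^sup>2" by (simp add: power2_eq_square)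
  then show ?thesis using pq r by (simp add: ennreal_mult[symmetric] ennreal_power ennreal_leI)
qed

lemma ennreal_power2_le_imp_le:
  fixes a b :: ennreal
  assumes "a\<^sup>2 \<le> b\<^sup>2"
  shows "a \<le> b"
proof (cases "b = \<infinity>")
  case False
  then obtain r where r: "b = ennreal r" "0 \<le> r" by (cases b) auto
  have "a\<^sup>2 < \<infinity>" using assms r by (simp add: ennreal_power order_le_less_trans)
  then have "a \<noteq> \<infinity>" by (auto simp: power2_eq_square)
  then obtain s where s: "a = ennreal s" "0 \<le> s" by (cases a) auto
  have "s\<^sup>2 \<le> r\<^sup>2" using assms r s by (simp add: ennreal_power)
  then have "s \<le> r" using r(2) by (rule power2_le_imp_le)
  then show ?thesis using r s by (simp add: ennreal_leI)
qed auto

text \<open>Dividing \<open>f\<close> and \<open>g\<close> by their suprema \<alpha> and \<beta>,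
  and \<open>h\<close> by the square root of \<alpha>\<beta>, preserves the midpoint condition and
  produces the normalized situation, since \<open>min\<close> of two numbers is at most their
  geometric mean. The inequality between the arithmetic and geometric means turns the resulting sum
  into a product. Boundedness keeps the suprema finite.\<close>

lemma prekopa_leindler_bounded:
  fixes f g h :: "real \<Rightarrow> ennreal"
  assumes [measurable]: "f \<in> borel_measurable borel" "g \<in> borel_measurable borel" "h \<in> borel_measurable borel"
    and bound: "\<And>x. f x \<le> ennreal M" "\<And>x. g x \<le> ennreal M"
    and mid: "\<And>x y. f x * g y \<le> (h ((x + y) / 2))\<^sup>2"
  shows "(\<integral>\<^sup>+x. f x \<partial>lborel) * (\<integral>\<^sup>+x. g x \<partial>lborel) \<le> (\<integral>\<^sup>+x. h x \<partial>lborel)\<^sup>2"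
proof -
  define a where "a = (SUP x. f x)"
  define b where "b = (SUP x. g x)"
  have fa: "f x \<le> a" and gb: "g x \<le> b" for x by (auto simp: a_def b_def intro: SUP_upper)
  have "a \<le> ennreal M" "b \<le> ennreal M" unfolding a_def b_def by (auto intro!: SUP_least bound)
  then obtain \<alpha> \<beta> where ab: "a = ennreal \<alpha>" "0 \<le> \<alpha>" "b = ennreal \<beta>" "0 \<le> \<beta>"
    by (cases a; cases b) (auto simp: top_unique)
  show ?thesis
  proof (cases "\<alpha> = 0 \<or> \<beta> = 0")
    case True
    then have "(\<forall>x. f x = 0) \<or> (\<forall>x. g x = 0)" using fa gb ab by auto
    then show ?thesis by auto
  next
    case False
    then have pos: "0 < \<alpha>" "0 < \<beta>" using ab by auto
    define s where "s = sqrt (\<alpha> * \<beta>)"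
    have s: "0 < s" "s\<^sup>2 = \<alpha> * \<beta>" using pos by (auto simp: s_def)
    define F G H where "F x = ennreal (1/\<alpha>) * f x" and "G x = ennreal (1/\<beta>) * g x"
      and "H x = ennreal (1/s) * h x" for x
    have [measurable]: "F \<in> borel_measurable borel" "G \<in> borel_measurable borel" "H \<in> borel_measurable borel"
      unfolding F_def G_def H_def by measurable
    have cancel: "ennreal c * (ennreal (1/c) * y) = y" if "0 < c" for c y
      using that by (simp add: mult.assoc[symmetric] ennreal_mult[symmetric])
    have cancel': "ennreal (1/c) * (ennreal c * y) = y" if "0 < c" for c y
      using that by (simp add: mult.assoc[symmetric] ennreal_mult[symmetric])
    have norm: "(\<forall>x. ennreal (1/c) * u x \<le> 1) \<and> (\<forall>t<1. \<exists>x. t < ennreal (1/c) * u x)"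
      if "0 < c" "(SUP x. u x) = ennreal c" for c and u :: "real \<Rightarrow> ennreal"
    proof safe
      fix x
      have "u x \<le> ennreal c" using that(2) by (metis SUP_upper UNIV_I)
      then have "ennreal (1/c) * u x \<le> ennreal (1/c) * ennreal c" by (rule mult_left_mono) simp
      then show "ennreal (1/c) * u x \<le> 1" using that(1) by (simp add: ennreal_mult[symmetric])
    next
      fix t :: ennreal assume "t < 1"
      then have "ennreal c * t < ennreal c * 1" using that(1) by (intro ennreal_mult_strict_left_mono) auto
      then have "ennreal c * t < (SUP x. u x)" using that by simp
      then obtain x where "ennreal c * t < u x" by (auto simp: less_SUP_iff)
      then have "ennreal (1/c) * (ennreal c * t) < ennreal (1/c) * u x"
        using that(1) by (intro ennreal_mult_strict_left_mono) auto
      then show "\<exists>x. t < ennreal (1/c) * u x" using cancel'[OF that(1)] by auto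
    qed
    have "(\<integral>\<^sup>+x. F x \<partial>lborel) + (\<integral>\<^sup>+x. G x \<partial>lborel) \<le> 2 * (\<integral>\<^sup>+x. H x \<partial>lborel)"
    proof (rule prekopa_leindler_normalized)
      fix x y
      have "(min (F x) (G y))\<^sup>2 \<le> F x * G y" unfolding power2_eq_square by (intro mult_mono) auto
      also have "\<dots> = ennreal (1/(\<alpha>*\<beta>)) * (f x * g y)"
        using pos unfolding F_def G_def
        by (simp add: mult_ac ennreal_mult[symmetric] flip: mult.assoc)
      also have "\<dots> \<le> ennreal (1/(\<alpha>*\<beta>)) * (h ((x + y) / 2))\<^sup>2" by (intro mult_left_mono mid) auto
      also have "\<dots> = (H ((x + y)/2))\<^sup>2"
        using s by (simp add: H_def power_mult_distrib ennreal_power power_divide)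
      finally show "min (F x) (G y) \<le> H ((x + y) / 2)"
        by (rule ennreal_power2_le_imp_le)
    qed (use norm[OF pos(1), of f] norm[OF pos(2), of g] ab in \<open>auto simp: a_def b_def F_def G_def\<close>)
    then have le: "(\<integral>\<^sup>+x. F x \<partial>lborel) * (\<integral>\<^sup>+x. G x \<partial>lborel) \<le> (\<integral>\<^sup>+x. H x \<partial>lborel)\<^sup>2"
      by (rule ennreal_am_gm)
    have "(\<integral>\<^sup>+x. f x \<partial>lborel) = ennreal \<alpha> * (\<integral>\<^sup>+x. F x \<partial>lborel)"
      "(\<integral>\<^sup>+x. g x \<partial>lborel) = ennreal \<beta> * (\<integral>\<^sup>+x. G x \<partial>lborel)"
      "(\<integral>\<^sup>+x. h x \<partial>lborel) = ennreal s * (\<integral>\<^sup>+x. H x \<partial>lborel)"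
      unfolding F_def G_def H_def using pos s by (simp_all add: nn_integral_cmult cancel)
    then have "(\<integral>\<^sup>+x. f x \<partial>lborel) * (\<integral>\<^sup>+x. g x \<partial>lborel)
        = ennreal (\<alpha> * \<beta>) * ((\<integral>\<^sup>+x. F x \<partial>lborel) * (\<integral>\<^sup>+x. G x \<partial>lborel))"
      using pos by (simp add: ennreal_mult mult_ac)
    also have "\<dots> \<le> ennreal (\<alpha> * \<beta>) * (\<integral>\<^sup>+x. H x \<partial>lborel)\<^sup>2" by (intro mult_left_mono le) auto
    also have "\<dots> = (ennreal s * (\<integral>\<^sup>+x. H x \<partial>lborel))\<^sup>2"
      using s by (simp add: power_mult_distrib ennreal_power)
    also have "\<dots> = (\<integral>\<^sup>+x. h x \<partial>lborel)\<^sup>2"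
      unfolding H_def using s by (simp add: nn_integral_cmult cancel)
    finally show ?thesis .
  qed
qed

text \<open>Truncation at height n and monotone convergence. The product of two suprema involves two
  truncation heights; it is bounded by the diagonal case at their maximum.\<close>

lemma prekopa_leindler_real:
  fixes f g h :: "real \<Rightarrow> ennreal"
  assumes [measurable]: "f \<in> borel_measurable borel" "g \<in> borel_measurable borel" "h \<in> borel_measurable borel"
    and mid: "\<And>x y. f x * g y \<le> (h ((x + y) / 2))\<^sup>2"
  shows "(\<integral>\<^sup>+x. f x \<partial>lborel) * (\<integral>\<^sup>+x. g x \<partial>lborel) \<le> (\<integral>\<^sup>+x. h x \<partial>lborel)\<^sup>2"
proof -
  have trunc: "(\<integral>\<^sup>+x. u x \<partial>lborel) = (SUP n. \<integral>\<^sup>+x. min (u x) (ennreal (real n)) \<partial>lborel)"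
    if [measurable]: "u \<in> borel_measurable borel" for u :: "real \<Rightarrow> ennreal"
  proof -
    have "(SUP n. min (u x) (ennreal (real n))) = u x" for x
    proof -
      have "(SUP n. min (u x) (ennreal (real n))) = inf (u x) (SUP n. ennreal (real n))"
        by (simp add: inf_min[symmetric] inf_SUP)
      also have "(SUP n. ennreal (real n)) = \<infinity>"
        by (simp add: ennreal_SUP_of_nat_eq_top ennreal_of_nat_eq_real_of_nat[symmetric])
      finally show ?thesis by simp
    qed
    then show ?thesis
      by (subst nn_integral_monotone_convergence_SUP[symmetric])
         (auto simp: incseq_def le_fun_def min_le_iff_disj intro!: ennreal_leI)
  qed
  have inc: "incseq (\<lambda>n. \<integral>\<^sup>+x. min (u x) (ennreal (real n)) \<partial>lborel)" for u :: "real \<Rightarrow> ennreal"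
    by (auto simp: incseq_def min_le_iff_disj intro!: nn_integral_mono ennreal_leI)
  have diag: "(\<integral>\<^sup>+x. min (f x) (ennreal (real n)) \<partial>lborel) * (\<integral>\<^sup>+x. min (g x) (ennreal (real n)) \<partial>lborel)
      \<le> (\<integral>\<^sup>+x. h x \<partial>lborel)\<^sup>2" for n
  proof (rule prekopa_leindler_bounded[where M = "real n"])
    fix x y
    have "min (f x) (ennreal (real n)) * min (g y) (ennreal (real n)) \<le> f x * g y" by (intro mult_mono) auto
    also note mid
    finally show "min (f x) (ennreal (real n)) * min (g y) (ennreal (real n)) \<le> (h ((x + y) / 2))\<^sup>2" .
  qed auto
  have *: "(\<integral>\<^sup>+x. min (f x) (ennreal (real i)) \<partial>lborel) * (\<integral>\<^sup>+x. min (g x) (ennreal (real j)) \<partial>lborel)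
      \<le> (\<integral>\<^sup>+x. h x \<partial>lborel)\<^sup>2" for i j
  proof -
    have "(\<integral>\<^sup>+x. min (f x) (ennreal (real i)) \<partial>lborel) * (\<integral>\<^sup>+x. min (g x) (ennreal (real j)) \<partial>lborel)
      \<le> (\<integral>\<^sup>+x. min (f x) (ennreal (real (max i j))) \<partial>lborel)
        * (\<integral>\<^sup>+x. min (g x) (ennreal (real (max i j))) \<partial>lborel)"
      by (intro mult_mono incseqD[OF inc] max.cobounded1 max.cobounded2 zero_le)
    also note diag
    finally show ?thesis .
  qed
  show ?thesis
    unfolding trunc[OF assms(1)] trunc[OF assms(2)] SUP_mult_right_ennreal SUP_mult_left_ennreal
    by (intro SUP_least *)
qed

text \<open>The induction hypothesis, applied to the slices at heights s, t and (s + t)/2, says that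
  the partial integrals satisfy the midpoint condition in the remaining variable, to which the
  inequality on the line applies. The induction closes because hypothesis and conclusion have the
  same shape in every dimension.\<close>

lemma prekopa_leindler_PiM:
  fixes f g h :: "('i \<Rightarrow> real) \<Rightarrow> ennreal"
  assumes "finite I"
    and "f \<in> borel_measurable (\<Pi>\<^sub>M i\<in>I. lborel)" "g \<in> borel_measurable (\<Pi>\<^sub>M i\<in>I. lborel)"
      "h \<in> borel_measurable (\<Pi>\<^sub>M i\<in>I. lborel)"
    and "\<And>x y. \<lbrakk>x \<in> extensional I; y \<in> extensional I\<rbrakk>
      \<Longrightarrow> f x * g y \<le> (h (\<lambda>i\<in>I. (x i + y i) / 2))\<^sup>2"
  shows "(\<integral>\<^sup>+x. f x \<partial>(\<Pi>\<^sub>M i\<in>I. lborel)) * (\<integral>\<^sup>+x. g x \<partial>(\<Pi>\<^sub>M i\<in>I. lborel))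
    \<le> (\<integral>\<^sup>+x. h x \<partial>(\<Pi>\<^sub>M i\<in>I. lborel))\<^sup>2"
  using assms
proof (induction I arbitrary: f g h rule: finite_induct)
  case empty
  interpret product_sigma_finite "\<lambda>_. lborel :: real measure" ..
  show ?case using empty.prems(4)[of "\<lambda>_. undefined" "\<lambda>_. undefined"]
    by (simp add: nn_integral_empty restrict_def)
next
  case (insert i I)
  interpret product_sigma_finite "\<lambda>_. lborel :: real measure" ..
  note [measurable] = insert.prems(1-3)
  note fi = product_nn_integral_insert_rev[OF insert.hyps(1,2)]
  have meas: "(\<lambda>y. \<integral>\<^sup>+x. u (x(i := y)) \<partial>(\<Pi>\<^sub>M i\<in>I. lborel)) \<in> borel_measurable borel"
    if [measurable]: "u \<in> borel_measurable (\<Pi>\<^sub>M i\<in>insert i I. lborel)" for u :: "('i \<Rightarrow> real) \<Rightarrow> ennreal"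
  proof -
    interpret finite_product_sigma_finite "\<lambda>_. lborel :: real measure" I by standard (rule insert.hyps)
    have "(\<lambda>y. \<integral>\<^sup>+x. u (x(i := y)) \<partial>(\<Pi>\<^sub>M i\<in>I. lborel)) \<in> borel_measurable lborel"
      by (rule borel_measurable_nn_integral) measurable
    then show ?thesis by simp
  qed
  show ?case
    unfolding fi[OF insert.prems(1)] fi[OF insert.prems(2)] fi[OF insert.prems(3)]
  proof (rule prekopa_leindler_real[OF meas[OF insert.prems(1)] meas[OF insert.prems(2)] meas[OF insert.prems(3)]])
    fix s t :: real
    show "(\<integral>\<^sup>+x. f (x(i := s)) \<partial>(\<Pi>\<^sub>M i\<in>I. lborel)) * (\<integral>\<^sup>+x. g (x(i := t)) \<partial>(\<Pi>\<^sub>M i\<in>I. lborel))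
      \<le> (\<integral>\<^sup>+x. h (x(i := (s + t) / 2)) \<partial>(\<Pi>\<^sub>M i\<in>I. lborel))\<^sup>2"
    proof (rule insert.IH)
      fix x y :: "'i \<Rightarrow> real" assume xy: "x \<in> extensional I" "y \<in> extensional I"
      have fun_upd_in_ext: "x(i := s) \<in> extensional (insert i I)" "y(i := t) \<in> extensional (insert i I)"
        using xy by (auto simp: extensional_def)
      have "(\<lambda>j\<in>insert i I. ((x(i := s)) j + (y(i := t)) j) / 2) = (\<lambda>j\<in>I. (x j + y j) / 2)(i := (s + t) / 2)"
        using insert.hyps by (auto simp: fun_eq_iff)
      then show "f (x(i := s)) * g (y(i := t)) \<le> (h ((\<lambda>j\<in>I. (x j + y j) / 2)(i := (s + t) / 2)))\<^sup>2"
        using insert.prems(4)[of "x(i := s)" "y(i := t)"] fun_upd_in_ext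
        by (simp only:)
    qed measurable
  qed
qed

text \<open>The case of indicator functions: a form of the Brunn-Minkowski inequality without n-th
  roots.\<close>

lemma emeasure_midpoint_set:
  fixes A B C :: "'a::euclidean_space set"
  assumes [measurable]: "A \<in> sets borel" "B \<in> sets borel" "C \<in> sets borel"
    and mid: "\<And>a b. a \<in> A \<Longrightarrow> b \<in> B \<Longrightarrow> (1/2) *\<^sub>R (a + b) \<in> C"
  shows "emeasure lborel A * emeasure lborel B \<le> (emeasure lborel C)\<^sup>2"
proof -
  define T where "T x = (\<Sum>b\<in>Basis. x b *\<^sub>R b)" for x :: "'a \<Rightarrow> real"
  have [measurable]: "T \<in> borel_measurable (\<Pi>\<^sub>M b\<in>Basis. lborel)" unfolding T_def by measurable
  have lborel: "(lborel :: 'a measure) = distr (\<Pi>\<^sub>M b\<in>Basis. lborel) borel T"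
    unfolding T_def by (subst lborel_def) (simp add: lborel_eq_real)
  have eq: "emeasure lborel X = (\<integral>\<^sup>+x. indicator X (T x) \<partial>(\<Pi>\<^sub>M b\<in>Basis. lborel))"
    if [measurable]: "X \<in> sets borel" for X
  proof -
    have "emeasure lborel X = (\<integral>\<^sup>+x. indicator X x \<partial>(lborel :: 'a measure))" by simp
    also have "\<dots> = (\<integral>\<^sup>+x. indicator X (T x) \<partial>(\<Pi>\<^sub>M b\<in>Basis. lborel))"
      by (subst lborel, subst nn_integral_distr) auto
    finally show ?thesis .
  qed
  have Tmid: "T (\<lambda>b\<in>Basis. (x b + y b) / 2) = (1/2) *\<^sub>R (T x + T y)" for x y
    unfolding T_def by (simp add: scaleR_sum_right sum.distrib[symmetric] algebra_simps add_divide_distrib)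
  show ?thesis unfolding eq[OF assms(1)] eq[OF assms(2)] eq[OF assms(3)]
    by (rule prekopa_leindler_PiM) (use mid in \<open>auto simp: Tmid split: split_indicator\<close>)
qed


section \<open>Coordinate subspaces and cylinders over their subsets\<close>

definition proj_coords :: "'a::euclidean_space set \<Rightarrow> 'a \<Rightarrow> 'a" where
  "proj_coords J y = (\<Sum>b\<in>J. (y \<bullet> b) *\<^sub>R b)"

text \<open>Testing \<open>X \<subseteq> span J\<close> on the cylinder over \<open>X\<close> lets the Lebesgue measure of the whole space play
  the role of the \<open>card J\<close>-dimensional one, for which there is no type.\<close>

definition cylinder :: "'a::euclidean_space set \<Rightarrow> 'a set \<Rightarrow> 'a set" where
  "cylinder J X = {y. proj_coords J y \<in> X \<and> norm (y - proj_coords J y) \<le> 1}"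

lemma linear_proj_coords: "linear (proj_coords J)"
  unfolding proj_coords_def
  by (intro linear_compose_sum ballI linearI) (auto simp: algebra_simps)

lemma proj_coords_inner:
  assumes "J \<subseteq> Basis" "b \<in> Basis"
  shows "proj_coords J y \<bullet> b = (if b \<in> J then y \<bullet> b else 0)"
proof -
  have "finite J" using assms finite_Basis finite_subset by blast
  have "proj_coords J y \<bullet> b = (\<Sum>c\<in>J. (y \<bullet> c) * (c \<bullet> b))" by (simp add: proj_coords_def inner_sum_left)
  also have "\<dots> = (\<Sum>c\<in>J. if c = b then y \<bullet> c else 0)"
    using assms by (intro sum.cong) (auto simp: inner_not_same_Basis)
  finally show ?thesis using \<open>finite J\<close> by simp
qed

lemma proj_coords_span:
  assumes "J \<subseteq> Basis" "x \<in> span J"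
  shows "proj_coords J x = x"
proof (rule euclidean_eqI)
  fix b :: 'a assume b: "b \<in> Basis"
  have "x \<bullet> b = 0" if "b \<notin> J"
    using assms(2)
  proof (induction rule: span_induct)
    case base
    show ?case by (simp add: subspace_def inner_left_distrib)
  next
    case (step c)
    then show ?case using assms(1) b that by (metis inner_Basis subsetD)
  qed
  then show "proj_coords J x \<bullet> b = x \<bullet> b" using assms b by (simp add: proj_coords_inner)
qed

lemma norm_proj_coords_le:
  assumes "J \<subseteq> Basis"
  shows "norm (proj_coords J x) \<le> norm x"
  by (rule norm_le_componentwise) (simp add: proj_coords_inner[OF assms])

lemma borel_measurable_proj_coords [measurable]: "proj_coords J \<in> borel_measurable borel"
  unfolding proj_coords_def[abs_def] by measurable

lemma cylinder_sets [measurable (raw)]: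
  assumes [measurable]: "X \<in> sets borel"
  shows "cylinder J X \<in> sets borel"
  unfolding cylinder_def by measurable

text \<open>The map \<open>T\<close> stretches the coordinates in \<open>J\<close> by
  \<open>r\<close>, leaves the others alone and translates by \<open>v\<close>. It pulls the
  cylinder over the given ball back to the one over the unit ball, and its Jacobian is
  \<open>r ^ card J\<close>.\<close>

lemma emeasure_cylinder_cball:
  fixes J :: "'a::euclidean_space set"
  assumes J: "J \<subseteq> Basis" and v: "v \<in> span J" and r: "0 < r"
  shows "emeasure lborel (cylinder J (cball v r)) = ennreal (r ^ card J) * emeasure lborel (cylinder J (cball 0 1))"
proof -
  have fin: "finite J" using assms finite_Basis finite_subset by blast
  define c where "c j = (if j \<in> J then r else 1)" for j
  define T where "T x = v + (\<Sum>j\<in>Basis. (c j * (x \<bullet> j)) *\<^sub>R j)" for x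
  have c: "\<And>j. j \<in> Basis \<Longrightarrow> c j \<noteq> 0" using r by (auto simp: c_def)
  have [measurable]: "T \<in> borel_measurable borel" unfolding T_def[abs_def] by measurable
  have prod: "(\<Prod>j\<in>Basis. \<bar>c j\<bar>) = r ^ card J"
  proof -
    have "(\<Prod>j\<in>Basis. \<bar>c j\<bar>) = (\<Prod>j\<in>J. \<bar>c j\<bar>)"
      using J by (intro prod.mono_neutral_right) (auto simp: c_def)
    also have "\<dots> = (\<Prod>j\<in>J. r)" using r by (intro prod.cong) (auto simp: c_def)
    finally show ?thesis by simp
  qed
  have inner: "T x \<bullet> b = v \<bullet> b + c b * (x \<bullet> b)" if "b \<in> Basis" for x b
    using that by (simp add: T_def inner_add_left inner_sum_left inner_Basis if_distrib sum.delta cong: if_cong)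
  have vb: "v \<bullet> b = 0" if "b \<in> Basis" "b \<notin> J" for b
    using proj_coords_inner[OF J that(1), of v] proj_coords_span[OF J v] that(2) by simp
  have PT: "proj_coords J (T x) = v + r *\<^sub>R proj_coords J x" for x
    by (rule euclidean_eqI) (auto simp: proj_coords_inner[OF J] inner inner_add_left c_def vb)
  have QT: "T x - proj_coords J (T x) = x - proj_coords J x" for x
    by (rule euclidean_eqI) (auto simp: proj_coords_inner[OF J] inner inner_diff_left c_def vb)
  have "T -` cylinder J (cball v r) = cylinder J (cball 0 1)"
    unfolding cylinder_def vimage_Collect_eq QT unfolding PT using r by (auto simp: dist_norm)
  moreover have "lborel = density (distr lborel borel T) (\<lambda>_. (\<Prod>j\<in>Basis. \<bar>c j\<bar>))"
    unfolding T_def[abs_def] by (rule lborel_affine_euclidean[OF c])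
  then have "emeasure lborel (cylinder J (cball v r))
    = emeasure (density (distr lborel borel T) (\<lambda>_. (\<Prod>j\<in>Basis. \<bar>c j\<bar>))) (cylinder J (cball v r))"
    by (rule arg_cong[where f = "\<lambda>M. emeasure M _"])
  ultimately show ?thesis
    using r by (simp add: emeasure_density nn_integral_cmult_indicator emeasure_distr prod)
qed

text \<open>This number plays the role of the volume of the unit ball of \<open>span J\<close>;
  comparisons of sums of radii are obtained by cancelling it.\<close>

lemma cylinder_unit_ball_pos_finite:
  fixes J :: "'a::euclidean_space set"
  assumes J: "J \<subseteq> Basis"
  shows "0 < emeasure lborel (cylinder J (cball 0 1))" "emeasure lborel (cylinder J (cball 0 1)) < \<infinity>"
proof -
  have 1: "norm (y - proj_coords J y) \<le> norm y" for y
    by (rule norm_le_componentwise) (simp add: proj_coords_inner[OF J] inner_diff_left)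
  have "ball 0 1 \<subseteq> cylinder J (cball (0::'a) 1)"
    using 1 norm_proj_coords_le[OF J] by (fastforce simp: cylinder_def intro: order_trans)
  then have "emeasure lborel (ball (0::'a) 1) \<le> emeasure lborel (cylinder J (cball (0::'a) 1))"
    by (intro emeasure_mono) auto
  moreover have "0 < emeasure lborel (ball (0::'a) 1)"
    by (simp add: emeasure_ball content_ball_pos)
  ultimately show "0 < emeasure lborel (cylinder J (cball (0::'a) 1))" by order
  have "cylinder J (cball 0 1) \<subseteq> cball (0::'a) 2"
  proof
    fix y assume "y \<in> cylinder J (cball 0 1)"
    then have "norm (proj_coords J y) \<le> 1" "norm (y - proj_coords J y) \<le> 1" by (auto simp: cylinder_def)
    then show "y \<in> cball 0 2" using norm_triangle_ineq[of "proj_coords J y" "y - proj_coords J y"] by simp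
  qed
  then have "emeasure lborel (cylinder J (cball (0::'a) 1)) \<le> emeasure lborel (cball (0::'a) 2)"
    by (intro emeasure_mono) auto
  also have "\<dots> < \<infinity>" by (intro emeasure_compact_finite) simp
  finally show "emeasure lborel (cylinder J (cball (0::'a) 1)) < \<infinity>" .
qed

text \<open>Midpoints of the cylinder over \<open>K\<close> and its reflection project to half
  differences of points of \<open>K\<close>, which have norm at most \<open>r\<close>, and stay
  within height 1 by convexity. The reflection has the same measure, so the midpoint inequality
  compares the squares of the two measures.\<close>

lemma isodiametric_cylinder:
  fixes J :: "'a::euclidean_space set"
  assumes J: "J \<subseteq> Basis" and K: "K \<in> sets borel" and r: "0 < r"
    and diam: "\<And>x y. x \<in> K \<Longrightarrow> y \<in> K \<Longrightarrow> dist x y \<le> 2 * r"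
  shows "emeasure lborel (cylinder J K) \<le> ennreal (r ^ card J) * emeasure lborel (cylinder J (cball 0 1))"
proof -
  let ?A = "cylinder J K" and ?C = "cylinder J (cball 0 r)"
  have [measurable]: "?A \<in> sets borel" using K by measurable
  have "uminus ` ?A = uminus -` ?A" by (force simp: image_iff)
  moreover have "uminus -` ?A \<in> sets borel"
    by (rule measurable_sets_borel[of _ borel]; measurable)
  ultimately have B[measurable]: "uminus ` ?A \<in> sets borel" by simp
  have "emeasure lborel ?A * emeasure lborel (uminus ` ?A) \<le> (emeasure lborel ?C)\<^sup>2"
  proof (rule emeasure_midpoint_set)
    fix a b assume ab: "a \<in> ?A" "b \<in> uminus ` ?A"
    then obtain c where c: "b = - c" "c \<in> ?A" by auto
    let ?p = "proj_coords J"
    have "?p ((1/2) *\<^sub>R (a + b)) = (1/2) *\<^sub>R (?p a - ?p c)"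
      by (simp add: c linear_add linear_diff linear_scale linear_proj_coords)
    moreover have "dist (?p a) (?p c) \<le> 2 * r" using ab c diam by (auto simp: cylinder_def)
    moreover have "(1/2) *\<^sub>R (a + b) - (1/2) *\<^sub>R (?p a - ?p c) = (1/2) *\<^sub>R ((a - ?p a) - (c - ?p c))"
      by (simp add: c algebra_simps)
    moreover have "norm ((a - ?p a) - (c - ?p c)) \<le> 1 + 1"
      using ab c by (intro order_trans[OF norm_triangle_ineq4[of "a - ?p a"]] add_mono) (auto simp: cylinder_def)
    ultimately show "(1/2) *\<^sub>R (a + b) \<in> ?C" by (simp add: cylinder_def dist_norm)
  qed measurable
  then have "(emeasure lborel ?A)\<^sup>2 \<le> (emeasure lborel ?C)\<^sup>2"
    by (simp add: emeasure_lborel_uminus power2_eq_square)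
  then have "emeasure lborel ?A \<le> emeasure lborel ?C" by (rule ennreal_power2_le_imp_le)
  then show ?thesis using emeasure_cylinder_cball[OF J span_zero r] by simp
qed

section \<open>Efficient covers by balls\<close>

lemma power_le_add_small:
  fixes r \<eta> :: real
  assumes "0 < \<eta>"
  obtains t where "0 < t" "(r + t) ^ n \<le> r ^ n + \<eta>"
proof -
  have "((\<lambda>t. (r + t) ^ n) \<longlongrightarrow> (r + 0) ^ n) (at_right 0)" by (intro tendsto_intros)
  then have "\<forall>\<^sub>F t in at_right 0. (r + t) ^ n < r ^ n + \<eta>"
    using assms by (intro order_tendstoD) auto
  then have "\<forall>\<^sub>F t in at_right (0::real). (r + t) ^ n < r ^ n + \<eta> \<and> 0 < t"
    by (intro eventually_conj eventually_at_right_less)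
  then have "\<exists>t. (r + t) ^ n < r ^ n + \<eta> \<and> 0 < t"
    by (rule eventually_happens'[OF trivial_limit_at_right_real])
  then obtain t where "(r + t) ^ n < r ^ n + \<eta> \<and> 0 < t" by blast
  then show ?thesis by (intro that[of t]) auto
qed

text \<open>The union \<open>K\<close> of the balls has diameter at most \<open>2 * (r + t)\<close>,
  and the cylinders over disjoint balls are disjoint. The isodiametric inequality is applied to
  \<open>K\<close>, never to \<open>A\<close>, which may fail to be measurable.\<close>

lemma sum_radii_le_of_disjoint_balls:
  fixes J :: "'a::euclidean_space set" and F :: "('a \<times> real) set"
  assumes J: "J \<subseteq> Basis" and A: "A \<subseteq> span J"
    and diam: "\<And>x y. x \<in> A \<Longrightarrow> y \<in> A \<Longrightarrow> dist x y \<le> 2 * r" and r: "0 \<le> r" "0 < t"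
    and F: "finite F" "\<And>x \<rho>. (x, \<rho>) \<in> F \<Longrightarrow> x \<in> A \<and> 0 < \<rho> \<and> \<rho> \<le> t"
    and disj: "pairwise (\<lambda>i j. disjnt (cball (fst i) (snd i)) (cball (fst j) (snd j))) F"
  shows "(\<Sum>i\<in>F. snd i ^ card J) \<le> (r + t) ^ card J"
proof -
  let ?w = "emeasure lborel (cylinder J (cball (0::'a) 1))"
  define K where "K = (\<Union>i\<in>F. cball (fst i) (snd i))"
  have K: "K \<in> sets borel" unfolding K_def using F by (intro sets.finite_UN) auto
  have cylK: "cylinder J K = (\<Union>i\<in>F. cylinder J (cball (fst i) (snd i)))"
    by (auto simp: K_def cylinder_def)
  have dK: "dist x y \<le> 2 * (r + t)" if "x \<in> K" "y \<in> K" for x y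
  proof -
    obtain i j where ij: "i \<in> F" "j \<in> F" "x \<in> cball (fst i) (snd i)" "y \<in> cball (fst j) (snd j)"
      using \<open>x \<in> K\<close> \<open>y \<in> K\<close> by (auto simp: K_def)
    have "fst i \<in> A" "fst j \<in> A" "snd i \<le> t" "snd j \<le> t"
      using F(2)[of "fst i" "snd i"] F(2)[of "fst j" "snd j"] ij by auto
    moreover have "dist x y \<le> dist (fst i) x + dist (fst i) (fst j) + dist (fst j) y"
      using dist_triangle[of x y "fst i"] dist_triangle[of "fst i" y "fst j"] by (simp add: dist_commute)
    ultimately show ?thesis using ij diam[of "fst i" "fst j"] by simp
  qed
  have "ennreal (\<Sum>i\<in>F. snd i ^ card J) * ?w = (\<Sum>i\<in>F. ennreal (snd i ^ card J) * ?w)"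
    using F(2) by (subst sum_ennreal[symmetric]) (auto simp: sum_distrib_right intro!: less_imp_le)
  also have "\<dots> = (\<Sum>i\<in>F. emeasure lborel (cylinder J (cball (fst i) (snd i))))"
  proof (intro sum.cong refl)
    fix i assume "i \<in> F"
    then have "fst i \<in> span J" "0 < snd i" using F(2)[of "fst i" "snd i"] A by auto
    then show "ennreal (snd i ^ card J) * ?w = emeasure lborel (cylinder J (cball (fst i) (snd i)))"
      using emeasure_cylinder_cball[OF J] by simp
  qed
  also have "\<dots> = emeasure lborel (cylinder J K)"
    unfolding cylK
  proof (rule sum_emeasure[OF _ _ F(1)])
    show "(\<lambda>i. cylinder J (cball (fst i) (snd i))) ` F \<subseteq> sets lborel" by auto
    show "disjoint_family_on (\<lambda>i. cylinder J (cball (fst i) (snd i))) F"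
      unfolding disjoint_family_on_def
    proof (intro ballI impI)
      fix i j assume "i \<in> F" "j \<in> F" "i \<noteq> j"
      then have "disjnt (cball (fst i) (snd i)) (cball (fst j) (snd j))"
        using disj by (simp add: pairwise_def)
      then show "cylinder J (cball (fst i) (snd i)) \<inter> cylinder J (cball (fst j) (snd j)) = {}"
        unfolding cylinder_def disjnt_def by blast
    qed
  qed
  also have "\<dots> \<le> ennreal ((r + t) ^ card J) * ?w"
    using r by (intro isodiametric_cylinder[OF J K _ dK]) auto
  finally have le: "ennreal (\<Sum>i\<in>F. snd i ^ card J) * ?w \<le> ennreal ((r + t) ^ card J) * ?w" .
  obtain w where w: "?w = ennreal w" "0 < w"
    using cylinder_unit_ball_pos_finite[OF J] by (cases ?w) auto
  have nn: "0 \<le> (\<Sum>i\<in>F. snd i ^ card J)" using F(2) by (intro sum_nonneg zero_le_power) force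
  have "(\<Sum>i\<in>F. snd i ^ card J) * w \<le> (r + t) ^ card J * w"
    using le w nn r by (simp add: ennreal_mult[symmetric] zero_le_mult_iff)
  then show ?thesis using w by simp
qed

text \<open>Vitali's lemma yields disjoint balls whose finite sums of n-th powers are bounded, so
  finitely many of them, \<open>F0\<close>, carry all but \<open>\<tau>\<close> of the supremum of
  these sums. Enlarging only the remaining ones by the factor 5 covers what \<open>F0\<close>
  misses, and the price \<open>5 ^ n * \<tau>\<close> is negligible. All centres stay in
  \<open>A\<close>.\<close>

lemma efficient_ball_cover:
  fixes J :: "'a::euclidean_space set"
  assumes J: "J \<subseteq> Basis" and A: "A \<subseteq> span J"
    and diam: "\<And>x y. x \<in> A \<Longrightarrow> y \<in> A \<Longrightarrow> dist x y \<le> 2 * r"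
    and r: "0 \<le> r" and \<delta>: "0 < \<delta>" and \<eta>: "0 < \<eta>"
  obtains I :: "('a \<times> real) set" where "countable I"
    "\<And>x \<rho>. (x, \<rho>) \<in> I \<Longrightarrow> x \<in> A \<and> 0 < \<rho> \<and> \<rho> \<le> \<delta>"
    "A \<subseteq> (\<Union>i\<in>I. cball (fst i) (snd i))"
    "\<And>F. finite F \<Longrightarrow> F \<subseteq> I \<Longrightarrow> (\<Sum>i\<in>F. snd i ^ card J) \<le> r ^ card J + \<eta>"
proof -
  let ?n = "card J"
  obtain t0 where t0: "0 < t0" "(r + t0) ^ ?n \<le> r ^ ?n + \<eta> / 2"
    using power_le_add_small[of "\<eta> / 2" r ?n] \<eta> by auto
  \<comment> \<open>The bound \<open>\<delta> / 5\<close> keeps the radii at most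
    \<open>\<delta>\<close> after the enlargement by 5.\<close>
  define t where "t = min t0 (\<delta> / 5)"
  have t: "0 < t" "5 * t \<le> \<delta>" "t \<le> \<delta>" using t0 \<delta> by (auto simp: t_def)
  have "(r + t) ^ ?n \<le> (r + t0) ^ ?n" using r t by (intro power_mono) (auto simp: t_def)
  then have tn: "(r + t) ^ ?n \<le> r ^ ?n + \<eta> / 2" using t0 by linarith
  define K where "K = {(x, \<rho>). x \<in> A \<and> 0 < \<rho> \<and> \<rho> \<le> t}"
  obtain C where C: "countable C" "C \<subseteq> K"
    "pairwise (\<lambda>i j. disjnt (cball (fst i) (snd i)) (cball (fst j) (snd j))) C"
    "\<And>i. i \<in> K \<Longrightarrow> \<exists>j. j \<in> C \<and> \<not> disjnt (cball (fst i) (snd i)) (cball (fst j) (snd j)) \<and>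
        cball (fst i) (snd i) \<subseteq> ball (fst j) (5 * snd j)"
  proof (rule Vitali_covering_lemma_cballs_balls[of K snd t fst])
    show "0 < snd i \<and> snd i \<le> t" if "i \<in> K" for i using that by (auto simp: K_def)
  qed blast
  define s where "s F = (\<Sum>i\<in>F. snd i ^ ?n)" for F :: "('a \<times> real) set"
  have s_le: "s F \<le> (r + t) ^ ?n" if "finite F" "F \<subseteq> C" for F
    unfolding s_def
  proof (rule sum_radii_le_of_disjoint_balls[OF J A diam r t(1) that(1)])
    show "x \<in> A \<and> 0 < \<rho> \<and> \<rho> \<le> t" if "(x, \<rho>) \<in> F" for x \<rho>
      using that \<open>F \<subseteq> C\<close> C(2) by (auto simp: K_def)
    show "pairwise (\<lambda>i j. disjnt (cball (fst i) (snd i)) (cball (fst j) (snd j))) F"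
      using C(3) \<open>F \<subseteq> C\<close> by (rule pairwise_subset)
  qed
  define SF where "SF = s ` {F. finite F \<and> F \<subseteq> C}"
  \<comment> \<open>Chosen so that \<open>5 ^ card J * \<tau>\<close> is the second half of
    \<open>\<eta>\<close>; the first half was spent on replacing \<open>r\<close> by
    \<open>r + t\<close>.\<close>
  define \<tau> where "\<tau> = \<eta> / (2 * 5 ^ ?n)"
  have \<tau>: "0 < \<tau>" using \<eta> by (simp add: \<tau>_def)
  have bdd: "bdd_above SF" unfolding SF_def by (rule bdd_aboveI[of _ "(r + t) ^ ?n"]) (auto simp: s_le)
  have "SF \<noteq> {}" unfolding SF_def by auto
  obtain F0 where F0: "finite F0" "F0 \<subseteq> C" "Sup SF - \<tau> < s F0"
  proof -
    have "\<exists>y\<in>SF. Sup SF - \<tau> < y" using \<open>SF \<noteq> {}\<close> \<tau> by (intro less_cSupD) auto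
    then show ?thesis using that unfolding SF_def by blast
  qed
  have tail: "s F \<le> \<tau>" if F: "finite F" "F \<subseteq> C - F0" for F
  proof -
    have "s (F0 \<union> F) = s F0 + s F" unfolding s_def using F F0(1) by (intro sum.union_disjoint) auto
    moreover have "s (F0 \<union> F) \<le> Sup SF" using F F0 by (intro cSup_upper[OF _ bdd]) (auto simp: SF_def)
    ultimately show ?thesis using F0(3) by linarith
  qed
  define e where "e i = (fst i, 5 * snd i)" for i :: "'a \<times> real"
  have inj: "inj e" by (auto simp: inj_def e_def prod_eq_iff)
  have CK: "fst i \<in> A \<and> 0 < snd i \<and> snd i \<le> t" if "i \<in> C" for i
    using that C(2) by (auto simp: K_def)
  show ?thesis
  proof (rule that[of "F0 \<union> e ` (C - F0)"])
    show "countable (F0 \<union> e ` (C - F0))" using C(1) F0(1) by (auto intro: countable_finite)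
    show "x \<in> A \<and> 0 < \<rho> \<and> \<rho> \<le> \<delta>" if "(x, \<rho>) \<in> F0 \<union> e ` (C - F0)" for x \<rho>
      using that
    proof
      assume "(x, \<rho>) \<in> F0"
      then show ?thesis using CK[of "(x, \<rho>)"] F0(2) t by auto
    next
      assume "(x, \<rho>) \<in> e ` (C - F0)"
      then obtain i where "i \<in> C" "x = fst i" "\<rho> = 5 * snd i" by (auto simp: e_def)
      then show ?thesis using CK[of i] t by auto
    qed
    show "A \<subseteq> (\<Union>i\<in>F0 \<union> e ` (C - F0). cball (fst i) (snd i))"
    proof
      fix x assume x: "x \<in> A"
      show "x \<in> (\<Union>i\<in>F0 \<union> e ` (C - F0). cball (fst i) (snd i))"
      proof (cases "x \<in> (\<Union>i\<in>F0. cball (fst i) (snd i))")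
        case False
        have xF0: "x \<in> - (\<Union>i\<in>F0. cball (fst i) (snd i))" using False by blast
        have "open (- (\<Union>i\<in>F0. cball (fst i) (snd i)))"
          using F0(1) by (intro open_Compl closed_UN) auto
        then obtain \<rho>0 where \<rho>0: "0 < \<rho>0" "cball x \<rho>0 \<subseteq> - (\<Union>i\<in>F0. cball (fst i) (snd i))"
          unfolding open_contains_cball using xF0 by blast
        \<comment> \<open>The ball around \<open>x\<close> is taken so small that it misses the
          closed union over \<open>F0\<close>. The selected ball that Vitali's lemma finds meeting
          it then lies outside \<open>F0\<close>, hence is among the enlarged ones.\<close>
        define \<rho> where "\<rho> = min \<rho>0 t"
        have "(x, \<rho>) \<in> K" using x \<rho>0 t by (auto simp: K_def \<rho>_def)
        then obtain j where j: "j \<in> C" "\<not> disjnt (cball x \<rho>) (cball (fst j) (snd j))"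
          "cball x \<rho> \<subseteq> ball (fst j) (5 * snd j)" using C(4)[of "(x, \<rho>)"] by auto
        have "cball x \<rho> \<subseteq> cball x \<rho>0" by (auto simp: \<rho>_def)
        then have "j \<notin> F0" using \<rho>0(2) j(2) by (auto simp: disjnt_def)
        moreover have "x \<in> cball x \<rho>" using \<rho>0 t by (simp add: \<rho>_def)
        then have "x \<in> ball (fst j) (5 * snd j)" using j(3) by blast
        then have "x \<in> cball (fst (e j)) (snd (e j))" by (simp add: e_def)
        ultimately show ?thesis using j(1) by blast
      qed auto
    qed
    fix F assume F: "finite F" "F \<subseteq> F0 \<union> e ` (C - F0)"
    define G where "G = e -` F \<inter> (C - F0)"
    have "finite (e -` F)" using F(1) inj by (rule finite_vimageI)
    then have G: "finite G" "G \<subseteq> C - F0" unfolding G_def by auto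
    have "F \<subseteq> F0 \<union> e ` G" using F(2) unfolding G_def by blast
    have nn: "0 \<le> snd i" if i: "i \<in> F0 \<union> e ` G" for i
    proof (cases "i \<in> F0")
      case True
      then show ?thesis using CK[of i] F0(2) by auto
    next
      case False
      then obtain j where "j \<in> G" "i = e j" using i by blast
      then show ?thesis using CK[of j] G(2) by (auto simp: e_def)
    qed
    have "s F \<le> s (F0 \<union> e ` G)" unfolding s_def
    proof (rule sum_mono2)
      show "finite (F0 \<union> e ` G)" using F0(1) G(1) by simp
      show "F \<subseteq> F0 \<union> e ` G" by fact
      show "0 \<le> snd i ^ ?n" if "i \<in> F0 \<union> e ` G - F" for i
        using that nn by (intro zero_le_power) blast
    qed
    also have "\<dots> \<le> s F0 + s (e ` G)"
    proof -
      have "0 \<le> s (F0 \<inter> e ` G)" unfolding s_def using nn by (intro sum_nonneg zero_le_power) blast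
      moreover have "s (F0 \<union> e ` G) + s (F0 \<inter> e ` G) = s F0 + s (e ` G)"
        unfolding s_def using F0(1) G(1) by (intro sum.union_inter) auto
      ultimately show ?thesis by linarith
    qed
    also have "s (e ` G) = 5 ^ ?n * s G"
    proof -
      have "s (e ` G) = (\<Sum>i\<in>G. (5 * snd i) ^ ?n)"
        unfolding s_def by (subst sum.reindex[OF inj_on_subset[OF inj subset_UNIV]]) (simp add: e_def)
      then show ?thesis by (simp only: s_def power_mult_distrib sum_distrib_left)
    qed
    also have "\<dots> \<le> 5 ^ ?n * \<tau>" using tail[OF G] by (intro mult_left_mono) auto
    also have "5 ^ ?n * \<tau> = \<eta> / 2" by (simp add: \<tau>_def)
    also have "s F0 \<le> r ^ ?n + \<eta> / 2" using s_le[OF F0(1,2)] tn by linarith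
    finally show "(\<Sum>i\<in>F. snd i ^ ?n) \<le> r ^ ?n + \<eta>" by (simp add: s_def)
  qed
qed

section \<open>Spherical measure of sets bilipschitz to Euclidean ones\<close>

abbreviation diam_mass :: "('a \<Rightarrow> 'a \<Rightarrow> real) \<Rightarrow> nat \<Rightarrow> 'a set \<Rightarrow> ennreal" where
  "diam_mass d n B \<equiv> ennreal (1 / 2 ^ n) * ediam d B ^ n"

lemma ediam_mcball_le:
  assumes "Metric_space UNIV d"
  shows "ediam d (Metric_space.mcball UNIV d x r) \<le> ennreal (2 * r)"
proof -
  interpret Metric_space UNIV d by fact
  show ?thesis unfolding ediam_def
  proof (intro SUP_least ennreal_leI)
    fix y z assume "y \<in> mcball x r" "z \<in> mcball x r"
    then show "d y z \<le> 2 * r" using triangle[of y x z] by (auto simp: commute)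
  qed
qed

text \<open>Replaces admissible sequences by covers with an arbitrary countable index set and a
  bound on finite sums. A ball of radius \<rho> has diameter at most 2\<rho>, hence mass at most
  \<rho>^n; the radii are therefore requested at scale \<open>\<delta> / 2\<close>.\<close>

lemma spherical0_le_of_ball_covers:
  fixes d :: "'a \<Rightarrow> 'a \<Rightarrow> real"
  assumes M: "Metric_space UNIV d" and n: "1 \<le> n" and c: "0 \<le> c"
    and cover: "\<And>\<delta> \<eta>. 0 < \<delta> \<Longrightarrow> 0 < \<eta> \<Longrightarrow> \<exists>I :: ('a \<times> real) set. countable I
      \<and> (\<forall>i\<in>I. 0 < snd i \<and> snd i \<le> \<delta>) \<and> E \<subseteq> (\<Union>i\<in>I. Metric_space.mcball UNIV d (fst i) (snd i))
      \<and> (\<forall>F. finite F \<longrightarrow> F \<subseteq> I \<longrightarrow> (\<Sum>i\<in>F. snd i ^ n) \<le> c + \<eta>)"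
  shows "spherical0 d n E \<le> ennreal c"
proof -
  interpret Metric_space UNIV d by fact
  have diam: "diam_mass d n (mcball x \<rho>) \<le> ennreal (\<rho> ^ n)" if "0 \<le> \<rho>" for x \<rho>
  proof -
    have "diam_mass d n (mcball x \<rho>) \<le> ennreal (1 / 2 ^ n) * ennreal (2 * \<rho>) ^ n"
      by (rule mult_left_mono[OF power_mono[OF ediam_mcball_le[OF M]]]) auto
    also have "\<dots> = ennreal (1 / 2 ^ n * (2 * \<rho>) ^ n)"
    proof -
      have a: "0 \<le> 2 * \<rho>" using that by simp
      have b: "0 \<le> (1::real) / 2 ^ n" by simp
      show ?thesis unfolding ennreal_power[OF a] by (rule ennreal_mult[symmetric, OF b zero_le_power[OF a]])
    qed
    also have "1 / 2 ^ n * (2 * \<rho>) ^ n = \<rho> ^ n" by (simp only: power_mult_distrib) simp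
    finally show ?thesis .
  qed
  show ?thesis
    unfolding spherical0_def covering_measure_def
  proof (rule SUP_least, rule ennreal_le_epsilon)
    fix \<delta> e :: real assume "\<delta> \<in> {0<..}" "0 < e"
    then have \<delta>: "0 < \<delta>" by simp
    \<comment> \<open>One half of \<open>e\<close> pays for the excess of the given cover, the other
      for the balls that pad it to a sequence.\<close>
    define \<eta> where "\<eta> = e / 2"
    have \<eta>: "0 < \<eta>" using \<open>0 < e\<close> by (simp add: \<eta>_def)
    obtain I :: "('a \<times> real) set" where I: "countable I" "\<And>i. i \<in> I \<Longrightarrow> 0 < snd i \<and> snd i \<le> \<delta> / 2"
      "E \<subseteq> (\<Union>i\<in>I. mcball (fst i) (snd i))"
      "\<And>F. finite F \<Longrightarrow> F \<subseteq> I \<Longrightarrow> (\<Sum>i\<in>F. snd i ^ n) \<le> c + \<eta>"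
    proof -
      obtain I :: "('a \<times> real) set" where I: "countable I \<and> (\<forall>i\<in>I. 0 < snd i \<and> snd i \<le> \<delta> / 2)
        \<and> E \<subseteq> (\<Union>i\<in>I. mcball (fst i) (snd i))
        \<and> (\<forall>F. finite F \<longrightarrow> F \<subseteq> I \<longrightarrow> (\<Sum>i\<in>F. snd i ^ n) \<le> c + \<eta>)"
        using cover[OF half_gt_zero[OF \<delta>] \<eta>] by (rule exE)
      show ?thesis by (rule that[of I]) (use I in simp_all)
    qed
    define f where "f = to_nat_on I"
    have f: "inj_on f I" unfolding f_def by (rule inj_on_to_nat_on[OF I(1)])
    \<comment> \<open>Three demands on a padding radius: admissible diameter,
      \<open>\<tau> k ^ n \<le> \<tau> k\<close> (from \<open>\<tau> k \<le> 1\<close> and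
      \<open>n \<ge> 1\<close>), and a geometric series with sum \<open>\<eta>\<close>.\<close>
    define \<tau> where "\<tau> k = min (\<delta> / 2) (min 1 (\<eta> * (1 / 2) ^ Suc k))" for k
    have \<tau>: "0 < \<tau> k" "\<tau> k \<le> \<delta> / 2" "\<tau> k \<le> 1" "\<tau> k \<le> \<eta> * (1 / 2) ^ Suc k" for k
      using \<delta> \<eta> by (auto simp: \<tau>_def)
    text \<open>The cover must be a sequence of balls of positive radius, so the unused indices carry small dummy balls.\<close>
    define p where "p k = (if k \<in> f ` I then inv_into I f k else (undefined, \<tau> k))" for k
    define B where "B k = mcball (fst (p k)) (snd (p k))" for k
    have p: "0 < snd (p k) \<and> snd (p k) \<le> \<delta> / 2" for k
    proof (cases "k \<in> f ` I")
      case True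
      then show ?thesis using I(2)[OF inv_into_into[OF True]] by (simp add: p_def)
    next
      case False
      then show ?thesis using \<tau>[of k] by (simp add: p_def)
    qed
    have p0: "0 \<le> snd (p k)" for k using p[of k] by simp
    have "(INF B\<in>{B. range B \<subseteq> {mcball x r |x r. 0 < r} \<and> E \<subseteq> (\<Union>j. B j) \<and> (\<forall>j. ediam d (B j) \<le> ennreal \<delta>)}.
         \<Sum>j. diam_mass d n (B j)) \<le> (\<Sum>j. diam_mass d n (B j))"
    proof (rule INF_lower, intro CollectI conjI allI)
      show "range B \<subseteq> {mcball x r |x r. 0 < r}" using p unfolding B_def by blast
      show "E \<subseteq> (\<Union>j. B j)"
      proof
        fix x assume "x \<in> E"
        then obtain i where i: "i \<in> I" "x \<in> mcball (fst i) (snd i)" using I(3) by blast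
        then have "p (f i) = i" using f by (simp add: p_def inv_into_f_f)
        then have "x \<in> B (f i)" using i by (simp add: B_def)
        then show "x \<in> (\<Union>j. B j)" by blast
      qed
      fix j
      have "ediam d (B j) \<le> ennreal (2 * snd (p j))" unfolding B_def by (rule ediam_mcball_le[OF M])
      also have "\<dots> \<le> ennreal \<delta>" using p[of j] by (intro ennreal_leI) auto
      finally show "ediam d (B j) \<le> ennreal \<delta>" .
    qed
    also have "\<dots> \<le> ennreal (c + \<eta> + \<eta>)"
    proof (rule ennreal_suminf_bound_add[where y = 0, simplified])
      fix N
      let ?P = "{..<N} \<inter> f ` I" and ?Q = "{..<N} - f ` I"
      have "(\<Sum>j<N. diam_mass d n (B j)) \<le> (\<Sum>j<N. ennreal (snd (p j) ^ n))"
        unfolding B_def by (intro sum_mono diam p0)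
      also have "\<dots> = ennreal (\<Sum>j<N. snd (p j) ^ n)" by (intro sum_ennreal zero_le_power p0)
      also have "\<dots> \<le> ennreal (c + \<eta> + \<eta>)"
      proof (rule ennreal_leI)
        have "(\<Sum>j<N. snd (p j) ^ n) = (\<Sum>j\<in>?P. snd (p j) ^ n) + (\<Sum>j\<in>?Q. snd (p j) ^ n)"
        proof -
          have "{..<N} = ?P \<union> ?Q" by blast
          moreover have "(\<Sum>j\<in>?P \<union> ?Q. snd (p j) ^ n) = (\<Sum>j\<in>?P. snd (p j) ^ n) + (\<Sum>j\<in>?Q. snd (p j) ^ n)"
            by (intro sum.union_disjoint) auto
          ultimately show ?thesis by simp
        qed
        also have "(\<Sum>j\<in>?P. snd (p j) ^ n) = (\<Sum>i\<in>inv_into I f ` ?P. snd i ^ n)"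
        proof (subst sum.reindex)
          show "inj_on (inv_into I f) ?P" by (rule inj_on_subset[OF inj_on_inv_into[of _ f I]]) auto
          show "(\<Sum>j\<in>?P. snd (p j) ^ n) = sum ((\<lambda>i. snd i ^ n) \<circ> inv_into I f) ?P"
            by (intro sum.cong) (auto simp: p_def)
        qed
        also have "\<dots> \<le> c + \<eta>" by (intro I(4)) (auto simp: inv_into_into)
        also have "(\<Sum>j\<in>?Q. snd (p j) ^ n) \<le> (\<Sum>j\<in>?Q. \<eta> * (1 / 2) ^ Suc j)"
        proof (rule sum_mono)
          fix j assume "j \<in> ?Q"
          then have "snd (p j) = \<tau> j" by (simp add: p_def)
          moreover have "\<tau> j ^ n \<le> \<tau> j ^ 1" using \<tau>[of j] n by (intro power_decreasing) auto
          ultimately show "snd (p j) ^ n \<le> \<eta> * (1 / 2) ^ Suc j" using \<tau>(4)[of j] by simp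
        qed
        also have "\<dots> \<le> (\<Sum>j<N. \<eta> * (1 / 2) ^ Suc j)" using \<eta> by (intro sum_mono2) auto
        also have "\<dots> \<le> (\<Sum>j. \<eta> * (1 / 2) ^ Suc j)"
        proof (rule sum_le_suminf)
          show "summable (\<lambda>j. \<eta> * (1 / 2) ^ Suc j)"
            by (rule sums_summable[OF sums_mult[OF power_half_series, of \<eta>]])
        qed (use \<eta> in auto)
        also have "\<dots> = \<eta>" 
          by (subst sums_unique[OF sums_mult[OF power_half_series, of \<eta>], symmetric]) simp
        finally show "(\<Sum>j<N. snd (p j) ^ n) \<le> c + \<eta> + \<eta>" by simp
      qed
      finally show "(\<Sum>j<N. diam_mass d n (B j)) \<le> ennreal (c + \<eta> + \<eta>)" .
    qed
    also have "\<dots> = ennreal c + ennreal e" 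
    proof -
      have "c + \<eta> + \<eta> = c + e" by (simp add: \<eta>_def)
      then show ?thesis using c \<open>0 < e\<close> by (simp only: ennreal_plus less_imp_le)
    qed
    finally show "(INF B\<in>{B. range B \<subseteq> {mcball x r |x r. 0 < r} \<and> E \<subseteq> (\<Union>j. B j) \<and> (\<forall>j. ediam d (B j) \<le> ennreal \<delta>)}.
         \<Sum>j. diam_mass d n (B j)) \<le> ennreal c + ennreal e" .
  qed
qed

text \<open>The image of \<open>B\<close> has Euclidean diameter at most D / l, where D is the
  diameter of \<open>B\<close>. An efficient Euclidean cover of it, centred in the image, pulls back
  to \<open>d\<close>-balls centred in \<open>B\<close> with radii multiplied by \<open>u\<close>;
  the two distortions combine to \<open>(u / l) ^ n\<close>.\<close>

lemma spherical0_le_ediam_aux: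
  fixes d :: "'a::euclidean_space \<Rightarrow> 'a \<Rightarrow> real" and g :: "'a \<Rightarrow> 'a"
  assumes M: "Metric_space UNIV d" and J: "J \<subseteq> Basis" "card J = n" and n: "1 \<le> n"
    and g: "g ` B \<subseteq> span J" and lu: "0 < l" "0 < u"
    and lower: "\<And>x y. x \<in> B \<Longrightarrow> y \<in> B \<Longrightarrow> l * dist (g x) (g y) \<le> d x y"
    and upper: "\<And>x y. x \<in> B \<Longrightarrow> y \<in> B \<Longrightarrow> d x y \<le> u * dist (g x) (g y)"
  shows "spherical0 d n B \<le> ennreal ((u / l) ^ n) * (diam_mass d n B)"
proof (cases "ediam d B = \<infinity>")
  case True
  then have "ediam d B ^ n = \<infinity>" using n by simp
  then have "ennreal ((u / l) ^ n) * (diam_mass d n B) = \<infinity>"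
    using lu by (simp add: ennreal_mult_top)
  then show ?thesis by simp
next
  case False
  interpret Metric_space UNIV d by fact
  obtain D where D: "ediam d B = ennreal D" "0 \<le> D" using False by (cases "ediam d B") auto
  have dD: "d x y \<le> D" if "x \<in> B" "y \<in> B" for x y
  proof -
    have "ennreal (d x y) \<le> ediam d B" unfolding ediam_def
      by (rule SUP_upper2[OF that(1)], rule SUP_upper[OF that(2)])
    then show ?thesis using D by simp
  qed
  \<comment> \<open>Half the bound D / l on the diameter of the image, so that \<open>r ^ n\<close>
    is \<open>diam_mass d n B\<close> divided by \<open>l ^ n\<close>.\<close>
  define r where "r = D / (2 * l)"
  have r: "0 \<le> r" using D lu by (simp add: r_def)
  define h where "h = inv_into B g"
  have gh: "h x \<in> B" "g (h x) = x" if "x \<in> g ` B" for x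
    using that by (auto simp: h_def inv_into_into f_inv_into_f)
  have "spherical0 d n B \<le> ennreal (u ^ n * r ^ n)"
  proof (rule spherical0_le_of_ball_covers[OF M n])
    show "0 \<le> u ^ n * r ^ n" using r lu by simp
    fix \<delta> \<eta> :: real assume "0 < \<delta>" "0 < \<eta>"
    have diam: "dist x y \<le> 2 * r" if "x \<in> g ` B" "y \<in> g ` B" for x y
    proof -
      have "l * dist x y \<le> D" using lower[of "h x" "h y"] dD[of "h x" "h y"] gh that by simp
      then show ?thesis using lu by (simp add: r_def field_simps)
    qed
    \<comment> \<open>Both tolerances are divided in advance by the factors that the dilation of
      radii by \<open>u\<close> will produce.\<close>
    have pos: "0 < \<delta> / u" "0 < \<eta> / u ^ n" using \<open>0 < \<delta>\<close> \<open>0 < \<eta>\<close> lu by auto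
    obtain I :: "('a \<times> real) set" where I: "countable I"
      "\<And>x \<rho>. (x, \<rho>) \<in> I \<Longrightarrow> x \<in> g ` B \<and> 0 < \<rho> \<and> \<rho> \<le> \<delta> / u"
      "g ` B \<subseteq> (\<Union>i\<in>I. cball (fst i) (snd i))"
      "\<And>F. finite F \<Longrightarrow> F \<subseteq> I \<Longrightarrow> (\<Sum>i\<in>F. snd i ^ card J) \<le> r ^ card J + \<eta> / u ^ n"
    proof (rule efficient_ball_cover[OF J(1) g _ r pos], goal_cases)
      case (1 x y)
      show ?case by (rule diam) (fact 1)+
    next
      case (2 I)
      show ?case by (rule 2(1)) (fact 2)+
    qed
    define e where "e i = (h (fst i), u * snd i)" for i :: "'a \<times> real"
    have e: "inj_on e I"
    proof (rule inj_onI)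
      fix i j assume ij: "i \<in> I" "j \<in> I" "e i = e j"
      have "fst i \<in> g ` B" "fst j \<in> g ` B"
        by (rule conjunct1[OF I(2)[of "fst i" "snd i", unfolded prod.collapse, OF ij(1)]],
            rule conjunct1[OF I(2)[of "fst j" "snd j", unfolded prod.collapse, OF ij(2)]])
      moreover have hh: "h (fst i) = h (fst j)" "u * snd i = u * snd j" using ij(3) by (simp_all add: e_def)
      ultimately have "fst i = fst j" by (metis gh(2))
      moreover have "snd i = snd j" using hh(2) lu by simp
      ultimately show "i = j" by (simp add: prod_eq_iff)
    qed
    show "\<exists>I :: ('a \<times> real) set. countable I
      \<and> (\<forall>i\<in>I. 0 < snd i \<and> snd i \<le> \<delta>) \<and> B \<subseteq> (\<Union>i\<in>I. mcball (fst i) (snd i))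
      \<and> (\<forall>F. finite F \<longrightarrow> F \<subseteq> I \<longrightarrow> (\<Sum>i\<in>F. snd i ^ n) \<le> u ^ n * r ^ n + \<eta>)"
    proof (intro exI[of _ "e ` I"] conjI ballI allI impI)
      show "countable (e ` I)" using I(1) by simp
      fix i assume "i \<in> e ` I"
      then obtain j where j: "j \<in> I" "i = e j" by auto
      then have "0 < snd j \<and> snd j \<le> \<delta> / u" using I(2)[of "fst j" "snd j"] by auto
      then show "0 < snd i" "snd i \<le> \<delta>" using j lu by (simp_all add: e_def pos_le_divide_eq mult.commute)
    next
      show "B \<subseteq> (\<Union>i\<in>e ` I. mcball (fst i) (snd i))"
      proof
        fix x assume x: "x \<in> B"
        then obtain i where i: "i \<in> I" "g x \<in> cball (fst i) (snd i)" using I(3) by blast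
        have fi: "fst i \<in> g ` B" using I(2)[of "fst i" "snd i"] i by auto
        have "d (h (fst i)) x \<le> u * dist (fst i) (g x)" using upper[OF gh(1)[OF fi] x] gh(2)[OF fi] by simp
        also have "\<dots> \<le> u * snd i" using i lu by (intro mult_left_mono) auto
        finally have "x \<in> mcball (fst (e i)) (snd (e i))" by (simp add: e_def)
        then show "x \<in> (\<Union>i\<in>e ` I. mcball (fst i) (snd i))" using i(1) by blast
      qed
    next
      fix F assume F: "finite F" "F \<subseteq> e ` I"
      then obtain G where G: "G \<subseteq> I" "F = e ` G" "finite G" using finite_subset_image[OF F] by blast
      have "(\<Sum>i\<in>F. snd i ^ n) = (\<Sum>i\<in>G. (u * snd i) ^ n)"
        unfolding G(2) using inj_on_subset[OF e G(1)] by (subst sum.reindex) (auto simp: e_def)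
      also have "\<dots> = u ^ n * (\<Sum>i\<in>G. snd i ^ n)" by (simp add: power_mult_distrib sum_distrib_left)
      also have "\<dots> \<le> u ^ n * (r ^ n + \<eta> / u ^ n)"
        using I(4)[OF G(3,1)] J lu by (intro mult_left_mono) auto
      also have "\<dots> = u ^ n * r ^ n + \<eta>" using lu by (simp add: field_simps)
      finally show "(\<Sum>i\<in>F. snd i ^ n) \<le> u ^ n * r ^ n + \<eta>" .
    qed
  qed
  also have "u ^ n * r ^ n = (u / l * (1 / 2 * D)) ^ n"
    unfolding power_mult_distrib[symmetric] r_def by (rule arg_cong[where f = "\<lambda>x. x ^ n"]) simp
  also have "\<dots> = (u / l) ^ n * (1 / 2 ^ n * D ^ n)"
    by (simp only: power_mult_distrib power_one_over)
  also have "ennreal \<dots> = ennreal ((u / l) ^ n) * (diam_mass d n B)"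
  proof -
    have "0 \<le> (u / l) ^ n" "0 \<le> 1 / 2 ^ n * D ^ n" "(0::real) \<le> 1 / 2 ^ n" "0 \<le> D ^ n" using D lu by auto
    then show ?thesis unfolding D(1) ennreal_power[OF D(2)] by (simp only: ennreal_mult)
  qed
  finally show ?thesis .
qed

text \<open>A linear isometry carries \<open>V\<close> onto a coordinate subspace, where the
  cylinder volumes are available.\<close>

lemma spherical0_le_ediam:
  fixes d :: "'a::euclidean_space \<Rightarrow> 'a \<Rightarrow> real" and g :: "'a \<Rightarrow> 'a"
  assumes M: "Metric_space UNIV d" and V: "subspace V" "dim V = n" and n: "1 \<le> n"
    and g: "g ` B \<subseteq> V" and lu: "0 < l" "0 < u"
    and lower: "\<And>x y. x \<in> B \<Longrightarrow> y \<in> B \<Longrightarrow> l * dist (g x) (g y) \<le> d x y"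
    and upper: "\<And>x y. x \<in> B \<Longrightarrow> y \<in> B \<Longrightarrow> d x y \<le> u * dist (g x) (g y)"
  shows "spherical0 d n B \<le> ennreal ((u / l) ^ n) * (diam_mass d n B)"
proof -
  have "n \<le> card (Basis :: 'a set)" using V(2) dim_subset_UNIV[of V] by simp
  then obtain J :: "'a set" where J: "J \<subseteq> Basis" "card J = n" by (rule obtain_subset_with_card_n)
  have "independent J" using J(1) independent_Basis independent_mono by blast
  then have "dim V = dim (span J)" using J(2) V(2) by (simp add: dim_eq_card_independent)
  then obtain f where f: "linear f" "f ` V = span J" "\<And>x. x \<in> V \<Longrightarrow> norm (f x) = norm x"
    using isometries_subspaces[OF V(1) subspace_span[of J], of thesis] by blast
  have dist: "dist (f (g x)) (f (g y)) = dist (g x) (g y)" if "x \<in> B" "y \<in> B" for x y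
  proof -
    have "g x - g y \<in> V" using g that V(1) by (intro subspace_diff) auto
    then have "norm (f (g x - g y)) = norm (g x - g y)" by (rule f(3))
    then show ?thesis by (simp add: dist_norm linear_diff[OF f(1)])
  qed
  show ?thesis
  proof (rule spherical0_le_ediam_aux[OF M J n _ lu, of "f \<circ> g"])
    show "(f \<circ> g) ` B \<subseteq> span J" using g f(2) by auto
  qed (auto simp: dist lower upper)
qed

section \<open>Comparison of covering measures\<close>

definition premeasure ::
  "('a \<Rightarrow> 'a \<Rightarrow> real) \<Rightarrow> nat \<Rightarrow> 'a set set \<Rightarrow> real \<Rightarrow> 'a set \<Rightarrow> ennreal" where
  "premeasure d n \<F> \<delta> E =
     (INF B\<in>{B :: nat \<Rightarrow> 'a set. range B \<subseteq> \<F> \<and> E \<subseteq> (\<Union>j. B j) \<and> (\<forall>j. ediam d (B j) \<le> ennreal \<delta>)}.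
       \<Sum>j. diam_mass d n (B j))"

lemma covering_measure_eq: "covering_measure d n \<F> E = (SUP \<delta>\<in>{0<..}. premeasure d n \<F> \<delta> E)"
  by (simp add: covering_measure_def premeasure_def)

lemma premeasure_le:
  assumes "range B \<subseteq> \<F>" "E \<subseteq> (\<Union>j. B j)" "\<And>j. ediam d (B j) \<le> ennreal \<delta>"
  shows "premeasure d n \<F> \<delta> E \<le> (\<Sum>j. diam_mass d n (B j))"
  unfolding premeasure_def by (rule INF_lower) (use assms in blast)

lemma premeasure_greatest:
  assumes "\<And>B. range B \<subseteq> \<F> \<Longrightarrow> E \<subseteq> (\<Union>j. B j) \<Longrightarrow> (\<And>j. ediam d (B j) \<le> ennreal \<delta>)
    \<Longrightarrow> x \<le> (\<Sum>j. diam_mass d n (B j))"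
  shows "x \<le> premeasure d n \<F> \<delta> E"
  unfolding premeasure_def by (rule INF_greatest) (use assms in blast)

lemma premeasure_le_measure:
  "0 < \<delta> \<Longrightarrow> premeasure d n \<F> \<delta> E \<le> covering_measure d n \<F> E"
  unfolding covering_measure_eq by (rule SUP_upper) simp

lemma premeasure_mono:
  assumes "E \<subseteq> F"
  shows "premeasure d n \<F> \<delta> E \<le> premeasure d n \<F> \<delta> F"
  by (rule premeasure_greatest, rule premeasure_le) (use assms in auto)

lemma covering_measure_mono:
  assumes "E \<subseteq> F"
  shows "covering_measure d n \<F> E \<le> covering_measure d n \<F> F"
  unfolding covering_measure_eq by (rule SUP_mono) (use premeasure_mono[OF assms] in blast)

lemma premeasure_antimono:
  assumes "\<delta> \<le> \<delta>'"
  shows "premeasure d n \<F> \<delta>' E \<le> premeasure d n \<F> \<delta> E"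
proof (rule premeasure_greatest, rule premeasure_le)
  fix B :: "nat \<Rightarrow> 'a set" and j assume *: "\<And>j. ediam d (B j) \<le> ennreal \<delta>"
  show "ediam d (B j) \<le> ennreal \<delta>'" using *[of j] ennreal_leI[OF assms] by (rule order_trans)
qed

lemma covering_measure_antimono_family:
  assumes "\<F> \<subseteq> \<G>"
  shows "covering_measure d n \<G> E \<le> covering_measure d n \<F> E"
  unfolding covering_measure_eq
proof (rule SUP_mono)
  fix \<delta> :: real assume "\<delta> \<in> {0<..}"
  moreover have "premeasure d n \<G> \<delta> E \<le> premeasure d n \<F> \<delta> E"
    by (rule premeasure_greatest, rule premeasure_le) (use assms in auto)
  ultimately show "\<exists>\<delta>'\<in>{0<..}. premeasure d n \<G> \<delta> E \<le> premeasure d n \<F> \<delta>' E" by blast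
qed

lemma premeasure_UN_le:
  fixes E :: "nat \<Rightarrow> 'a set"
  shows "premeasure d n \<F> \<delta> (\<Union>i. E i) \<le> (\<Sum>i. premeasure d n \<F> \<delta> (E i))"
proof (rule ennreal_le_epsilon)
  fix e :: real assume fin: "(\<Sum>i. premeasure d n \<F> \<delta> (E i)) < top_class.top" and e: "0 < e"
  have "\<exists>B. range B \<subseteq> \<F> \<and> E i \<subseteq> (\<Union>j. B j) \<and> (\<forall>j. ediam d (B j) \<le> ennreal \<delta>)
     \<and> (\<Sum>j. diam_mass d n (B j)) \<le> premeasure d n \<F> \<delta> (E i) + ennreal (e * (1/2) ^ Suc i)" for i
  proof -
    have "premeasure d n \<F> \<delta> (E i) < top_class.top" using fin by (rule ennreal_suminf_lessD)
    moreover have "0 < ennreal (e * (1/2) ^ Suc i)" using e by simp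
    ultimately have "premeasure d n \<F> \<delta> (E i)
        < premeasure d n \<F> \<delta> (E i) + ennreal (e * (1/2) ^ Suc i)"
      by (metis add.right_neutral ennreal_add_left_cancel_less infinity_ennreal_def top.not_eq_extremum)
    then obtain B where "B \<in> {B. range B \<subseteq> \<F> \<and> E i \<subseteq> (\<Union>j. B j) \<and> (\<forall>j. ediam d (B j) \<le> ennreal \<delta>)}"
      "(\<Sum>j. diam_mass d n (B j)) < premeasure d n \<F> \<delta> (E i) + ennreal (e * (1/2) ^ Suc i)"
      unfolding premeasure_def[of d n \<F> \<delta> "E i"] INF_less_iff by blast
    then show ?thesis by (intro exI[of _ B]) (simp add: less_imp_le)
  qed
  then obtain B where B: "\<And>i. range (B i) \<subseteq> \<F>" "\<And>i. E i \<subseteq> (\<Union>j. B i j)" "\<And>i j. ediam d (B i j) \<le> ennreal \<delta>"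
    "\<And>i. (\<Sum>j. diam_mass d n (B i j)) \<le> premeasure d n \<F> \<delta> (E i) + ennreal (e * (1/2) ^ Suc i)"
    by metis
  define f where "f p = ennreal (1 / 2 ^ n) * ediam d (B (fst p) (snd p)) ^ n" for p
  have "premeasure d n \<F> \<delta> (\<Union>i. E i) \<le> (\<Sum>k. f (prod_decode k))"
    unfolding f_def
  proof (rule premeasure_le)
    show "range (\<lambda>k. B (fst (prod_decode k)) (snd (prod_decode k))) \<subseteq> \<F>" using B(1) by blast
    show "(\<Union>i. E i) \<subseteq> (\<Union>k. B (fst (prod_decode k)) (snd (prod_decode k)))"
    proof
      fix x assume "x \<in> (\<Union>i. E i)"
      then obtain i j where "x \<in> B i j" using B(2) by blast
      then have "x \<in> B (fst (prod_decode (prod_encode (i, j)))) (snd (prod_decode (prod_encode (i, j))))" by simp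
      then show "x \<in> (\<Union>k. B (fst (prod_decode k)) (snd (prod_decode k)))" by blast
    qed
  qed (rule B(3))
  also have "\<dots> = (\<Sum>i. \<Sum>j. f (i, j))" by (rule suminf_ennreal_2dimen) simp
  also have "\<dots> \<le> (\<Sum>i. premeasure d n \<F> \<delta> (E i) + ennreal (e * (1/2) ^ Suc i))"
    by (rule suminf_le) (use B(4) in \<open>simp_all add: f_def\<close>)
  also have "\<dots> = (\<Sum>i. premeasure d n \<F> \<delta> (E i)) + (\<Sum>i. ennreal (e * (1/2) ^ Suc i))"
    by (rule suminf_add[symmetric]) auto
  also have "(\<Sum>i. ennreal (e * (1/2) ^ Suc i)) = ennreal (e * 1)"
  proof (rule sums_unique[symmetric])
    have "(\<lambda>i. e * (1/2) ^ Suc i) sums (e * 1)" by (intro sums_mult power_half_series)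
    then show "(\<lambda>i. ennreal (e * (1/2) ^ Suc i)) sums ennreal (e * 1)" using e by (subst sums_ennreal) auto
  qed
  finally show "premeasure d n \<F> \<delta> (\<Union>i. E i) \<le> (\<Sum>i. premeasure d n \<F> \<delta> (E i)) + ennreal e" by simp
qed

lemma covering_measure_UN_le:
  fixes E :: "nat \<Rightarrow> 'a set"
  shows "covering_measure d n \<F> (\<Union>i. E i) \<le> (\<Sum>i. covering_measure d n \<F> (E i))"
  unfolding covering_measure_eq[of d n \<F> "\<Union>i. E i"]
proof (rule SUP_least)
  fix \<delta> :: real assume \<delta>: "\<delta> \<in> {0<..}"
  have "premeasure d n \<F> \<delta> (\<Union>i. E i) \<le> (\<Sum>i. premeasure d n \<F> \<delta> (E i))"
    by (rule premeasure_UN_le)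
  also have "\<dots> \<le> (\<Sum>i. covering_measure d n \<F> (E i))"
    by (rule suminf_le) (use \<delta> premeasure_le_measure in auto)
  finally show "premeasure d n \<F> \<delta> (\<Union>i. E i) \<le> (\<Sum>i. covering_measure d n \<F> (E i))" .
qed

section \<open>Separated sets and the passage from local to global estimates\<close>

lemma ediam_empty [simp]: "ediam d {} = 0"
  by (simp add: ediam_def bot_ennreal)

lemma ediam_mono: "A \<subseteq> B \<Longrightarrow> ediam d A \<le> ediam d B"
  unfolding ediam_def by (intro SUP_mono) (blast intro: SUP_mono)

lemma dist_le_ediam:
  assumes "ediam d B \<le> ennreal \<delta>" "x \<in> B" "y \<in> B" "0 \<le> \<delta>"
  shows "d x y \<le> \<delta>"
proof -
  have "ennreal (d x y) \<le> ediam d B" unfolding ediam_def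
    by (rule SUP_upper2[OF assms(2)], rule SUP_upper[OF assms(3)])
  then have "ennreal (d x y) \<le> ennreal \<delta>" using assms(1) by (rule order_trans)
  then show ?thesis using assms(4) by simp
qed

text \<open>A set of diameter below \<open>s\<close> cannot meet both \<open>A\<close> and
  \<open>A'\<close>, so every fine cover splits into a cover of each, members missing the set being
  replaced by \<open>{}\<close>. For this the family must contain \<open>{}\<close>, and
  \<open>n \<ge> 1\<close> makes it weightless, as \<open>0 ^ 0\<close> would be 1.\<close>

lemma covering_measure_add_separated:
  assumes s: "0 < s" and sep: "\<And>x y. x \<in> A \<Longrightarrow> y \<in> A' \<Longrightarrow> s \<le> d x y"
    and F: "{} \<in> \<F>" and n: "1 \<le> n"
  shows "covering_measure d n \<F> A + covering_measure d n \<F> A' \<le> covering_measure d n \<F> (A \<union> A')"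
proof -
  let ?X = "covering_measure d n \<F> (A \<union> A')"
  have small: "premeasure d n \<F> \<delta> A + premeasure d n \<F> \<delta> A' \<le> ?X" if \<delta>: "0 < \<delta>" "\<delta> < s" for \<delta>
  proof -
    have "premeasure d n \<F> \<delta> A + premeasure d n \<F> \<delta> A' \<le> premeasure d n \<F> \<delta> (A \<union> A')"
    proof (rule premeasure_greatest)
      fix B :: "nat \<Rightarrow> 'a set"
      assume B: "range B \<subseteq> \<F>" "A \<union> A' \<subseteq> (\<Union>j. B j)" "\<And>j. ediam d (B j) \<le> ennreal \<delta>"
      define P where "P A j = (if B j \<inter> A = {} then {} else B j)" for A j
      have P: "premeasure d n \<F> \<delta> C \<le> (\<Sum>j. diam_mass d n (P C j))" if CA: "C \<subseteq> A \<union> A'" for C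
      proof (rule premeasure_le)
        show "range (P C) \<subseteq> \<F>" using B(1) F by (auto simp: P_def)
        show "C \<subseteq> (\<Union>j. P C j)"
        proof
          fix x assume x: "x \<in> C"
          then obtain j where "x \<in> B j" using B(2) CA by blast
          then have "x \<in> P C j" using x by (auto simp: P_def)
          then show "x \<in> (\<Union>j. P C j)" by blast
        qed
        show "ediam d (P C j) \<le> ennreal \<delta>" for j using B(3)[of j] by (simp add: P_def)
      qed
      have "premeasure d n \<F> \<delta> A + premeasure d n \<F> \<delta> A'
         \<le> (\<Sum>j. diam_mass d n (P A j)) + (\<Sum>j. diam_mass d n (P A' j))"
        by (rule add_mono[OF P P]) auto
      also have "\<dots> = (\<Sum>j. diam_mass d n (P A j) + diam_mass d n (P A' j))"
        by (rule suminf_add) auto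
      also have "\<dots> \<le> (\<Sum>j. diam_mass d n (B j))"
      proof (rule suminf_le)
        fix j
        have "P A j = {} \<or> P A' j = {}"
        proof (rule ccontr)
          assume "\<not> ?thesis"
          then obtain x y where xy: "x \<in> B j" "x \<in> A" "y \<in> B j" "y \<in> A'"
            by (auto simp: P_def split: if_splits)
          have "d x y \<le> \<delta>" using B(3) xy(1,3) \<delta>(1) by (intro dist_le_ediam[of d "B j"]) auto
          then show False using sep[OF xy(2,4)] \<delta> by simp
        qed
        moreover have "P A j = {} \<or> P A j = B j" "P A' j = {} \<or> P A' j = B j" by (auto simp: P_def)
        ultimately show "diam_mass d n (P A j) + diam_mass d n (P A' j)
           \<le> diam_mass d n (B j)"
          using n by (auto simp: power_0_left)
      qed auto
      finally show "premeasure d n \<F> \<delta> A + premeasure d n \<F> \<delta> A'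
        \<le> (\<Sum>j. diam_mass d n (B j))" .
    qed
    also have "\<dots> \<le> ?X" using \<delta>(1) by (rule premeasure_le_measure)
    finally show ?thesis .
  qed
  have all: "premeasure d n \<F> \<delta> A + premeasure d n \<F> \<delta>' A' \<le> ?X" if "0 < \<delta>" "0 < \<delta>'" for \<delta> \<delta>'
  proof -
    define \<tau> where "\<tau> = min (s/2) (min \<delta> \<delta>')"
    have "premeasure d n \<F> \<delta> A + premeasure d n \<F> \<delta>' A'
      \<le> premeasure d n \<F> \<tau> A + premeasure d n \<F> \<tau> A'"
      by (intro add_mono premeasure_antimono) (auto simp: \<tau>_def)
    also have "\<dots> \<le> ?X" using s that by (intro small) (auto simp: \<tau>_def)
    finally show ?thesis .
  qed
  have "covering_measure d n \<F> A + premeasure d n \<F> \<delta>' A' \<le> ?X" if "0 < \<delta>'" for \<delta>'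
    unfolding covering_measure_eq[of d n \<F> A]
    by (subst ennreal_SUP_add_left[symmetric]) (use that all in \<open>auto intro!: SUP_least\<close>)
  then show ?thesis
    unfolding covering_measure_eq[of d n \<F> A']
    by (subst ennreal_SUP_add_right) (auto intro!: SUP_least)
qed


text \<open>Balls of positive radius are all nonempty, so the value 0 is reached only in the limit
  of covers by padding balls.\<close>

lemma spherical0_empty:
  assumes "Metric_space UNIV d" "1 \<le> n"
  shows "spherical0 d n {} = 0"
proof -
  have "spherical0 d n {} \<le> ennreal 0"
    by (rule spherical0_le_of_ball_covers[OF assms order_refl]) (intro exI[of _ "{}"], simp)
  then show ?thesis by simp
qed

text \<open>On a subset of \<open>good k\<close>, where one radius serves all points, every piece of
  a fine cover contains a good point and lies within its radius, so the local estimate sums up. To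
  exhaust an arbitrary \<open>E\<close>, the differences \<open>R k\<close> of consecutive good sets
  are used as in Caratheodory's criterion: those of equal parity are separated, their Hausdorff
  measures sum to at most twice that of \<open>E\<close>, and so the tail beyond some
  \<open>good k\<close> is negligible for both measures.\<close>

lemma spherical0_le_hausdorff0_of_local:
  fixes d :: "'a::topological_space \<Rightarrow> 'a \<Rightarrow> real"
  assumes M: "Metric_space UNIV d" and n: "1 \<le> n" and \<kappa>: "0 < \<kappa>"
    and loc: "\<And>x. x \<in> S \<Longrightarrow> \<exists>r>0. \<forall>B. B \<subseteq> S \<longrightarrow> (\<forall>y\<in>B. d x y < r) \<longrightarrow>
      spherical0 d n B \<le> ennreal \<kappa> * (diam_mass d n B)"
    and E: "E \<subseteq> S"
  shows "spherical0 d n E \<le> ennreal \<kappa> * hausdorff0 d n E"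
proof -
  interpret Metric_space UNIV d by fact
  let ?H = "hausdorff0 d n" and ?S = "spherical0 d n"
  have H_mono: "?H A \<le> ?H A'" if "A \<subseteq> A'" for A A'
    unfolding hausdorff0_def using that by (rule covering_measure_mono)
  define good where "good k = {x\<in>S. \<forall>B. B \<subseteq> S \<longrightarrow> (\<forall>y\<in>B. d x y < 1 / real (Suc k)) \<longrightarrow>
      ?S B \<le> ennreal \<kappa> * (diam_mass d n B)}" for k
  have good_mono: "good k \<subseteq> good l" if "k \<le> l" for k l
  proof
    fix x assume x: "x \<in> good k"
    have "1 / real (Suc l) \<le> 1 / real (Suc k)" using that by (simp add: frac_le)
    then show "x \<in> good l" using x unfolding good_def by (auto intro: less_le_trans)
  qed
  have good_cover: "\<exists>k. x \<in> good k" if x: "x \<in> S" for x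
  proof -
    obtain r where r: "0 < r" "\<forall>B. B \<subseteq> S \<longrightarrow> (\<forall>y\<in>B. d x y < r) \<longrightarrow>
      ?S B \<le> ennreal \<kappa> * (diam_mass d n B)" using loc[OF x] by blast
    obtain k where k: "1 / real (Suc k) < r" using nat_approx_posE[OF r(1)] by blast
    have "x \<in> good k" unfolding good_def using x
    proof (intro CollectI conjI allI impI)
      fix B assume B: "B \<subseteq> S" "\<forall>y\<in>B. d x y < 1 / real (Suc k)"
      then have "\<forall>y\<in>B. d x y < r" using k by (meson less_trans)
      then show "?S B \<le> ennreal \<kappa> * (diam_mass d n B)" using r(2) B(1) by blast
    qed
    then show ?thesis ..
  qed
  \<comment> \<open>If \<open>d x y < sep k\<close>, the ball of radius 1/(k+2) about y lies in the
    ball of radius 1/(k+1) about x. So goodness of x at level k passes to y at level k+1.\<close>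
  define sep where "sep k = 1 / real (Suc k) - 1 / real (Suc (Suc k))" for k
  have sep_pos: "0 < sep k" for k by (simp add: sep_def frac_less2)
  have good_sep: "sep k \<le> d x y" if x: "x \<in> good k" and y: "y \<in> S" "y \<notin> good (Suc k)" for x y k
  proof (rule ccontr)
    assume "\<not> sep k \<le> d x y"
    then have less: "d x y < sep k" by simp
    have "y \<in> good (Suc k)" unfolding good_def using y(1)
    proof (intro CollectI conjI allI impI)
      fix B assume B: "B \<subseteq> S" "\<forall>z\<in>B. d y z < 1 / real (Suc (Suc k))"
      have "d x z < 1 / real (Suc k)" if "z \<in> B" for z
      proof -
        have "d x z \<le> d x y + d y z" by (rule triangle) auto
        then show ?thesis using less B(2) that unfolding sep_def by fastforce
      qed
      then show "?S B \<le> ennreal \<kappa> * (diam_mass d n B)"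
        using x B(1) unfolding good_def by blast
    qed
    then show False using y(2) by simp
  qed
  have on_good: "?S A \<le> ennreal \<kappa> * ?H A" if A: "A \<subseteq> good k" for A k
  proof -
    define \<delta> where "\<delta> = 1 / (2 * real (Suc k))"
    have \<delta>: "0 < \<delta>" "\<delta> < 1 / real (Suc k)" by (simp_all add: \<delta>_def field_simps)
    have AS: "A \<subseteq> S" using A unfolding good_def by blast
    \<comment> \<open>The factor \<open>\<kappa>\<close> is moved to the left so that the claim
      becomes a lower bound for an infimum over covers.\<close>
    have "ennreal (1 / \<kappa>) * ?S A \<le> premeasure d n {B. closed B} \<delta> A"
    proof (rule premeasure_greatest)
      fix B :: "nat \<Rightarrow> 'a set" assume B: "A \<subseteq> (\<Union>j. B j)" "\<And>j. ediam d (B j) \<le> ennreal \<delta>"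
      have AB: "A = (\<Union>j. A \<inter> B j)" using B(1) by blast
      have "?S A \<le> (\<Sum>j. ?S (A \<inter> B j))"
        by (subst AB) (unfold spherical0_def, rule covering_measure_UN_le)
      also have "\<dots> \<le> (\<Sum>j. ennreal \<kappa> * (diam_mass d n (B j)))"
      proof (rule suminf_le)
        fix j
        show "?S (A \<inter> B j) \<le> ennreal \<kappa> * (diam_mass d n (B j))"
        proof (cases "A \<inter> B j = {}")
          case True
          then show ?thesis by (simp add: spherical0_empty[OF M n])
        next
          case False
          then obtain x where x: "x \<in> A" "x \<in> B j" by blast
          have "\<forall>y\<in>A \<inter> B j. d x y < 1 / real (Suc k)"
          proof
            fix y assume "y \<in> A \<inter> B j"
            then have "d x y \<le> \<delta>" using B(2)[of j] x \<delta>(1) by (intro dist_le_ediam[of d "B j"]) auto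
            then show "d x y < 1 / real (Suc k)" using \<delta>(2) by simp
          qed
          moreover have "A \<inter> B j \<subseteq> S" using AS by blast
          ultimately have "?S (A \<inter> B j) \<le> ennreal \<kappa> * (diam_mass d n (A \<inter> B j))"
            using A x(1) unfolding good_def by blast
          also have "\<dots> \<le> ennreal \<kappa> * (diam_mass d n (B j))"
            by (rule mult_left_mono[OF mult_left_mono[OF power_mono[OF ediam_mono]]]) auto
          finally show ?thesis .
        qed
      qed auto
      also have "\<dots> = ennreal \<kappa> * (\<Sum>j. diam_mass d n (B j))" by (rule ennreal_suminf_cmult)
      finally have "ennreal (1 / \<kappa>) * ?S A \<le> ennreal (1 / \<kappa>) * (ennreal \<kappa> * (\<Sum>j. diam_mass d n (B j)))"
        by (rule mult_left_mono) simp
      also have "\<dots> = ennreal (1 / \<kappa> * \<kappa>) * (\<Sum>j. diam_mass d n (B j))"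
        using \<kappa> by (subst ennreal_mult) (simp_all add: mult.assoc)
      also have "1 / \<kappa> * \<kappa> = 1" using \<kappa> by simp
      finally show "ennreal (1 / \<kappa>) * ?S A \<le> (\<Sum>j. diam_mass d n (B j))" by simp
    qed
    also have "\<dots> \<le> ?H A" unfolding hausdorff0_def using \<delta>(1) by (rule premeasure_le_measure)
    finally have "ennreal \<kappa> * (ennreal (1 / \<kappa>) * ?S A) \<le> ennreal \<kappa> * ?H A" by (rule mult_left_mono) simp
    moreover have "ennreal \<kappa> * (ennreal (1 / \<kappa>) * ?S A) = ennreal (\<kappa> * (1 / \<kappa>)) * ?S A"
      using \<kappa> by (subst ennreal_mult) (simp_all add: mult.assoc)
    moreover have "\<kappa> * (1 / \<kappa>) = 1" using \<kappa> by simp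
    ultimately show ?thesis by simp
  qed
  show ?thesis
  proof (cases "?H E = \<infinity>")
    case True
    then show ?thesis using \<kappa> by (simp add: ennreal_mult_top)
  next
    case False
    define R where "R k = E \<inter> (good (Suc k) - good k)" for k
    text \<open>Annuli of indices of the same parity are at positive distance from each other.\<close>
    have parity: "(\<Sum>i<N. ?H (R (2 * i + p))) \<le> ?H (\<Union>i<N. R (2 * i + p))" for N p
    proof (induction N)
      case (Suc N)
      have "?H (\<Union>i<N. R (2 * i + p)) + ?H (R (2 * N + p)) \<le> ?H ((\<Union>i<N. R (2 * i + p)) \<union> R (2 * N + p))"
        unfolding hausdorff0_def
      \<comment> \<open>For \<open>i < N\<close> the annulus \<open>R (2 * i + p)\<close> lies in
        \<open>good (2 * N + p - 1)\<close>, one level below the set \<open>good (2 * N + p)\<close>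
        avoided by the new annulus. This gap of one level is what skipping every other index
        buys.\<close>
      proof (rule covering_measure_add_separated[OF sep_pos[of "2 * N + p - 1"] _ _ n])
        fix x y assume "x \<in> (\<Union>i<N. R (2 * i + p))" "y \<in> R (2 * N + p)"
        then obtain i where i: "i < N" "x \<in> good (Suc (2 * i + p))" and y: "y \<in> E" "y \<notin> good (2 * N + p)"
          by (auto simp: R_def)
        have "Suc (2 * i + p) \<le> 2 * N + p - 1" using i(1) by linarith
        then have "x \<in> good (2 * N + p - 1)" using i(2) good_mono by blast
        moreover have "Suc (2 * N + p - 1) = 2 * N + p" using i by simp
        ultimately show "sep (2 * N + p - 1) \<le> d x y" using y E by (intro good_sep) auto
      qed simp
      also have "(\<Union>i<N. R (2 * i + p)) \<union> R (2 * N + p) = (\<Union>i<Suc N. R (2 * i + p))"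
        by (auto simp: lessThan_Suc)
      finally show ?case using Suc.IH by (auto intro: order_trans[OF add_right_mono])
    qed simp
    have RE: "?H (\<Union>i<N. R (2 * i + p)) \<le> ?H E" for N p by (rule H_mono) (auto simp: R_def)
    have split: "(\<Sum>j<2 * N. f j) = (\<Sum>i<N. f (2 * i + 0)) + (\<Sum>i<N. f (2 * i + 1))"
      for N and f :: "nat \<Rightarrow> ennreal"
      by (induction N) (simp_all add: ac_simps)
    obtain a where a: "?H E = ennreal a" "0 \<le> a" using False by (cases "?H E") auto
    have "?H (R j) \<le> ennreal a" for j using H_mono[of "R j" E] a by (auto simp: R_def)
    then have "?H (R j) \<noteq> top_class.top" for j by (metis ennreal_neq_top top_unique)
    then have "\<exists>h. ?H (R j) = ennreal h \<and> 0 \<le> h" for j by (metis ennreal_cases)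
    then obtain h where h: "\<And>j. ?H (R j) = ennreal (h j)" "\<And>j. 0 \<le> h j" by metis
    have bound: "(\<Sum>j<N. h j) \<le> 2 * a" for N
    proof -
      have "(\<Sum>j<N. h j) \<le> (\<Sum>j<2 * N. h j)" by (rule sum_mono2) (use h in auto)
      moreover have "ennreal (\<Sum>j<2 * N. h j) \<le> ennreal (a + a)"
      proof -
        have "ennreal (\<Sum>j<2 * N. h j) = (\<Sum>j<2 * N. ?H (R j))" using h by simp
        also have "\<dots> \<le> ?H E + ?H E"
          unfolding split by (rule add_mono; rule order_trans[OF parity RE])
        also have "\<dots> = ennreal (a + a)" by (simp only: a(1) ennreal_plus[OF a(2) a(2)])
        finally show ?thesis .
      qed
      then have "(\<Sum>j<2 * N. h j) \<le> a + a" using a(2) by (subst (asm) ennreal_le_iff) auto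
      ultimately show ?thesis by simp
    qed
    have summable: "summable h" by (rule summableI_nonneg_bounded[OF h(2) bound])
    have two: "?S (A \<union> A') \<le> ?S A + ?S A'" for A A'
    proof -
      define X where "X i = (if i = 0 then A else if i = 1 then A' else {})" for i :: nat
      have "A \<union> A' = (\<Union>i. X i)"
      proof (intro equalityI subsetI)
        fix x assume "x \<in> A \<union> A'"
        then have "x \<in> X 0 \<or> x \<in> X 1" by (auto simp: X_def)
        then show "x \<in> (\<Union>i. X i)" by blast
      qed (auto simp: X_def split: if_splits)
      then have "?S (A \<union> A') \<le> (\<Sum>i. ?S (X i))"
        unfolding spherical0_def by (simp only: covering_measure_UN_le)
      also have "\<dots> = (\<Sum>i\<in>{0, 1}. ?S (X i))"
        by (rule suminf_finite) (auto simp: X_def spherical0_empty[OF M n])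
      finally show ?thesis by (simp add: X_def)
    qed
    show ?thesis
    proof (rule ennreal_le_epsilon)
      fix e :: real assume e: "0 < e"
      then obtain k where "\<forall>m\<ge>k. norm (\<Sum>i. h (i + m)) < e / \<kappa>"
        using suminf_exist_split[OF _ summable, of "e / \<kappa>"] \<kappa> by auto
      then have k: "(\<Sum>i. h (i + k)) \<le> e / \<kappa>" by force
      have sk: "summable (\<lambda>i. h (i + k))" using summable by (rule summable_ignore_initial_segment)
      have "E \<subseteq> (E \<inter> good k) \<union> (\<Union>i. R (i + k))"
      proof
        fix x assume x: "x \<in> E"
        show "x \<in> (E \<inter> good k) \<union> (\<Union>i. R (i + k))"
        proof (cases "x \<in> good k")
          case False
          obtain l0 where "x \<in> good l0" using good_cover x E by blast
          \<comment> \<open>The annulus containing \<open>x\<close> is found from the first level at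
            which \<open>x\<close> is good; that level exceeds \<open>k\<close>, hence is a
            successor.\<close>
          define l where "l = (LEAST l. x \<in> good l)"
          have l: "x \<in> good l" unfolding l_def using \<open>x \<in> good l0\<close> by (rule LeastI)
          have "k < l" using False l good_mono[of l k] by (meson not_le subsetD)
          then obtain i where i: "l = Suc (i + k)" by (metis add.commute less_iff_Suc_add)
          have "x \<notin> good (i + k)" using not_less_Least[of "i + k" "\<lambda>l. x \<in> good l"] i unfolding l_def by simp
          then have "x \<in> R (i + k)" using x l i by (simp add: R_def)
          then show ?thesis by blast
        qed (use x in blast)
      qed
      then have "?S E \<le> ?S ((E \<inter> good k) \<union> (\<Union>i. R (i + k)))"
        unfolding spherical0_def by (rule covering_measure_mono)
      also have "\<dots> \<le> ?S (E \<inter> good k) + ?S (\<Union>i. R (i + k))" by (rule two)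
      also have "?S (E \<inter> good k) \<le> ennreal \<kappa> * ?H E"
        by (rule order_trans[OF on_good mult_left_mono[OF H_mono]]) auto
      also have "?S (\<Union>i. R (i + k)) \<le> (\<Sum>i. ?S (R (i + k)))"
        unfolding spherical0_def by (rule covering_measure_UN_le)
      also have "\<dots> \<le> (\<Sum>i. ennreal \<kappa> * ennreal (h (i + k)))"
      proof (rule suminf_le)
        fix i
        show "?S (R (i + k)) \<le> ennreal \<kappa> * ennreal (h (i + k))"
          unfolding h(1)[symmetric] by (rule on_good[of _ "Suc (i + k)"]) (auto simp: R_def)
      qed auto
      also have "\<dots> = ennreal \<kappa> * ennreal (\<Sum>i. h (i + k))"
        unfolding ennreal_suminf_cmult by (subst suminf_ennreal2[OF h(2) sk]) simp
      also have "\<dots> \<le> ennreal \<kappa> * ennreal (e / \<kappa>)" using k by (intro mult_left_mono ennreal_leI) auto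
      also have "\<dots> = ennreal e" using \<kappa> e by (simp add: ennreal_mult[symmetric])
      finally show "?S E \<le> ennreal \<kappa> * ?H E + ennreal e" by (simp add: add_left_mono)
    qed
  qed
qed

section \<open>Exterior algebra\<close>

text \<open>Left exterior multiplication by the vector with coordinates \<open>x\<close>, as an
  operator on multivectors. The value 0 at infinite \<open>K\<close> agrees with
  \<open>wedge\<close>, whose sum then runs over an infinite set and is 0 by convention.\<close>

definition ext_mult :: "(nat \<Rightarrow> real) \<Rightarrow> multivector \<Rightarrow> multivector" where
  "ext_mult x b K = (if finite K then \<Sum>i\<in>K. (-1) ^ card {j\<in>K. j < i} * x i * b (K - {i}) else 0)"

definition vec_coeffs :: "(nat \<Rightarrow> 'a::euclidean_space) \<Rightarrow> 'a \<Rightarrow> nat \<Rightarrow> real" where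
  "vec_coeffs e v i = (if i \<in> {1..DIM('a)} then v \<bullet> e i else 0)"

text \<open>Only singletons \<open>I\<close> contribute, and the sign counts the elements of
  \<open>K\<close> before the removed one. Every product occurring in the geometric definitions has
  a vector as left factor, so associativity of \<open>wedge\<close> never enters.\<close>

lemma wedge_mv_of_vector:
  "wedge (mv_of_vector e v) b = ext_mult (vec_coeffs e v) b"
proof
  fix K :: "nat set"
  show "wedge (mv_of_vector e v) b K = ext_mult (vec_coeffs e v) b K"
  proof (cases "finite K")
    case False
    then show ?thesis by (simp add: wedge_def ext_mult_def finite_Pow_iff)
  next
    case True
    have mv: "mv_of_vector e v {i} = vec_coeffs e v i" for i
    proof -
      have "mv_of_vector e v {i} = (\<Sum>k = 1..DIM('a). if k = i then v \<bullet> e k else 0)"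
        unfolding mv_of_vector_def by (rule sum.cong) auto
      then show ?thesis by (simp add: vec_coeffs_def)
    qed
    have mv0: "mv_of_vector e v I = 0" if "I \<notin> (\<lambda>i. {i}) ` K" "I \<subseteq> K" for I
      unfolding mv_of_vector_def by (rule sum.neutral) (use that in auto)
    have "wedge (mv_of_vector e v) b K = (\<Sum>I\<in>(\<lambda>i. {i}) ` K.
       (-1) ^ card {(i, j). i \<in> I \<and> j \<in> K - I \<and> j < i} * mv_of_vector e v I * b (K - I))"
      unfolding wedge_def using True mv0 by (intro sum.mono_neutral_right) auto
    also have "\<dots> = (\<Sum>k\<in>K. (-1) ^ card {(i, j). i \<in> {k} \<and> j \<in> K - {k} \<and> j < i} * mv_of_vector e v {k} * b (K - {k}))"
      by (subst sum.reindex) (auto simp: inj_on_def)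
    also have "\<dots> = (\<Sum>i\<in>K. (-1) ^ card {j\<in>K. j < i} * vec_coeffs e v i * b (K - {i}))"
    proof (intro sum.cong refl)
      fix k
      have "{(i, j). i \<in> {k} \<and> j \<in> K - {k} \<and> j < i} = Pair k ` {j\<in>K. j < k}" by auto
      then have "card {(i, j). i \<in> {k} \<and> j \<in> K - {k} \<and> j < i} = card {j\<in>K. j < k}"
        by (simp add: card_image inj_on_def)
      then show "(-1) ^ card {(i, j). i \<in> {k} \<and> j \<in> K - {k} \<and> j < i} * mv_of_vector e v {k} * b (K - {k})
        = (-1) ^ card {j\<in>K. j < k} * vec_coeffs e v k * b (K - {k})" by (simp only: mv)
    qed
    finally show ?thesis using True by (simp add: ext_mult_def)
  qed
qed

lemma wedge_list_eq: "wedge_list e vs = foldr ext_mult (map (vec_coeffs e) vs) mv_one"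
  by (induction vs) (simp_all add: wedge_list_def wedge_mv_of_vector)

lemma ext_mult_sum_left:
  "finite A \<Longrightarrow> ext_mult (\<lambda>i. \<Sum>a\<in>A. c a * x a i) b K = (\<Sum>a\<in>A. c a * ext_mult (x a) b K)"
  by (simp add: ext_mult_def sum_distrib_left sum_distrib_right sum.swap[of _ A K] mult_ac)

lemma ext_mult_sum_right:
  "finite A \<Longrightarrow> ext_mult x (\<lambda>K. \<Sum>a\<in>A. c a * b a K) K = (\<Sum>a\<in>A. c a * ext_mult x (b a) K)"
  by (simp add: ext_mult_def sum_distrib_left sum_distrib_right sum.swap[of _ A K] mult_ac)

lemma ext_mult_zero_right [simp]: "ext_mult x (\<lambda>_. 0) = (\<lambda>_. 0)"
  by (simp add: ext_mult_def fun_eq_iff)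

lemma ext_mult_cmult_right: "ext_mult x (\<lambda>K. c * b K) = (\<lambda>K. c * ext_mult x b K)"
  by (simp add: ext_mult_def fun_eq_iff sum_distrib_left mult_ac)

text \<open>Removing the smaller index first lowers the position of the larger one by one, whereas
  removing the larger first leaves the position of the smaller unchanged.\<close>

lemma removal_signs:
  fixes K :: "nat set"
  assumes "finite K" "i \<in> K" "j \<in> K" "i < j"
  shows "(-1::real) ^ card {k\<in>K. k < i} * (-1) ^ card {k\<in>K - {i}. k < j}
       = - ((-1) ^ card {k\<in>K. k < j} * (-1) ^ card {k\<in>K - {j}. k < i})"
proof -
  have "{k\<in>K. k < j} = insert i {k\<in>K - {i}. k < j}" using assms by auto
  then have "card {k\<in>K. k < j} = Suc (card {k\<in>K - {i}. k < j})" using assms(1) by simp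
  moreover have "{k\<in>K - {j}. k < i} = {k\<in>K. k < i}" using assms by auto
  ultimately show ?thesis by simp
qed

lemma ext_mult_anticommute:
  "ext_mult x (ext_mult y b) = (\<lambda>K. - ext_mult y (ext_mult x b) K)"
proof
  fix K :: "nat set"
  show "ext_mult x (ext_mult y b) K = - ext_mult y (ext_mult x b) K"
  proof (cases "finite K")
    case True
    define s where "s L i = (-1::real) ^ card {j\<in>L. j < i}" for L :: "nat set" and i
    define P where "P = {p \<in> K \<times> K. fst p \<noteq> snd p}"
    have expand: "ext_mult u (ext_mult w b) K
       = (\<Sum>(i, j)\<in>P. s K i * s (K - {i}) j * u i * w j * b (K - {i} - {j}))" for u w
    proof -
      have "ext_mult u (ext_mult w b) K = (\<Sum>i\<in>K. \<Sum>j\<in>K - {i}. s K i * s (K - {i}) j * u i * w j * b (K - {i} - {j}))"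
        using True by (simp add: ext_mult_def s_def sum_distrib_left mult_ac)
      also have "\<dots> = (\<Sum>(i, j)\<in>Sigma K (\<lambda>i. K - {i}). s K i * s (K - {i}) j * u i * w j * b (K - {i} - {j}))"
        using True by (intro sum.Sigma) auto
      also have "Sigma K (\<lambda>i. K - {i}) = P" by (auto simp: P_def)
      finally show ?thesis .
    qed
    have sgn: "s K i * s (K - {i}) j = - (s K j * s (K - {j}) i)" if "i \<in> K" "j \<in> K" "i \<noteq> j" for i j
      using removal_signs[OF True, of i j] removal_signs[OF True, of j i] that unfolding s_def
      by (cases i j rule: linorder_cases) auto
    have "ext_mult y (ext_mult x b) K
      = (\<Sum>(i, j)\<in>P. s K j * s (K - {j}) i * y j * x i * b (K - {j} - {i}))"
      unfolding expand by (rule sum.reindex_bij_witness[where i = prod.swap and j = prod.swap]) (auto simp: P_def)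
    also have "\<dots> = (\<Sum>(i, j)\<in>P. - (s K i * s (K - {i}) j * x i * y j * b (K - {i} - {j})))"
    proof (intro sum.cong refl, clarify)
      fix i j assume "(i, j) \<in> P"
      then have ij: "i \<in> K" "j \<in> K" "i \<noteq> j" by (auto simp: P_def)
      have "K - {j} - {i} = K - {i} - {j}" by auto
      then show "s K j * s (K - {j}) i * y j * x i * b (K - {j} - {i}) = - (s K i * s (K - {i}) j * x i * y j * b (K - {i} - {j}))"
        using sgn[OF ij] by (simp add: mult_ac)
    qed
    also have "\<dots> = - ext_mult x (ext_mult y b) K"
      unfolding expand by (simp add: sum_negf case_prod_unfold)
    finally show ?thesis by simp
  qed (simp add: ext_mult_def)
qed

lemma ext_mult_twice: "ext_mult x (ext_mult x b) = (\<lambda>_. 0)"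
proof
  fix K
  have "ext_mult x (ext_mult x b) K = - ext_mult x (ext_mult x b) K"
    by (rule fun_cong[OF ext_mult_anticommute])
  then show "ext_mult x (ext_mult x b) K = 0" by simp
qed

text \<open>The new factor moves to its sorted place past the smaller ones, each changing the sign;
  if it meets a copy of itself, the product vanishes.\<close>

lemma ext_mult_sorted_list:
  assumes "sorted_wrt (<) xs"
  shows "ext_mult (f i) (foldr ext_mult (map f xs) mv_one)
    = (\<lambda>K. if i \<in> set xs then 0 else (-1) ^ card {j\<in>set xs. j < i} * foldr ext_mult (map f (insort i xs)) mv_one K)"
  using assms
proof (induction xs)
  case (Cons x xs)
  have less: "\<And>y. y \<in> set xs \<Longrightarrow> x < y" using Cons.prems by simp
  consider "i < x" | "i = x" | "x < i" by (rule linorder_cases)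
  then show ?case
  proof cases
    case 1
    then have nin: "i \<notin> set (x # xs)" and "{j\<in>set (x # xs). j < i} = {}"
      using less by (auto dest: less_trans order.asym)
    then have c0: "card {j\<in>set (x # xs). j < i} = 0" by (simp only: card.empty)
    have "i \<le> x" using 1 by simp
    then show ?thesis unfolding c0 using nin by (simp add: fun_eq_iff)
  next
    case 2
    then show ?thesis by (simp add: ext_mult_twice)
  next
    case 3
    have "ext_mult (f i) (foldr ext_mult (map f (x # xs)) mv_one)
      = (\<lambda>K. - ext_mult (f x) (ext_mult (f i) (foldr ext_mult (map f xs) mv_one)) K)"
      by (simp add: ext_mult_anticommute[of "f i"])
    also have "\<dots> = (\<lambda>K. - ext_mult (f x) (\<lambda>K. if i \<in> set xs then 0 else (-1) ^ card {j\<in>set xs. j < i} * foldr ext_mult (map f (insort i xs)) mv_one K) K)"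
      using Cons by simp
    also have "\<dots> = (\<lambda>K. if i \<in> set (x # xs) then 0 else (-1) ^ card {j\<in>set (x # xs). j < i} * foldr ext_mult (map f (insort i (x # xs))) mv_one K)"
    proof (cases "i \<in> set xs")
      case False
      have "{j\<in>set (x # xs). j < i} = insert x {j\<in>set xs. j < i}" using 3 by auto
      moreover have "x \<notin> set xs" using less by blast
      ultimately have c: "card {j\<in>set (x # xs). j < i} = Suc (card {j\<in>set xs. j < i})" by simp
      have "\<not> i \<le> x" "i \<noteq> x" using 3 by auto
      then show ?thesis unfolding c using False by (simp add: ext_mult_cmult_right fun_eq_iff)
    qed (use 3 in simp)
    finally show ?thesis .
  qed
qed simp

lemma ext_mult_sorted_list_of_set:
  assumes "finite J"
  shows "ext_mult (f i) (foldr ext_mult (map f (sorted_list_of_set J)) mv_one)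
    = (\<lambda>K. if i \<in> J then 0 else (-1) ^ card {j\<in>J. j < i} * foldr ext_mult (map f (sorted_list_of_set (insert i J))) mv_one K)"
  using ext_mult_sorted_list[of "sorted_list_of_set J" f i] assms
  by (auto simp: fun_eq_iff sorted_list_of_set_insert_remove)

text \<open>Increasing products of unit vectors are the basis multivectors, with sign +1 because
  each new front factor has the smallest index.\<close>

lemma foldr_ext_mult_unit:
  assumes "sorted_wrt (<) xs"
  shows "foldr ext_mult (map (\<lambda>i k. if k = i then 1 else 0) xs) mv_one K = (if K = set xs then 1 else 0)"
  using assms
proof (induction xs arbitrary: K)
  case (Cons x xs)
  have less: "\<And>y. y \<in> set xs \<Longrightarrow> x < y" using Cons.prems by simp
  define b where "b = foldr ext_mult (map (\<lambda>i k. if k = i then 1 else 0) xs) mv_one"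
  have b: "b L = (if L = set xs then 1 else 0)" for L unfolding b_def using Cons by simp
  have "ext_mult (\<lambda>k. if k = x then 1 else 0) b K = (if K = set (x # xs) then 1 else 0)"
  proof (cases "finite K \<and> x \<in> K")
    case True
    have "ext_mult (\<lambda>k. if k = x then 1 else 0) b K
      = (\<Sum>i\<in>K. (-1) ^ card {j\<in>K. j < i} * (if i = x then 1 else 0) * b (K - {i}))"
      using True by (simp add: ext_mult_def)
    also have "\<dots> = (\<Sum>i\<in>K. if i = x then (-1) ^ card {j\<in>K. j < x} * b (K - {x}) else 0)"
      by (rule sum.cong) auto
    also have "\<dots> = (-1) ^ card {j\<in>K. j < x} * b (K - {x})" using True by simp
    finally have eq: "ext_mult (\<lambda>k. if k = x then 1 else 0) b K = (-1) ^ card {j\<in>K. j < x} * b (K - {x})" .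
    show ?thesis
    proof (cases "K = set (x # xs)")
      case True
      have "x \<notin> set xs" using less by blast
      moreover have "{j\<in>K. j < x} = {}" using True less by (auto dest: order.asym)
      then have c0: "card {j\<in>K. j < x} = 0" by (simp only: card.empty)
      moreover have "K - {x} = set xs" using True \<open>x \<notin> set xs\<close> by auto
      ultimately show ?thesis unfolding eq c0 using True b[of "set xs"] by simp
    next
      case False
      then have "K - {x} \<noteq> set xs" using \<open>finite K \<and> x \<in> K\<close> by auto
      then show ?thesis unfolding eq using False b[of "K - {x}"] by simp
    qed
  next
    case False
    then have "K \<noteq> set (x # xs)" by auto
    moreover have "(\<Sum>i\<in>K. (-1) ^ card {j\<in>K. j < i} * (if i = x then 1 else 0) * b (K - {i})) = 0" if "finite K"
      by (rule sum.neutral) (use that False in auto)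
    ultimately show ?thesis by (simp add: ext_mult_def)
  qed
  then show ?case by (simp add: b_def)
qed (simp add: mv_one_def)

text \<open>The map induced by \<open>M\<close> on the exterior algebra, prescribed on basis
  multivectors and extended linearly.\<close>

definition ext_power :: "(nat \<Rightarrow> 'a::euclidean_space) \<Rightarrow> ('a \<Rightarrow> 'a) \<Rightarrow> multivector \<Rightarrow> multivector" where
  "ext_power e M b K = (\<Sum>J\<in>Pow {1..DIM('a)}. b J * wedge_list e (map (\<lambda>i. M (e i)) (sorted_list_of_set J)) K)"

lemma ext_power_sum:
  "finite A \<Longrightarrow> ext_power e M (\<lambda>K. \<Sum>a\<in>A. c a * b a K) = (\<lambda>K. \<Sum>a\<in>A. c a * ext_power e M (b a) K)"
  by (simp add: ext_power_def fun_eq_iff sum_distrib_left sum_distrib_right sum.swap[of _ A] mult_ac)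

lemma ext_power_zero [simp]: "ext_power e M (\<lambda>_. 0) = (\<lambda>_. 0)"
  by (simp add: ext_power_def fun_eq_iff)

lemma ext_power_mv_one: "ext_power e M mv_one = mv_one"
proof
  fix K
  have "ext_power e M mv_one K = (\<Sum>J\<in>{{}}. mv_one J * wedge_list e (map (\<lambda>i. M (e i)) (sorted_list_of_set J)) K)"
    unfolding ext_power_def by (intro sum.mono_neutral_right) (auto simp: mv_one_def)
  then show "ext_power e M mv_one K = mv_one K" by (simp add: mv_one_def wedge_list_def)
qed

abbreviation orthonormal_seq :: "(nat \<Rightarrow> 'a::euclidean_space) \<Rightarrow> bool" where
  "orthonormal_seq e \<equiv> \<forall>i\<in>{1..DIM('a)}. \<forall>k\<in>{1..DIM('a)}. e i \<bullet> e k = (if i = k then 1 else 0)"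

lemma orthonormal_expansion:
  fixes e :: "nat \<Rightarrow> 'a::euclidean_space"
  assumes on: "orthonormal_seq e"
  shows "v = (\<Sum>i\<in>{1..DIM('a)}. (v \<bullet> e i) *\<^sub>R e i)"
proof -
  let ?q = "DIM('a)"
  have inj: "inj_on e {1..?q}"
  proof (rule inj_onI)
    fix i k assume *: "i \<in> {1..?q}" "k \<in> {1..?q}" "e i = e k"
    then have "e i \<bullet> e k = 1" using on by auto
    then show "i = k" using on * by (metis zero_neq_one)
  qed
  have orth: "pairwise orthogonal (e ` {1..?q})"
    unfolding pairwise_def orthogonal_def using on by auto
  have "0 \<notin> e ` {1..?q}" using on by force
  then have ind: "independent (e ` {1..?q})" using orth by (rule pairwise_orthogonal_independent[rotated])
  have "card (e ` {1..?q}) = ?q" using inj by (simp add: card_image)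
  have span: "UNIV \<subseteq> span (e ` {1..?q})"
    using ind \<open>card (e ` {1..?q}) = ?q\<close> by (intro card_ge_dim_independent) auto
  show ?thesis
  proof (rule vector_eq_dot_span[where B = "e ` {1..?q}"])
    fix b assume "b \<in> e ` {1..?q}"
    then obtain k where k: "k \<in> {1..?q}" "b = e k" by auto
    have "b \<bullet> (\<Sum>i\<in>{1..?q}. (v \<bullet> e i) *\<^sub>R e i) = (\<Sum>i\<in>{1..?q}. (v \<bullet> e i) * (e i \<bullet> e k))"
      by (simp add: inner_sum_right k(2) inner_commute)
    also have "\<dots> = (\<Sum>i\<in>{1..?q}. if i = k then v \<bullet> e i else 0)"
      by (rule sum.cong) (use on k in auto)
    also have "\<dots> = b \<bullet> v" using k by (simp add: inner_commute)
    finally show "b \<bullet> v = b \<bullet> (\<Sum>i\<in>{1..?q}. (v \<bullet> e i) *\<^sub>R e i)" by simp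
  qed (use span in auto)
qed

lemma vec_coeffs_expansion:
  fixes e :: "nat \<Rightarrow> 'a::euclidean_space"
  assumes on: "orthonormal_seq e"
    and M: "linear M"
  shows "vec_coeffs e (M v) = (\<lambda>k. \<Sum>i\<in>{1..DIM('a)}. vec_coeffs e v i * vec_coeffs e (M (e i)) k)"
proof
  fix k
  have "M v = M (\<Sum>i\<in>{1..DIM('a)}. (v \<bullet> e i) *\<^sub>R e i)" using orthonormal_expansion[OF on, of v] by simp
  also have "\<dots> = (\<Sum>i\<in>{1..DIM('a)}. (v \<bullet> e i) *\<^sub>R M (e i))"
    by (simp add: linear_sum[OF M] linear_scale[OF M])
  finally show "vec_coeffs e (M v) k = (\<Sum>i\<in>{1..DIM('a)}. vec_coeffs e v i * vec_coeffs e (M (e i)) k)"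
    by (auto simp: vec_coeffs_def inner_sum_left)
qed

text \<open>Compatibility of the induced map with products, which need only be known for a vector on
  the left. After expanding \<open>v\<close>, both sides are sums over pairs of an index i and a set
  J not containing it, matched by sending (i, J) to the pair of \<open>insert i J\<close> and
  i.\<close>

lemma ext_power_ext_mult:
  fixes e :: "nat \<Rightarrow> 'a::euclidean_space"
  assumes on: "orthonormal_seq e"
    and M: "linear M"
  shows "ext_power e M (ext_mult (vec_coeffs e v) b) = ext_mult (vec_coeffs e (M v)) (ext_power e M b)"
proof
  fix K
  let ?Q = "{1..DIM('a)}" and ?x = "vec_coeffs e v"
  define W where "W J = wedge_list e (map (\<lambda>i. M (e i)) (sorted_list_of_set J))" for J
  define f where "f i = vec_coeffs e (M (e i))" for i
  have W: "W J = foldr ext_mult (map f (sorted_list_of_set J)) mv_one" for J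
  proof -
    have "f = (\<lambda>i. vec_coeffs e (M (e i)))" by (simp add: fun_eq_iff f_def)
    then show ?thesis by (simp add: W_def wedge_list_eq comp_def)
  qed
  have key: "ext_mult (f i) (W J) K = (if i \<in> J then 0 else (-1) ^ card {j\<in>J. j < i} * W (insert i J) K)"
    if "J \<subseteq> ?Q" for i J
    using ext_mult_sorted_list_of_set[OF finite_subset[OF that], of f i] unfolding W by simp
  have "ext_mult (vec_coeffs e (M v)) (ext_power e M b) K = (\<Sum>i\<in>?Q. ?x i * ext_mult (f i) (ext_power e M b) K)"
    unfolding vec_coeffs_expansion[OF on M, of v] f_def by (rule ext_mult_sum_left) simp
  also have "\<dots> = (\<Sum>i\<in>?Q. \<Sum>J\<in>Pow ?Q. ?x i * (b J * ext_mult (f i) (W J) K))"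
  proof (intro sum.cong refl)
    fix i
    have "ext_power e M b = (\<lambda>K. \<Sum>J\<in>Pow ?Q. b J * W J K)" by (simp add: ext_power_def W_def fun_eq_iff)
    then show "?x i * ext_mult (f i) (ext_power e M b) K = (\<Sum>J\<in>Pow ?Q. ?x i * (b J * ext_mult (f i) (W J) K))"
      by (simp add: ext_mult_sum_right sum_distrib_left)
  qed
  also have "\<dots> = (\<Sum>(i, J)\<in>?Q \<times> Pow ?Q. ?x i * (b J * ext_mult (f i) (W J) K))"
    by (simp add: sum.cartesian_product)
  also have "\<dots> = (\<Sum>(i, J)\<in>{(i, J). i \<in> ?Q \<and> J \<subseteq> ?Q \<and> i \<notin> J}. ?x i * (b J * ((-1) ^ card {j\<in>J. j < i} * W (insert i J) K)))"
  proof (rule sum.mono_neutral_cong_right)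
    show "finite (?Q \<times> Pow ?Q)" by simp
  qed (auto simp: key)
  also have "\<dots> = (\<Sum>(J, i)\<in>Sigma (Pow ?Q) (\<lambda>J. J). (-1) ^ card {j\<in>J. j < i} * ?x i * b (J - {i}) * W J K)"
  proof (rule sum.reindex_bij_witness[where i = "\<lambda>(J, i). (i, J - {i})" and j = "\<lambda>(i, J). (insert i J, i)"])
    fix p assume "p \<in> {(i, J). i \<in> ?Q \<and> J \<subseteq> ?Q \<and> i \<notin> J}"
    then obtain i J where p: "p = (i, J)" "i \<in> ?Q" "J \<subseteq> ?Q" "i \<notin> J" by auto
    have "{j\<in>insert i J. j < i} = {j\<in>J. j < i}" "insert i J - {i} = J" using p by auto
    then show "(case case p of (i, J) \<Rightarrow> (insert i J, i) of
          (J, i) \<Rightarrow> (-1) ^ card {j\<in>J. j < i} * ?x i * b (J - {i}) * W J K)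
       = (case p of (i, J) \<Rightarrow> ?x i * (b J * ((-1) ^ card {j\<in>J. j < i} * W (insert i J) K)))"
      unfolding p by (simp only: case_prod_conv) (simp only: mult_ac)
  qed auto
  also have "\<dots> = (\<Sum>J\<in>Pow ?Q. \<Sum>i\<in>J. (-1) ^ card {j\<in>J. j < i} * ?x i * b (J - {i}) * W J K)"
    by (rule sum.Sigma[symmetric]) (auto intro: finite_subset)
  also have "\<dots> = (\<Sum>J\<in>Pow ?Q. ext_mult ?x b J * W J K)"
    by (rule sum.cong) (auto simp: ext_mult_def sum_distrib_right dest: finite_subset)
  also have "\<dots> = ext_power e M (ext_mult ?x b) K" by (simp add: ext_power_def W_def)
  finally show "ext_power e M (ext_mult ?x b) K = ext_mult (vec_coeffs e (M v)) (ext_power e M b) K" by simp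
qed

lemma ext_power_wedge_list:
  fixes e :: "nat \<Rightarrow> 'a::euclidean_space"
  assumes on: "orthonormal_seq e"
    and M: "linear M"
  shows "ext_power e M (wedge_list e vs) = wedge_list e (map M vs)"
proof (induction vs)
  case Nil
  show ?case using ext_power_mv_one[of e M] by (simp add: wedge_list_def)
next
  case (Cons v vs)
  then show ?case using ext_power_ext_mult[OF on M, of v "wedge_list e vs"] by (simp add: wedge_list_eq)
qed

text \<open>The vectors annihilating a fixed multivector form a subspace, so \<open>t\<close> may be
  taken from the list; it then moves through the product until it meets itself.\<close>

lemma wedge_list_span_zero:
  assumes "t \<in> span (set ts)"
  shows "ext_mult (vec_coeffs e t) (wedge_list e ts) = (\<lambda>_. 0)"
  using assms
proof (induction rule: span_induct)
  case base
  let ?Z = "{t. ext_mult (vec_coeffs e t) (wedge_list e ts) = (\<lambda>_. 0)}"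
  show ?case
  proof (rule subspaceI)
    have "vec_coeffs e 0 = (\<lambda>_. 0)" by (simp add: vec_coeffs_def fun_eq_iff)
    then have "ext_mult (vec_coeffs e 0) b K = 0" for b K by (simp add: ext_mult_def)
    then show "0 \<in> ?Z" by (simp add: fun_eq_iff)
  next
    fix x y assume "x \<in> ?Z"
      "y \<in> ?Z"
    moreover have "ext_mult (vec_coeffs e (x + y)) b K = ext_mult (vec_coeffs e x) b K + ext_mult (vec_coeffs e y) b K" for b K
      by (auto simp: ext_mult_def vec_coeffs_def inner_add_left sum.distrib[symmetric] algebra_simps intro!: sum.cong)
    ultimately show "x + y \<in> ?Z" by (simp add: fun_eq_iff)
  next
    fix c x assume "x \<in> ?Z"
    moreover have "ext_mult (vec_coeffs e (c *\<^sub>R x)) b K = c * ext_mult (vec_coeffs e x) b K" for b K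
      by (auto simp: ext_mult_def vec_coeffs_def sum_distrib_left algebra_simps intro!: sum.cong)
    ultimately show "c *\<^sub>R x \<in> ?Z" by (simp add: fun_eq_iff)
  qed
next
  case (step t)
  then show ?case
  proof (induction ts)
    case (Cons s ts)
    show ?case
    proof (cases "t = s")
      case True
      then show ?thesis by (simp add: wedge_list_eq ext_mult_twice)
    next
      case False
      then have "ext_mult (vec_coeffs e t) (wedge_list e ts) = (\<lambda>_. 0)" using Cons by simp
      moreover have "wedge_list e (s # ts) = ext_mult (vec_coeffs e s) (wedge_list e ts)" by (simp add: wedge_list_eq)
      ultimately show ?thesis by (simp add: ext_mult_anticommute[of "vec_coeffs e t"])
    qed
  qed simp
qed

text \<open>Degrees add under the product. In total degree \<open>j + M\<close> only the parts of
  maximal degree of both factors can contribute, so their product is a homogeneous component of the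
  vanishing product.\<close>

lemma ext_mult_top_degree:
  fixes deg :: "nat \<Rightarrow> nat"
  assumes zero: "ext_mult x b = (\<lambda>_. 0)"
    and b: "\<And>K. b K \<noteq> 0 \<Longrightarrow> (\<Sum>i\<in>K. deg i) \<le> M" and x: "\<And>i. x i \<noteq> 0 \<Longrightarrow> deg i \<le> j"
  shows "ext_mult (\<lambda>i. if deg i = j then x i else 0) (\<lambda>K. if (\<Sum>i\<in>K. deg i) = M then b K else 0) = (\<lambda>_. 0)"
proof
  fix K
  let ?x = "\<lambda>i. if deg i = j then x i else 0" and ?b = "\<lambda>K. if (\<Sum>i\<in>K. deg i) = M then b K else 0"
  show "ext_mult ?x ?b K = 0"
  proof (cases "finite K")
    case True
    have deg: "(\<Sum>i\<in>K. deg i) = deg i + (\<Sum>k\<in>K - {i}. deg k)" if "i \<in> K" for i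
      using True that by (rule sum.remove)
    show ?thesis
    proof (cases "(\<Sum>i\<in>K. deg i) = j + M")
      case eq: True
      have "?x i * ?b (K - {i}) = x i * b (K - {i})" if "i \<in> K" for i
        using deg[OF that] eq b[of "K - {i}"] x[of i] by (cases "x i = 0 \<or> b (K - {i}) = 0") auto
      then have "ext_mult ?x ?b K = ext_mult x b K"
        unfolding ext_mult_def by (intro if_cong sum.cong refl) (simp only: mult.assoc)
      then show ?thesis using zero by simp
    next
      case False
      have "?x i * ?b (K - {i}) = 0" if "i \<in> K" for i
        using deg[OF that] False by auto
      then have "(\<Sum>i\<in>K. (-1) ^ card {j\<in>K. j < i} * ?x i * ?b (K - {i})) = 0"
        by (intro sum.neutral ballI) (simp only: mult.assoc mult_zero_right)
      then show ?thesis using True unfolding ext_mult_def by (simp only: if_True)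
    qed
  qed (simp add: ext_mult_def)
qed

section \<open>Homogeneous groups\<close>

context homogeneous_group
begin

abbreviation lcomp :: "'a \<Rightarrow> nat \<Rightarrow> 'a" where "lcomp \<equiv> component G"

lemma layer_decomposition_exists: "\<exists>c. (\<forall>j. c j \<in> layer G j) \<and> x = (\<Sum>j = 1..step G. c j)"
proof -
  let ?D = "{x. \<exists>c. (\<forall>j. c j \<in> layer G j) \<and> x = (\<Sum>j = 1..step G. c j)}"
  have "x \<in> span (\<Union>j\<in>{1..step G}. layer G j)" by (simp only: layer_span UNIV_I)
  then show ?thesis
  proof (induction rule: span_induct)
    case base
    show ?case
    proof (rule subspaceI)
      show "0 \<in> ?D"
        by (auto intro!: exI[of _ "\<lambda>_. 0"] subspace_0[OF layer_subspace])
    next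
      fix x y assume "x \<in> ?D"
        "y \<in> ?D"
      then obtain c c' where "\<forall>j. c j \<in> layer G j" "x = (\<Sum>j = 1..step G. c j)"
        "\<forall>j. c' j \<in> layer G j" "y = (\<Sum>j = 1..step G. c' j)" by blast
      then show "x + y \<in> ?D"
        by (auto intro!: exI[of _ "\<lambda>j. c j + c' j"] subspace_add[OF layer_subspace] simp: sum.distrib)
    next
      fix r x assume "x \<in> ?D"
      then obtain c where "\<forall>j. c j \<in> layer G j" "x = (\<Sum>j = 1..step G. c j)" by blast
      then show "r *\<^sub>R x \<in> ?D"
        by (auto intro!: exI[of _ "\<lambda>j. r *\<^sub>R c j"] subspace_scale[OF layer_subspace] simp: scaleR_sum_right)
    qed
  next
    case (step x)
    then obtain i where i: "i \<in> {1..step G}" "x \<in> layer G i" by blast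
    show ?case
    proof (intro exI[of _ "\<lambda>j. if j = i then x else 0"] conjI allI)
      show "(if j = i then x else 0) \<in> layer G j" for j using i subspace_0[OF layer_subspace] by simp
      show "x = (\<Sum>j = 1..step G. if j = i then x else 0)" using i(1) by simp
    qed
  qed
qed

lemma layer_decomposition_unique:
  assumes "\<And>j. c j \<in> layer G j" "\<And>j. c' j \<in> layer G j" "(\<Sum>j = 1..step G. c j) = (\<Sum>j = 1..step G. c' j)"
  shows "c = c'"
proof
  fix i
  show "c i = c' i"
  proof (cases "i \<in> {1..step G}")
    case False
    then have "layer G i = {0}" by (rule layer_outside)
    then show ?thesis using assms(1)[of i] assms(2)[of i] by simp
  next
    case True
    define f where "f j = c j - c' j" for j
    have f: "f j \<in> layer G j" for j unfolding f_def by (intro subspace_diff layer_subspace assms)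
    have "0 = (\<Sum>j = 1..step G. f j) \<bullet> f i" using assms(3) by (simp add: f_def sum_subtractf)
    also have "\<dots> = (\<Sum>j = 1..step G. f j \<bullet> f i)" by (simp add: inner_sum_left)
    also have "\<dots> = (\<Sum>j = 1..step G. if j = i then f i \<bullet> f i else 0)"
      by (rule sum.cong) (use layer_orthogonal[OF _ f f] in auto)
    also have "\<dots> = f i \<bullet> f i" using True by simp
    finally show ?thesis by (simp add: f_def)
  qed
qed

text \<open>Justifies the definite description in \<open>component\<close>: the layers span, which
  gives existence, and are orthogonal, which gives uniqueness.\<close>

lemma comp_decomposition: "lcomp x j \<in> layer G j" "x = (\<Sum>j = 1..step G. lcomp x j)"
proof -
  have "\<exists>!c. (\<forall>j. c j \<in> layer G j) \<and> x = (\<Sum>j = 1..step G. c j)"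
  proof (rule ex_ex1I[OF layer_decomposition_exists])
    show "c = c'" if "(\<forall>j. c j \<in> layer G j) \<and> x = (\<Sum>j = 1..step G. c j)"
      "(\<forall>j. c' j \<in> layer G j) \<and> x = (\<Sum>j = 1..step G. c' j)" for c c'
      using that by (intro layer_decomposition_unique) auto
  qed
  from theI'[OF this] show "lcomp x j \<in> layer G j" "x = (\<Sum>j = 1..step G. lcomp x j)"
    unfolding component_def by blast+
qed

lemma comp_eqI:
  assumes "\<And>j. c j \<in> layer G j" "x = (\<Sum>j = 1..step G. c j)"
  shows "lcomp x = c"
  by (rule layer_decomposition_unique) (use assms comp_decomposition in auto)

lemma comp_outside: "j \<notin> {1..step G} \<Longrightarrow> lcomp x j = 0"
  using comp_decomposition(1)[of x j] layer_outside[of j] by simp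

lemma comp_add: "lcomp (x + y) j = lcomp x j + lcomp y j"
proof -
  have "lcomp (x + y) = (\<lambda>j. lcomp x j + lcomp y j)"
  proof (rule comp_eqI)
    show "lcomp x j + lcomp y j \<in> layer G j" for j by (intro subspace_add layer_subspace comp_decomposition)
    show "x + y = (\<Sum>j = 1..step G. lcomp x j + lcomp y j)"
      using comp_decomposition(2)[of x] comp_decomposition(2)[of y] by (simp add: sum.distrib)
  qed
  then show ?thesis by simp
qed

lemma comp_scale: "lcomp (r *\<^sub>R x) j = r *\<^sub>R lcomp x j"
proof -
  have "lcomp (r *\<^sub>R x) = (\<lambda>j. r *\<^sub>R lcomp x j)"
  proof (rule comp_eqI)
    show "r *\<^sub>R lcomp x j \<in> layer G j" for j by (intro subspace_scale layer_subspace comp_decomposition)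
    show "r *\<^sub>R x = (\<Sum>j = 1..step G. r *\<^sub>R lcomp x j)"
      using comp_decomposition(2)[of x] by (simp add: scaleR_sum_right[symmetric])
  qed
  then show ?thesis by simp
qed

lemma linear_comp: "linear (\<lambda>x. lcomp x j)"
  by (rule linearI) (simp_all add: comp_add comp_scale)

lemma comp_0 [simp]: "lcomp 0 j = 0"
  using linear_0[OF linear_comp] .

lemma comp_diff: "lcomp (x - y) j = lcomp x j - lcomp y j"
  using linear_diff[OF linear_comp] .

lemma comp_layer: "x \<in> layer G i \<Longrightarrow> lcomp x j = (if j = i then x else 0)"
proof -
  assume x: "x \<in> layer G i"
  show ?thesis
  proof (cases "i \<in> {1..step G}")
    case False
    then have "x = 0" using x layer_outside by auto
    then show ?thesis by simp
  next
    case True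
    have "lcomp x = (\<lambda>j. if j = i then x else 0)"
      by (rule comp_eqI) (use x True subspace_0[OF layer_subspace] in auto)
    then show ?thesis by simp
  qed
qed

lemma in_layer_iff: "x \<in> layer G i \<longleftrightarrow> (\<forall>j. j \<noteq> i \<longrightarrow> lcomp x j = 0)"
proof
  assume z: "\<forall>j. j \<noteq> i \<longrightarrow> lcomp x j = 0"
  have "x = (\<Sum>j = 1..step G. lcomp x j)" by (rule comp_decomposition)
  also have "\<dots> = (\<Sum>j = 1..step G. if j = i then lcomp x i else 0)" by (rule sum.cong) (use z in auto)
  also have "\<dots> = lcomp x i" by (simp add: comp_outside)
  finally show "x \<in> layer G i" using comp_decomposition(1)[of x i] by simp
qed (simp add: comp_layer)

lemma comp_eq_iff: "x = y \<longleftrightarrow> (\<forall>j. lcomp x j = lcomp y j)"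
  using comp_decomposition(2)[of x] comp_decomposition(2)[of y] by (metis (mono_tags, lifting) sum.cong)

lemma step_pos: "1 \<le> step G"
proof (rule ccontr)
  assume "\<not> 1 \<le> step G"
  then have "step G \<notin> {1..step G}" by simp
  then show False using layer_outside[of "step G"] layer_step by simp
qed

text \<open>The sum of the layers of degree at least \<open>j\<close>; these ideals measure how far
  a perturbation sits from the low layers.\<close>

definition filt :: "nat \<Rightarrow> 'a set" where
  "filt j = {x. \<forall>i<j. lcomp x i = 0}"

lemma subspace_filt: "subspace (filt j)"
  by (rule subspaceI) (simp_all add: filt_def comp_add comp_scale)

lemma filt_1 [simp]: "filt (Suc 0) = UNIV" "filt 1 = UNIV"
  by (simp_all add: filt_def comp_outside)

lemma filt_antimono: "i \<le> j \<Longrightarrow> filt j \<subseteq> filt i"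
  by (auto simp: filt_def)

lemma linear_br: "linear (\<lambda>y. bracket G x y)" "linear (\<lambda>x. bracket G x y)"
  using bracket_bilinear by (auto simp: bilinear_def)

lemma br_filt:
  assumes x: "x \<in> filt a" and y: "y \<in> filt b"
  shows "bracket G x y \<in> filt (a + b)"
proof -
  have "bracket G x y = (\<Sum>i = 1..step G. bracket G (lcomp x i) y)"
    by (subst comp_decomposition(2)[of x]) (rule linear_sum[OF linear_br(2)])
  also have "\<dots> = (\<Sum>i = 1..step G. \<Sum>k = 1..step G. bracket G (lcomp x i) (lcomp y k))"
    by (rule sum.cong[OF refl], subst comp_decomposition(2)[of y]) (rule linear_sum[OF linear_br(1)])
  also have "\<dots> \<in> filt (a + b)"
  proof (intro subspace_sum subspace_filt)
    fix i k
    show "bracket G (lcomp x i) (lcomp y k) \<in> filt (a + b)"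
    proof (cases "i < a \<or> k < b")
      case True
      then have "bracket G (lcomp x i) (lcomp y k) = 0"
        using x y linear_0[OF linear_br(1)] linear_0[OF linear_br(2)] by (auto simp: filt_def)
      then show ?thesis by (simp add: subspace_0 subspace_filt)
    next
      case False
      have "bracket G (lcomp x i) (lcomp y k) \<in> layer G (i + k)"
        by (intro bracket_graded comp_decomposition)
      then show ?thesis using False by (auto simp: filt_def comp_layer)
    qed
  qed
  finally show ?thesis .
qed

section \<open>Nested brackets and the Baker-Campbell-Hausdorff law\<close>

abbreviation nested :: "'a list \<Rightarrow> 'a" where "nested \<equiv> nested_bracket (bracket G)"

lemma nb_Cons: "zs \<noteq> [] \<Longrightarrow> nested (z # zs) = bracket G z (nested zs)"
  by (cases zs) auto

text \<open>The difference telescopes, one letter at a time. Every letter lies in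
  \<open>filt 1\<close>, so a bracket with a further letter raises the degree of a difference by at
  least one; a word of length 1 contains no bracket and gains nothing.\<close>

lemma nb_diff_filt:
  assumes "length zs = length ws" "zs \<noteq> []" "1 \<le> j"
    "\<And>k. k < length zs \<Longrightarrow> zs ! k - ws ! k \<in> filt j"
  shows "nested zs - nested ws \<in> filt j \<and> (2 \<le> length zs \<longrightarrow> nested zs - nested ws \<in> filt (Suc j))"
  using assms
proof (induction zs ws rule: list_induct2)
  case (Cons z zs w ws)
  show ?case
  proof (cases "zs = []")
    case True
    then show ?thesis using Cons by auto
  next
    case False
    then have ws: "ws \<noteq> []" using Cons.hyps by auto
    have IH: "nested zs - nested ws \<in> filt j"
      using Cons.IH[OF False Cons.prems(2)] Cons.prems(3)[of "Suc k" for k] by auto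
    have z: "z - w \<in> filt j" using Cons.prems(3)[of 0] by simp
    have "nested (z # zs) - nested (w # ws) = bracket G (z - w) (nested zs) + bracket G w (nested zs - nested ws)"
      using False ws by (simp add: nb_Cons linear_diff[OF linear_br(1)] linear_diff[OF linear_br(2)])
    moreover have "bracket G (z - w) (nested zs) \<in> filt (j + 1)" using z by (rule br_filt) simp
    moreover have "bracket G w (nested zs - nested ws) \<in> filt (1 + j)" by (rule br_filt) (use IH in simp_all)
    ultimately have "nested (z # zs) - nested (w # ws) \<in> filt (Suc j)"
      by (simp add: subspace_add[OF subspace_filt])
    then show ?thesis using filt_antimono[of j "Suc j"] by auto
  qed
qed simp

lemma nb_multiples:
  assumes "zs \<noteq> []" "set zs \<subseteq> range (\<lambda>r. r *\<^sub>R v)"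
  shows "nested zs \<in> range (\<lambda>r. r *\<^sub>R v) \<and> (2 \<le> length zs \<longrightarrow> nested zs = 0)"
  using assms
proof (induction zs)
  case (Cons z zs)
  show ?case
  proof (cases "zs = []")
    case False
    then obtain r s where "z = r *\<^sub>R v" "nested zs = s *\<^sub>R v" using Cons by auto
    then have "nested (z # zs) = 0"
      using False bracket_alternating[of v]
      by (simp add: nb_Cons linear_scale[OF linear_br(1)] linear_scale[OF linear_br(2)])
    then show ?thesis by (auto intro: image_eqI[of _ _ 0])
  qed (use Cons in simp)
qed simp

text \<open>The word is formed in the letters \<open>True\<close> and \<open>False\<close> first, so
  that words for different arguments have equal length and can be compared letter by letter.\<close>

definition bch_word :: "'a \<Rightarrow> 'a \<Rightarrow> (nat \<times> nat) list \<Rightarrow> 'a list" where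
  "bch_word x y rs = map (\<lambda>b. if b then x else y) (dynkin_word True False rs)"

definition bch_coeff :: "nat \<Rightarrow> (nat \<times> nat) list \<Rightarrow> real" where
  "bch_coeff k rs = (-1) ^ (k - 1) / (real k * real (\<Sum>(r, s)\<leftarrow>rs. r + s) * (\<Prod>(r, s)\<leftarrow>rs. fact r * fact s))"

definition bch_higher :: "'a \<Rightarrow> 'a \<Rightarrow> 'a" where
  "bch_higher x y = (\<Sum>k = 1..step G. \<Sum>rs\<in>{rs \<in> dynkin_indices (step G) k. 2 \<le> length (dynkin_word True False rs)}.
     bch_coeff k rs *\<^sub>R nested (bch_word x y rs))"

lemma dynkin_word_bch_word: "dynkin_word x y rs = bch_word x y rs"
  by (induction rs) (auto simp: bch_word_def dynkin_word_def)

lemma length_dynkin_word: "length (dynkin_word x y rs) = (\<Sum>(r, s)\<leftarrow>rs. r + s)"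
  by (induction rs) (auto simp: dynkin_word_def)

lemma finite_dynkin_indices: "finite (dynkin_indices N k)"
proof (rule finite_subset)
  show "dynkin_indices N k \<subseteq> {rs. set rs \<subseteq> {..N} \<times> {..N} \<and> length rs = k}"
  proof
    fix rs assume rs: "rs \<in> dynkin_indices N k"
    have "r + s \<le> N" if "(r, s) \<in> set rs" for r s
    proof -
      have "r + s \<le> (\<Sum>(r, s)\<leftarrow>rs. r + s)"
        by (rule member_le_sum_list) (use that in \<open>force simp: image_iff\<close>, simp)
      then show ?thesis using rs by (simp add: dynkin_indices_def)
    qed
    then show "rs \<in> {rs. set rs \<subseteq> {..N} \<times> {..N} \<and> length rs = k}"
      using rs by (fastforce simp: dynkin_indices_def)
  qed
qed (simp add: finite_lists_length_eq)

lemma dynkin_index_length: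
  assumes "rs \<in> dynkin_indices N k"
  shows "k \<le> (\<Sum>(r, s)\<leftarrow>rs. r + s)"
proof -
  have "\<forall>(r, s)\<in>set rs. 0 < r + s \<Longrightarrow> length rs \<le> (\<Sum>(r, s)\<leftarrow>rs. r + s)"
    by (induction rs) auto
  then show ?thesis using assms by (auto simp: dynkin_indices_def)
qed

text \<open>Each of the k blocks of a Dynkin word is nonempty, so words of length 1 occur only for k
  = 1. These are \<open>[(1, 0)]\<close> and \<open>[(0, 1)]\<close>, with coefficient 1, and give
  \<open>x + y\<close>.\<close>

lemma mult_eq: "x \<otimes> y = x + y + bch_higher x y"
proof -
  define t where "t k rs = bch_coeff k rs *\<^sub>R nested (bch_word x y rs)" for k rs
  let ?len = "\<lambda>rs. length (dynkin_word True False rs)"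
  define L where "L k = {rs \<in> dynkin_indices (step G) k. \<not> 2 \<le> ?len rs}" for k
  have "x \<otimes> y = (\<Sum>k = 1..step G. \<Sum>rs\<in>dynkin_indices (step G) k. t k rs)"
    by (simp add: mult_bch bch_def t_def bch_coeff_def dynkin_word_bch_word)
  also have "\<dots> = (\<Sum>k = 1..step G. (\<Sum>rs\<in>{rs \<in> dynkin_indices (step G) k. 2 \<le> ?len rs}. t k rs) + (\<Sum>rs\<in>L k. t k rs))"
  proof (rule sum.cong[OF refl])
    fix k
    have "dynkin_indices (step G) k = {rs \<in> dynkin_indices (step G) k. 2 \<le> ?len rs} \<union> L k" by (auto simp: L_def)
    then show "(\<Sum>rs\<in>dynkin_indices (step G) k. t k rs)
      = (\<Sum>rs\<in>{rs \<in> dynkin_indices (step G) k. 2 \<le> ?len rs}. t k rs) + (\<Sum>rs\<in>L k. t k rs)"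
      by (subst sum.union_disjoint[symmetric]) (auto simp: L_def finite_dynkin_indices)
  qed
  also have "\<dots> = bch_higher x y + (\<Sum>k = 1..step G. \<Sum>rs\<in>L k. t k rs)"
    by (simp add: sum.distrib bch_higher_def t_def)
  also have "(\<Sum>k = 1..step G. \<Sum>rs\<in>L k. t k rs) = (\<Sum>k\<in>{1}. \<Sum>rs\<in>L k. t k rs)"
  proof (rule sum.mono_neutral_right)
    show "\<forall>k\<in>{1..step G} - {1}. (\<Sum>rs\<in>L k. t k rs) = 0"
    proof
      fix k assume k: "k \<in> {1..step G} - {1}"
      have "L k = {}" using k dynkin_index_length[of _ "step G" k]
        by (fastforce simp: L_def length_dynkin_word)
      then show "(\<Sum>rs\<in>L k. t k rs) = 0" by simp
    qed
  qed (use step_pos in auto)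
  also have "\<dots> = (\<Sum>rs\<in>{[(1, 0)], [(0, 1)]}. t 1 rs)"
  proof -
    have "L 1 = {[(1, 0)], [(0, 1)]}"
    proof (intro equalityI subsetI)
      fix rs assume "rs \<in> L 1"
      then obtain r s where "rs = [(r, s)]" "0 < r + s" "r + s < 2"
        by (auto simp: L_def dynkin_indices_def length_dynkin_word length_Suc_conv)
      then show "rs \<in> {[(1, 0)], [(0, 1)]}" by (cases r; cases s) auto
    qed (use step_pos in \<open>auto simp: L_def dynkin_indices_def length_dynkin_word\<close>)
    then show ?thesis by simp
  qed
  also have "\<dots> = x + y" by (simp add: t_def bch_coeff_def bch_word_def dynkin_word_def)
  finally show ?thesis by simp
qed

lemma higher_multiples: "bch_higher (a *\<^sub>R v) (b *\<^sub>R v) = 0"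
proof -
  have "nested (bch_word (a *\<^sub>R v) (b *\<^sub>R v) rs) = 0" if "2 \<le> length (dynkin_word True False rs)" for rs
  proof -
    have "2 \<le> length (bch_word (a *\<^sub>R v) (b *\<^sub>R v) rs)" using that by (simp add: bch_word_def)
    moreover have "set (bch_word (a *\<^sub>R v) (b *\<^sub>R v) rs) \<subseteq> range (\<lambda>r. r *\<^sub>R v)" by (auto simp: bch_word_def)
    moreover have "bch_word (a *\<^sub>R v) (b *\<^sub>R v) rs \<noteq> []" using that by (auto simp: bch_word_def)
    ultimately show ?thesis using nb_multiples by blast
  qed
  then show ?thesis by (simp add: bch_higher_def)
qed

text \<open>Lines through 0 are one-parameter subgroups, because all brackets of multiples of one
  vector vanish. The neutral element 0 and the inverse \<open>- x\<close> are read off from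
  this.\<close>

lemma mult_multiples: "(a *\<^sub>R v) \<otimes> (b *\<^sub>R v) = (a + b) *\<^sub>R v"
  by (simp add: mult_eq higher_multiples algebra_simps)

lemma zero_mult [simp]: "0 \<otimes> x = x" and mult_zero [simp]: "x \<otimes> 0 = x"
  using mult_multiples[of 0 x 1] mult_multiples[of 1 x 0] by simp_all

lemma mult_minus [simp]: "x \<otimes> (- x) = 0" and minus_mult [simp]: "(- x) \<otimes> x = 0"
  using mult_multiples[of 1 x "-1"] mult_multiples[of "-1" x 1] by simp_all

lemma mult_assoc: "(x \<otimes> y) \<otimes> z = x \<otimes> (y \<otimes> z)"
  by (rule m_assoc) (simp_all add: carrier_UNIV)

lemma minus_mult_cancel [simp]: "(- x) \<otimes> (x \<otimes> y) = y" and mult_minus_cancel [simp]: "x \<otimes> ((- x) \<otimes> y) = y"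
  by (simp_all add: mult_assoc[symmetric])

text \<open>Triangularity of the group law: a change of \<open>x\<close> in degrees at least
  \<open>j\<close> reaches the bracket terms only in degrees above \<open>j\<close>, since these
  words have length at least 2.\<close>

lemma higher_diff_filt:
  assumes "1 \<le> j" "x - x' \<in> filt j"
  shows "bch_higher x y - bch_higher x' y \<in> filt (Suc j)"
proof -
  have "bch_higher x y - bch_higher x' y
    = (\<Sum>k = 1..step G. \<Sum>rs\<in>{rs \<in> dynkin_indices (step G) k. 2 \<le> length (dynkin_word True False rs)}.
     bch_coeff k rs *\<^sub>R (nested (bch_word x y rs) - nested (bch_word x' y rs)))"
    by (simp add: bch_higher_def sum_subtractf scaleR_right_diff_distrib)
  also have "\<dots> \<in> filt (Suc j)"
  proof (intro subspace_sum subspace_scale subspace_filt)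
    fix k rs assume "rs \<in> {rs \<in> dynkin_indices (step G) k. 2 \<le> length (dynkin_word True False rs)}"
    then have "2 \<le> length (bch_word x y rs)" by (simp add: bch_word_def)
    then have "bch_word x y rs \<noteq> []" by auto
    have "bch_word x y rs ! l - bch_word x' y rs ! l \<in> filt j" if "l < length (bch_word x y rs)" for l
      using that assms(2) by (auto simp: bch_word_def subspace_0[OF subspace_filt])
    then show "nested (bch_word x y rs) - nested (bch_word x' y rs) \<in> filt (Suc j)"
      using nb_diff_filt[of "bch_word x y rs" "bch_word x' y rs" j] \<open>2 \<le> length (bch_word x y rs)\<close> \<open>bch_word x y rs \<noteq> []\<close> assms(1)
      by (simp add: bch_word_def)
  qed
  finally show ?thesis .
qed

section \<open>Dilations are automorphisms of the bracket and of the group law\<close>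

lemma comp_dilation: "lcomp (dilation G r x) j = r ^ j *\<^sub>R lcomp x j"
proof -
  have "lcomp (dilation G r x) = (\<lambda>j. r ^ j *\<^sub>R lcomp x j)"
    by (rule comp_eqI) (simp_all add: dilation_def subspace_scale layer_subspace comp_decomposition)
  then show ?thesis by simp
qed

lemma linear_dilation: "linear (dilation G r)"
  by (rule linearI; subst comp_eq_iff) (simp_all add: comp_dilation comp_add comp_scale algebra_simps)

lemma dilation_layer1: "x \<in> layer G 1 \<Longrightarrow> dilation G r x = r *\<^sub>R x"
  by (subst comp_eq_iff) (simp add: comp_dilation comp_scale comp_layer)

lemma dilation_layer: "x \<in> layer G i \<Longrightarrow> dilation G r x = r ^ i *\<^sub>R x"
  by (subst comp_eq_iff) (simp add: comp_dilation comp_scale comp_layer)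

lemma dilation_br: "dilation G r (bracket G x y) = bracket G (dilation G r x) (dilation G r y)"
proof -
  have expand: "bracket G u w = (\<Sum>i = 1..step G. \<Sum>k = 1..step G. bracket G (lcomp u i) (lcomp w k))" for u w
  proof -
    have "bracket G u w = (\<Sum>i = 1..step G. bracket G (lcomp u i) w)"
      by (subst comp_decomposition(2)[of u]) (rule linear_sum[OF linear_br(2)])
    also have "\<dots> = (\<Sum>i = 1..step G. \<Sum>k = 1..step G. bracket G (lcomp u i) (lcomp w k))"
      by (rule sum.cong[OF refl], subst comp_decomposition(2)[of w]) (rule linear_sum[OF linear_br(1)])
    finally show ?thesis .
  qed
  have "dilation G r (bracket G x y)
    = (\<Sum>i = 1..step G. \<Sum>k = 1..step G. dilation G r (bracket G (lcomp x i) (lcomp y k)))"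
    by (subst expand) (simp add: linear_sum[OF linear_dilation])
  also have "\<dots> = (\<Sum>i = 1..step G. \<Sum>k = 1..step G. bracket G (lcomp (dilation G r x) i) (lcomp (dilation G r y) k))"
  proof (intro sum.cong refl)
    fix i k
    have "dilation G r (bracket G (lcomp x i) (lcomp y k)) = r ^ (i + k) *\<^sub>R bracket G (lcomp x i) (lcomp y k)"
      by (intro dilation_layer bracket_graded comp_decomposition)
    then show "dilation G r (bracket G (lcomp x i) (lcomp y k)) = bracket G (lcomp (dilation G r x) i) (lcomp (dilation G r y) k)"
      by (simp add: comp_dilation linear_scale[OF linear_br(1)] linear_scale[OF linear_br(2)] power_add mult.commute)
  qed
  finally show ?thesis by (simp only: expand[of "dilation G r x"])
qed

lemma dilation_nb: "dilation G r (nested zs) = nested (map (dilation G r) zs)"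
proof (induction zs)
  case (Cons z zs)
  then show ?case by (cases "zs = []") (simp_all add: nb_Cons dilation_br)
qed (simp add: linear_0[OF linear_dilation])

lemma dilation_mult: "dilation G r (x \<otimes> y) = dilation G r x \<otimes> dilation G r y"
proof -
  have "map (dilation G r) (bch_word x y rs) = bch_word (dilation G r x) (dilation G r y) rs" for rs
    by (simp add: bch_word_def comp_def if_distrib)
  then show ?thesis
    by (simp add: mult_eq bch_higher_def linear_add[OF linear_dilation] linear_sum[OF linear_dilation]
        linear_scale[OF linear_dilation] dilation_nb)
qed

end

section \<open>Translations and homogeneous distances\<close>

text \<open>The derivative is required to be continuous jointly in point and direction, not in
  operator norm. This form passes directly to sums and bilinear products, and it is the one in which
  differentials of translations are used along curves.\<close>

definition C1_map :: "('b::real_normed_vector \<Rightarrow> 'c::real_normed_vector) \<Rightarrow> bool" where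
  "C1_map f \<longleftrightarrow> (\<exists>D. (\<forall>z. (f has_derivative D z) (at z)) \<and> continuous_on UNIV (\<lambda>p. D (fst p) (snd p)))"

lemma C1_map_linear:
  assumes "bounded_linear f"
  shows "C1_map f"
  unfolding C1_map_def
proof (intro exI[of _ "\<lambda>_. f"] conjI allI)
  show "(f has_derivative f) (at z)" for z by (rule bounded_linear_imp_has_derivative[OF assms])
  show "continuous_on UNIV (\<lambda>p. f (snd p))"
    by (intro bounded_linear.continuous_on[OF assms] continuous_intros)
qed

lemma C1_map_const: "C1_map (\<lambda>_. c)"
  unfolding C1_map_def by (intro exI[of _ "\<lambda>_ _. 0"]) auto

lemma C1_map_add:
  assumes "C1_map f" "C1_map g"
  shows "C1_map (\<lambda>z. f z + g z)"
proof -
  obtain D E where "\<And>z. (f has_derivative D z) (at z)" "continuous_on UNIV (\<lambda>p. D (fst p) (snd p))"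
    "\<And>z. (g has_derivative E z) (at z)" "continuous_on UNIV (\<lambda>p. E (fst p) (snd p))"
    using assms unfolding C1_map_def by blast
  then show ?thesis unfolding C1_map_def
    by (intro exI[of _ "\<lambda>z h. D z h + E z h"] conjI allI has_derivative_add continuous_on_add) auto
qed

lemma C1_map_sum: "finite A \<Longrightarrow> (\<And>a. a \<in> A \<Longrightarrow> C1_map (f a)) \<Longrightarrow> C1_map (\<lambda>z. \<Sum>a\<in>A. f a z)"
proof (induction A rule: finite_induct)
  case empty
  show ?case by (simp add: C1_map_const)
next
  case (insert a A)
  then show ?case using C1_map_add[of "f a" "\<lambda>z. \<Sum>a\<in>A. f a z"] by simp
qed

lemma C1_map_bilinear:
  assumes b: "bounded_bilinear b" and "C1_map f" "C1_map g"
  shows "C1_map (\<lambda>z. b (f z) (g z))"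
proof -
  obtain D E where D: "\<And>z. (f has_derivative D z) (at z)" "continuous_on UNIV (\<lambda>p. D (fst p) (snd p))"
    and E: "\<And>z. (g has_derivative E z) (at z)" "continuous_on UNIV (\<lambda>p. E (fst p) (snd p))"
    using assms unfolding C1_map_def by blast
  have f: "continuous_on UNIV f" and g: "continuous_on UNIV g"
    by (rule has_derivative_continuous_on, rule has_derivative_at_withinI, rule D(1))
      (rule has_derivative_continuous_on, rule has_derivative_at_withinI, rule E(1))
  have f': "continuous_on UNIV (\<lambda>p. f (fst p))" and g': "continuous_on UNIV (\<lambda>p. g (fst p))"
    by (rule continuous_on_compose2[OF f]; auto intro: continuous_intros)
       (rule continuous_on_compose2[OF g]; auto intro: continuous_intros)
  show ?thesis unfolding C1_map_def
  proof (intro exI[of _ "\<lambda>z h. b (f z) (E z h) + b (D z h) (g z)"] conjI allI)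
    show "((\<lambda>z. b (f z) (g z)) has_derivative (\<lambda>h. b (f z) (E z h) + b (D z h) (g z))) (at z)" for z
      by (rule bounded_bilinear.FDERIV[OF b D(1) E(1)])
    show "continuous_on UNIV (\<lambda>p. b (f (fst p)) (E (fst p) (snd p)) + b (D (fst p) (snd p)) (g (fst p)))"
      by (intro continuous_on_add bounded_bilinear.continuous_on[OF b] f' g' D(2) E(2))
  qed
qed

section \<open>Left translations, their differentials and left invariant fields\<close>

context homogeneous_group
begin

lemma bounded_bilinear_br: "bounded_bilinear (bracket G)"
  using bracket_bilinear by (simp add: bilinear_conv_bounded_bilinear)

lemma C1_map_nb: "C1_map (\<lambda>z :: 'a \<times> 'a. nested (map (\<lambda>b. if b then fst z else snd z) ws))"
proof (induction ws)
  case Nil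
  show ?case by (simp add: C1_map_const)
next
  case (Cons b ws)
  have b: "C1_map (\<lambda>z :: 'a \<times> 'a. if b then fst z else snd z)"
    by (cases b) (simp_all add: C1_map_linear bounded_linear_fst bounded_linear_snd)
  show ?case
  proof (cases "ws = []")
    case True
    then show ?thesis using b by simp
  next
    case False
    then show ?thesis using C1_map_bilinear[OF bounded_bilinear_br b Cons.IH] by (simp add: nb_Cons)
  qed
qed

lemma C1_map_mult: "C1_map (\<lambda>z. fst z \<otimes> snd z)"
proof -
  have scale: "C1_map (\<lambda>z. c *\<^sub>R f z)" if "C1_map f" for c :: real and f :: "'a \<times> 'a \<Rightarrow> 'a"
    using C1_map_bilinear[OF bounded_bilinear_scaleR C1_map_const that] .
  show ?thesis
    unfolding mult_eq bch_higher_def bch_word_def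
    by (intro C1_map_add C1_map_sum scale C1_map_nb C1_map_linear[OF bounded_linear_fst] C1_map_linear[OF bounded_linear_snd])
      (auto simp: finite_dynkin_indices)
qed

definition lderiv :: "'a \<Rightarrow> 'a \<Rightarrow> 'a \<Rightarrow> 'a" where
  "lderiv p x = frechet_derivative (\<lambda>y. p \<otimes> y) (at x)"

lemma lderiv_joint:
  "((\<lambda>y. p \<otimes> y) has_derivative lderiv p x) (at x)"
  "continuous_on UNIV (\<lambda>z. lderiv (fst z) (fst (snd z)) (snd (snd z)))"
  "continuous_on UNIV (\<lambda>z. fst z \<otimes> snd z)"
proof -
  obtain D where D: "\<And>z. ((\<lambda>z. fst z \<otimes> snd z) has_derivative D z) (at z)"
    "continuous_on UNIV (\<lambda>p. D (fst p) (snd p))"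
    using C1_map_mult unfolding C1_map_def by blast
  have der: "((\<lambda>y. p \<otimes> y) has_derivative (\<lambda>v. D (p, x) (0, v))) (at x)" for p x
  proof -
    have "((\<lambda>y. (p, y)) has_derivative (\<lambda>v. (0, v))) (at x)"
      by (intro has_derivative_Pair has_derivative_const has_derivative_ident)
    from has_derivative_compose[OF this D(1)] show ?thesis by simp
  qed
  have eq: "lderiv p x = (\<lambda>v. D (p, x) (0, v))" for p x
    unfolding lderiv_def by (rule frechet_derivative_at[OF der, symmetric])
  show "((\<lambda>y. p \<otimes> y) has_derivative lderiv p x) (at x)" unfolding eq by (rule der)
  show "continuous_on UNIV (\<lambda>z. lderiv (fst z) (fst (snd z)) (snd (snd z)))"
    unfolding eq
    by (rule continuous_on_compose2[OF D(2), where f = "\<lambda>z. ((fst z, fst (snd z)), (0, snd (snd z)))", simplified])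
       (intro continuous_intros)
  show "continuous_on UNIV (\<lambda>z. fst z \<otimes> snd z)"
    by (rule has_derivative_continuous_on, rule has_derivative_at_withinI, rule D(1))
qed

lemma linear_lderiv: "linear (lderiv p x)"
  by (rule bounded_linear.linear[OF has_derivative_bounded_linear[OF lderiv_joint(1)]])

lemma continuous_on_lderiv [continuous_intros]:
  assumes "continuous_on A f" "continuous_on A g" "continuous_on A h"
  shows "continuous_on A (\<lambda>t. lderiv (f t) (g t) (h t))"
  by (rule continuous_on_compose2[OF lderiv_joint(2), where f = "\<lambda>t. (f t, g t, h t)", simplified])
     (intro continuous_intros assms)

lemma continuous_on_mult [continuous_intros]:
  assumes "continuous_on A f" "continuous_on A g"
  shows "continuous_on A (\<lambda>t. f t \<otimes> g t)"
  by (rule continuous_on_compose2[OF lderiv_joint(3), where f = "\<lambda>t. (f t, g t)", simplified])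
     (intro continuous_intros assms)

lemma lderiv_mult: "lderiv (p \<otimes> q) x v = lderiv p (q \<otimes> x) (lderiv q x v)"
proof -
  have "((\<lambda>y. p \<otimes> (q \<otimes> y)) has_derivative (\<lambda>v. lderiv p (q \<otimes> x) (lderiv q x v))) (at x)"
    by (rule has_derivative_compose[OF lderiv_joint(1) lderiv_joint(1)])
  then have "((\<lambda>y. (p \<otimes> q) \<otimes> y) has_derivative (\<lambda>v. lderiv p (q \<otimes> x) (lderiv q x v))) (at x)"
    by (simp add: mult_assoc)
  then show ?thesis using has_derivative_unique[OF _ lderiv_joint(1)] by metis
qed

lemma lderiv_zero [simp]: "lderiv 0 x v = v"
proof -
  have "((\<lambda>y. 0 \<otimes> y) has_derivative (\<lambda>v. v)) (at x)" by simp
  then show ?thesis using has_derivative_unique[OF _ lderiv_joint(1)] by metis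
qed

lemma lderiv_inverse [simp]: "lderiv (- p) p (lderiv p 0 v) = v" "lderiv p 0 (lderiv (- p) p v) = v"
  using lderiv_mult[of "- p" p 0 v, symmetric] lderiv_mult[of p "- p" p v, symmetric]
  by (simp_all only: minus_mult mult_minus mult_zero lderiv_zero)

text \<open>A left invariant field is the left translate of its value at 0, which identifies the
  fields with vectors and makes \<open>basis_field\<close> well defined.\<close>

lemma left_invariant_fields_iff:
  "X \<in> left_invariant_fields G \<longleftrightarrow> X = (\<lambda>p. lderiv p 0 (X 0))"
proof
  assume "X \<in> left_invariant_fields G"
  then have X: "X (p \<otimes> x) = lderiv p x (X x)" for p x
    by (simp add: left_invariant_fields_def lderiv_def)
  show "X = (\<lambda>p. lderiv p 0 (X 0))"
  proof
    show "X p = lderiv p 0 (X 0)" for p using X[of p 0] by (simp only: mult_zero)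
  qed
next
  assume X: "X = (\<lambda>p. lderiv p 0 (X 0))"
  have "X (p \<otimes> x) = lderiv p x (X x)" for p x
  proof -
    have "X (p \<otimes> x) = lderiv (p \<otimes> x) 0 (X 0)" by (subst X) simp
    also have "\<dots> = lderiv p x (lderiv x 0 (X 0))" by (simp add: lderiv_mult)
    also have "lderiv x 0 (X 0) = X x" by (subst (2) X) simp
    finally show ?thesis .
  qed
  then show "X \<in> left_invariant_fields G" by (simp add: left_invariant_fields_def lderiv_def)
qed

lemma left_invariant_field_of_vector: "(\<lambda>p. lderiv p 0 v) \<in> left_invariant_fields G"
  by (subst left_invariant_fields_iff) simp

lemma basis_field_eq: "basis_field G e i = (\<lambda>p. lderiv p 0 (e i))"
  unfolding basis_field_def
proof (rule the_equality)
  show "(\<lambda>p. lderiv p 0 (e i)) \<in> left_invariant_fields G \<and> lderiv 0 0 (e i) = e i"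
    by (simp add: left_invariant_field_of_vector)
  show "X = (\<lambda>p. lderiv p 0 (e i))" if "X \<in> left_invariant_fields G \<and> X 0 = e i" for X
  proof -
    have "X = (\<lambda>p. lderiv p 0 (X 0))" using that left_invariant_fields_iff by blast
    also have "X 0 = e i" using that by blast
    finally show ?thesis .
  qed
qed

lemma bounded_linear_lcomp: "bounded_linear (\<lambda>x. lcomp x j)"
  by (simp add: linear_conv_bounded_linear[symmetric] linear_comp)

text \<open>In degrees up to \<open>j\<close> the difference of the two translates of y does not
  depend on y: its component is that of \<open>x - x'\<close>, by the triangularity of the group
  law. Its derivative therefore vanishes there.\<close>

lemma lderiv_diff_filt:
  assumes j: "1 \<le> j" and x: "x - x' \<in> filt j"
  shows "lderiv x 0 v - lderiv x' 0 v \<in> filt (Suc j)"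
  unfolding filt_def
proof (intro CollectI allI impI)
  fix i assume i: "i < Suc j"
  have const: "lcomp ((x \<otimes> y) - (x' \<otimes> y)) i = lcomp (x - x') i" for y
  proof -
    have "bch_higher x y - bch_higher x' y \<in> filt (Suc j)" by (rule higher_diff_filt[OF j x])
    then have "lcomp (bch_higher x y - bch_higher x' y) i = 0" using i by (simp add: filt_def)
    then show ?thesis by (simp add: mult_eq comp_add comp_diff)
  qed
  have "((\<lambda>y. lcomp ((x \<otimes> y) - (x' \<otimes> y)) i) has_derivative (\<lambda>v. lcomp (lderiv x 0 v - lderiv x' 0 v) i)) (at 0)"
    by (intro bounded_linear.has_derivative[OF bounded_linear_lcomp] has_derivative_diff lderiv_joint)
  then have "((\<lambda>y. lcomp (x - x') i) has_derivative (\<lambda>v. lcomp (lderiv x 0 v - lderiv x' 0 v) i)) (at (0::'a))"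
    by (simp only: const)
  then have "(\<lambda>v. lcomp (lderiv x 0 v - lderiv x' 0 v) i) = (\<lambda>v. 0)"
    using has_derivative_unique[OF _ has_derivative_const] by blast
  then show "lcomp (lderiv x 0 v - lderiv x' 0 v) i = 0" by metis
qed

text \<open>The line through \<open>v\<close> is an integral curve of the left invariant field of
  \<open>v\<close>. It serves as the reference curve for a constant control.\<close>

lemma lderiv_multiple: "lderiv (t *\<^sub>R v) 0 v = v"
proof -
  have "((\<lambda>s::real. s *\<^sub>R v) has_derivative (\<lambda>h. h *\<^sub>R v)) (at 0)"
    by (auto intro!: derivative_eq_intros)
  from has_derivative_compose[OF this, of "\<lambda>y. (t *\<^sub>R v) \<otimes> y" "lderiv (t *\<^sub>R v) 0"] lderiv_joint(1)[of "t *\<^sub>R v" 0]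
  have "((\<lambda>s. (t *\<^sub>R v) \<otimes> (s *\<^sub>R v)) has_derivative (\<lambda>h. lderiv (t *\<^sub>R v) 0 (h *\<^sub>R v))) (at 0)" by simp
  moreover have "((\<lambda>s. (t *\<^sub>R v) \<otimes> (s *\<^sub>R v)) has_derivative (\<lambda>h. h *\<^sub>R v)) (at 0)"
    unfolding mult_multiples by (auto intro!: derivative_eq_intros)
  ultimately have "(\<lambda>h. lderiv (t *\<^sub>R v) 0 (h *\<^sub>R v)) = (\<lambda>h. h *\<^sub>R v)" by (rule has_derivative_unique)
  from fun_cong[OF this, of 1] show ?thesis by simp
qed

lemma lderiv_dilation: "lderiv (dilation G r p) 0 (dilation G r v) = dilation G r (lderiv p 0 v)"
proof -
  have bl: "bounded_linear (dilation G r)" using linear_dilation by (simp add: linear_conv_bounded_linear)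
  have z: "dilation G r 0 = 0" by (rule linear_0[OF linear_dilation])
  have "((\<lambda>y. dilation G r (p \<otimes> y)) has_derivative (\<lambda>v. dilation G r (lderiv p 0 v))) (at 0)"
    by (rule bounded_linear.has_derivative[OF bl lderiv_joint(1)])
  moreover have "((\<lambda>y. dilation G r p \<otimes> dilation G r y) has_derivative (\<lambda>v. lderiv (dilation G r p) 0 (dilation G r v))) (at 0)"
    using has_derivative_compose[OF bounded_linear_imp_has_derivative[OF bl], of "\<lambda>y. dilation G r p \<otimes> y" "lderiv (dilation G r p) 0" 0 UNIV]
      lderiv_joint(1)[of "dilation G r p" 0] z by simp
  ultimately show ?thesis unfolding dilation_mult using has_derivative_unique by metis
qed

lemma mult_has_vector_derivative:
  assumes "(\<gamma> has_vector_derivative v) (at t)"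
  shows "((\<lambda>t. p \<otimes> \<gamma> t) has_vector_derivative lderiv p (\<gamma> t) v) (at t)"
  using has_derivative_compose[OF assms[unfolded has_vector_derivative_def] lderiv_joint(1)[of p "\<gamma> t"]]
  by (simp add: has_vector_derivative_def linear_scale[OF linear_lderiv])


section \<open>Multiradial distances near the identity\<close>

context
  fixes d
  assumes md: "multiradial G d"
begin

lemma hom_dist: "Metric_space UNIV d" "d (z \<otimes> x) (z \<otimes> y) = d x y"
  "0 < r \<Longrightarrow> d (dilation G r x) (dilation G r y) = r * d x y"
  using md by (simp_all add: multiradial_def homogeneous_distance_def)

lemma dist_eq_norm: "d x y = d ((- x) \<otimes> y) 0"
proof -
  interpret Metric_space UNIV d by (rule hom_dist)
  have "d x y = d ((- x) \<otimes> x) ((- x) \<otimes> y)" by (simp only: hom_dist)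
  then show ?thesis by (simp add: commute)
qed

lemma dilation_norm: "0 < r \<Longrightarrow> d (dilation G r x) 0 = r * d x 0"
  using hom_dist(3)[of r x 0] by (simp add: linear_0[OF linear_dilation])

lemma continuous_on_hom_norm: "continuous_on UNIV (\<lambda>x. d x 0)"
proof -
  obtain \<phi> where \<phi>: "continuous_on (orthant (step G)) \<phi>" "\<And>x. d x 0 = \<phi> (\<lambda>j. norm (lcomp x j))"
    using md unfolding multiradial_def by blast
  have "continuous_on UNIV (\<lambda>x. \<phi> (\<lambda>j. norm (lcomp x j)))"
  proof (rule continuous_on_compose2[OF \<phi>(1)])
    show "continuous_on UNIV (\<lambda>x j. norm (lcomp x j))"
      by (intro continuous_on_coordinatewise_then_product continuous_on_norm
          bounded_linear.continuous_on[OF bounded_linear_lcomp] continuous_on_id)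
    show "range (\<lambda>x j. norm (lcomp x j)) \<subseteq> orthant (step G)"
      by (auto simp: orthant_def comp_outside)
  qed
  then show ?thesis by (simp add: \<phi>(2))
qed

lemma closed_hom_ball: "closed (Metric_space.mcball UNIV d x r)"
proof -
  interpret Metric_space UNIV d by (rule hom_dist)
  have "continuous_on UNIV (\<lambda>y. d ((- x) \<otimes> y) 0)"
    by (rule continuous_on_compose2[OF continuous_on_hom_norm]) (auto intro!: continuous_intros)
  then have "closed {y. d ((- x) \<otimes> y) 0 \<le> r}" by (intro closed_Collect_le continuous_intros)
  moreover have "mcball x r = {y. d ((- x) \<otimes> y) 0 \<le> r}" by (auto simp: mcball_def dist_eq_norm[symmetric])
  ultimately show ?thesis by simp
qed

text \<open>A vector \<open>v\<close> of the first layer and \<open>norm v *\<^sub>R u\<close>, with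
  \<open>u\<close> a fixed unit vector there, have the same component norms and hence the same
  distance to 0; on that layer the dilations are plain multiples. If the layer is trivial, any
  constant does.\<close>

lemma hom_norm_layer1: "\<exists>c>0. \<forall>v\<in>layer G 1. d v 0 = c * norm v"
proof (cases "layer G 1 = {0}")
  case True
  interpret Metric_space UNIV d by (rule hom_dist)
  show ?thesis using True by (intro exI[of _ 1]) simp
next
  case False
  interpret Metric_space UNIV d by (rule hom_dist)
  obtain \<phi> where \<phi>: "\<And>x. d x 0 = \<phi> (\<lambda>j. norm (lcomp x j))"
    using md unfolding multiradial_def by blast
  obtain w where w: "w \<in> layer G 1" "w \<noteq> 0" using False subspace_0[OF layer_subspace] by blast
  define u where "u = (1 / norm w) *\<^sub>R w"
  have u: "u \<in> layer G 1" "norm u = 1" using w by (auto simp: u_def intro: subspace_scale layer_subspace)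
  show ?thesis
  proof (intro exI[of _ "d u 0"] conjI ballI)
    have "u \<noteq> 0" using u by auto
    then show "0 < d u 0" using nonneg[of u 0] zero[of u 0] by (simp add: less_le)
    fix v assume v: "v \<in> layer G 1"
    show "d v 0 = d u 0 * norm v"
    proof (cases "v = 0")
      case False
      have "(\<lambda>j. norm (lcomp v j)) = (\<lambda>j. norm (lcomp (norm v *\<^sub>R u) j))"
        using u v by (auto simp: comp_layer comp_scale)
      then have "d v 0 = d (norm v *\<^sub>R u) 0" by (simp add: \<phi>)
      also have "\<dots> = d (dilation G (norm v) u) 0" by (simp only: dilation_layer1[OF u(1)])
      also have "\<dots> = norm v * d u 0" using False by (intro dilation_norm) simp
      finally show ?thesis by simp
    qed simp
  qed
qed

text \<open>The growth of \<phi> at infinity, read backwards: the unit ball of \<open>d\<close> is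
  bounded in every layer.\<close>

lemma hom_norm_coercive: "\<exists>K>0. \<forall>x j. d x 0 \<le> 1 \<longrightarrow> norm (lcomp x j) \<le> K"
proof -
  obtain \<phi> where \<phi>: "\<And>x. d x 0 = \<phi> (\<lambda>j. norm (lcomp x j))"
    "filterlim \<phi> at_top (inf (filtercomap (\<lambda>x. L2_set x {1..step G}) at_top) (principal (orthant (step G))))"
    using md unfolding multiradial_def by blast
  have "eventually (\<lambda>x. 1 < \<phi> x) (inf (filtercomap (\<lambda>x. L2_set x {1..step G}) at_top) (principal (orthant (step G))))"
    using \<phi>(2) by (rule filterlim_at_top_dense[THEN iffD1, rule_format])
  then have "eventually (\<lambda>x. x \<in> orthant (step G) \<longrightarrow> 1 < \<phi> x) (filtercomap (\<lambda>x. L2_set x {1..step G}) at_top)"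
    by (simp add: eventually_inf_principal)
  then obtain P where P: "eventually P (at_top :: real filter)"
    "\<And>x. P (L2_set x {1..step G}) \<Longrightarrow> x \<in> orthant (step G) \<Longrightarrow> 1 < \<phi> x"
    unfolding eventually_filtercomap by blast
  obtain K0 where K0: "\<And>t. K0 \<le> t \<Longrightarrow> P t" using P(1) unfolding eventually_at_top_linorder by blast
  have "norm (lcomp x j) \<le> max K0 1" if "d x 0 \<le> 1" for x j
  proof (cases "j \<in> {1..step G}")
    case True
    let ?n = "\<lambda>j. norm (lcomp x j)"
    have "?n \<in> orthant (step G)" by (auto simp: orthant_def comp_outside)
    then have "\<not> K0 \<le> L2_set ?n {1..step G}" using P(2)[OF K0] that \<phi>(1) by fastforce
    moreover have "?n j \<le> L2_set ?n {1..step G}" using True by (intro member_le_L2_set) auto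
    ultimately show ?thesis by simp
  qed (simp add: comp_outside)
  then show ?thesis by (intro exI[of _ "max K0 1"]) auto
qed

text \<open>A point close to 0 is dilated into the unit ball, whose components are bounded by K;
  dilating back multiplies the component of degree j by \<open>r ^ j \<le> r\<close>.\<close>

lemma hom_norm_small:
  assumes "0 < \<eta>"
  shows "\<exists>r>0. \<forall>x. d x 0 < r \<longrightarrow> norm x < \<eta>"
proof -
  interpret Metric_space UNIV d by (rule hom_dist)
  obtain K where K: "0 < K" "\<And>x j. d x 0 \<le> 1 \<Longrightarrow> norm (lcomp x j) \<le> K" using hom_norm_coercive by blast
  \<comment> \<open>The norm is at most the sum of \<open>step G\<close> components of size
    \<open>r * K\<close>, so this choice bounds it by \<open>\<eta> / 2\<close>.\<close>
  define r where "r = min 1 (\<eta> / (2 * real (step G) * K))"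
  have r: "0 < r" "r \<le> 1" using assms K step_pos by (auto simp: r_def)
  have "norm x < \<eta>" if x: "d x 0 < r" for x
  proof -
    let ?y = "dilation G (1 / r) x"
    have "d ?y 0 = 1 / r * d x 0" using r by (intro dilation_norm) simp
    also have "\<dots> \<le> 1" using x r by simp
    finally have "d ?y 0 \<le> 1" .
    then have y: "norm (lcomp ?y j) \<le> K" for j by (rule K(2))
    have c: "norm (lcomp x j) \<le> r * K" if "j \<in> {1..step G}" for j
    proof -
      have "lcomp x j = r ^ j *\<^sub>R lcomp ?y j" using r by (simp add: comp_dilation power_one_over)
      then have "norm (lcomp x j) = r ^ j * norm (lcomp ?y j)" using r by simp
      also have "\<dots> \<le> r ^ 1 * K" using r that y K by (intro mult_mono power_decreasing) auto
      finally show ?thesis by simp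
    qed
    have "norm x = norm (\<Sum>j = 1..step G. lcomp x j)" by (simp only: comp_decomposition(2)[symmetric])
    also have "\<dots> \<le> (\<Sum>j = 1..step G. r * K)" by (rule sum_norm_le) (rule c)
    also have "\<dots> = real (step G) * K * r" by simp
    also have "\<dots> \<le> real (step G) * K * (\<eta> / (2 * real (step G) * K))"
      using K step_pos by (intro mult_left_mono) (auto simp: r_def)
    also have "\<dots> = \<eta> / 2" using K step_pos by simp
    finally show ?thesis using assms by simp
  qed
  then show ?thesis using r by blast
qed

text \<open>Left translation carries the comparison at 0 to any point, so that a chart domain
  contains a \<open>d\<close>-ball around each of its points.\<close>

lemma hom_ball_subset_open:
  assumes "open U" "p \<in> U"
  shows "\<exists>r>0. \<forall>x. d p x < r \<longrightarrow> x \<in> U"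
proof -
  have "continuous_on UNIV (\<lambda>y. p \<otimes> y)" by (intro continuous_intros)
  with assms(1) have "open ((\<lambda>y. p \<otimes> y) -` U)" by (rule open_vimage)
  obtain \<eta> where \<eta>: "0 < \<eta>" "ball 0 \<eta> \<subseteq> (\<lambda>y. p \<otimes> y) -` U"
  proof -
    have "0 \<in> (\<lambda>y. p \<otimes> y) -` U" using assms(2) by simp
    then show ?thesis using \<open>open ((\<lambda>y. p \<otimes> y) -` U)\<close> that unfolding open_contains_ball by blast
  qed
  obtain r where r: "0 < r" "\<And>x. d x 0 < r \<Longrightarrow> norm x < \<eta>" using hom_norm_small[OF \<eta>(1)] by blast
  have "x \<in> U" if "d p x < r" for x
  proof -
    have "d ((- p) \<otimes> x) 0 < r" using that by (simp only: dist_eq_norm[of p x])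
    then have "norm ((- p) \<otimes> x) < \<eta>" by (rule r(2))
    then have "(- p) \<otimes> x \<in> ball 0 \<eta>" by simp
    then have "p \<otimes> ((- p) \<otimes> x) \<in> U" using \<eta>(2) by blast
    then show ?thesis by (simp only: mult_minus_cancel)
  qed
  then show ?thesis using r(1) by blast
qed

end

end

section \<open>Tangent vectors of horizontal submanifolds\<close>

text \<open>With \<open>ext_power_ident\<close>, this functoriality lets the n-vector at a point be
  translated back to 0 without inverting anything by hand.\<close>

lemma ext_power_compose:
  fixes e :: "nat \<Rightarrow> 'a::euclidean_space"
  assumes on: "orthonormal_seq e"
    and M': "linear M'"
  shows "ext_power e M' (ext_power e M b) = ext_power e (\<lambda>v. M' (M v)) b"
proof -
  have "ext_power e M b = (\<lambda>K. \<Sum>J\<in>Pow {1..DIM('a)}. b J * wedge_list e (map (\<lambda>i. M (e i)) (sorted_list_of_set J)) K)"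
    by (simp add: ext_power_def fun_eq_iff)
  then have "ext_power e M' (ext_power e M b)
    = (\<lambda>K. \<Sum>J\<in>Pow {1..DIM('a)}. b J * ext_power e M' (wedge_list e (map (\<lambda>i. M (e i)) (sorted_list_of_set J))) K)"
    by (simp add: ext_power_sum)
  then show ?thesis by (simp add: ext_power_wedge_list[OF on M'] ext_power_def fun_eq_iff comp_def)
qed

lemma ext_power_ident:
  fixes e :: "nat \<Rightarrow> 'a::euclidean_space"
  assumes on: "orthonormal_seq e"
    and b: "\<And>J. b J \<noteq> 0 \<Longrightarrow> J \<subseteq> {1..DIM('a)}"
  shows "ext_power e (\<lambda>v. v) b = b"
proof
  fix K
  let ?Q = "{1..DIM('a)}"
  have unit: "vec_coeffs e (e i) = (\<lambda>k. if k = i then 1 else 0)" if "i \<in> ?Q" for i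
    using on that by (auto simp: vec_coeffs_def fun_eq_iff)
  have "wedge_list e (map e (sorted_list_of_set J)) K = (if K = J then 1 else 0)" if J: "J \<subseteq> ?Q" for J
  proof -
    have fin: "finite J" using J finite_subset by blast
    have "map (\<lambda>i. vec_coeffs e (e i)) (sorted_list_of_set J) = map (\<lambda>i k. if k = i then 1 else 0) (sorted_list_of_set J)"
      by (rule map_cong) (use J fin unit in auto)
    then have "wedge_list e (map e (sorted_list_of_set J))
      = foldr ext_mult (map (\<lambda>i k. if k = i then 1 else 0) (sorted_list_of_set J)) mv_one"
      unfolding wedge_list_eq map_map comp_def by (simp only:)
    then show ?thesis using foldr_ext_mult_unit[of "sorted_list_of_set J" K] fin by simp
  qed
  then have "ext_power e (\<lambda>v. v) b K = (\<Sum>J\<in>Pow ?Q. if J = K then b K else 0)"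
    unfolding ext_power_def by (intro sum.cong) auto
  also have "\<dots> = b K" using b[of K] by auto
  finally show "ext_power e (\<lambda>v. v) b K = b K" .
qed

context homogeneous_group
begin

section \<open>Degrees of basis vectors and left invariant n-vector fields\<close>

lemma layer_sum_dim_mono: "i \<le> j \<Longrightarrow> layer_sum_dim G i \<le> layer_sum_dim G j"
  unfolding layer_sum_dim_def by (rule sum_mono2) auto

context
  fixes e :: "nat \<Rightarrow> 'a"
  assumes gob: "graded_orthonormal_basis G e"
begin

lemma basis_orthonormal: "orthonormal_seq e"
  using gob by (simp add: graded_orthonormal_basis_def)

text \<open>Each layer is spanned by basis vectors of index at most the total layer dimension. A
  vector \<open>e i\<close> of larger index would be orthogonal to all layers, hence to
  itself.\<close>

lemma index_le_layer_sum_dim: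
  assumes i: "i \<in> {1..DIM('a)}"
  shows "i \<le> layer_sum_dim G (step G)"
proof (rule ccontr)
  assume "\<not> ?thesis"
  then have big: "layer_sum_dim G (step G) < i" by simp
  have orth: "x \<bullet> e i = 0" if x: "x \<in> layer G j" "j \<in> {1..step G}" for x j
  proof -
    have "x \<in> span (e ` {layer_sum_dim G (j - 1)<..layer_sum_dim G j})"
      using gob x unfolding graded_orthonormal_basis_def by blast
    then show ?thesis
    proof (induction rule: span_induct)
      case base
      show ?case by (simp add: subspace_def inner_left_distrib)
    next
      case (step y)
      then obtain k where k: "y = e k" "0 < k" "k \<le> layer_sum_dim G j" by auto
      have "k \<le> layer_sum_dim G (homgroup.step G)" using k(3) layer_sum_dim_mono[of j "homgroup.step G"] x(2) by simp
      then have "k \<noteq> i" "k \<in> {1..DIM('a)}" using big i k(2) by auto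
      then show ?case using basis_orthonormal i k(1) by simp
    qed
  qed
  have "e i \<in> span (\<Union>j\<in>{1..step G}. layer G j)" by (simp only: layer_span UNIV_I)
  then have "e i \<bullet> e i = 0"
  proof (induction rule: span_induct[where P = "\<lambda>x. x \<bullet> e i = 0"])
    case base
    show ?case by (simp add: subspace_def inner_left_distrib)
  next
    case (step y)
    then show ?case using orth by blast
  qed
  moreover have "e i \<bullet> e i = 1" 
  proof -
    have "e i \<bullet> e i = (if i = i then 1 else 0)" using basis_orthonormal i by blast
    then show ?thesis by simp
  qed
  ultimately show False by (simp only: zero_neq_one)
qed

lemma index_degree_props:
  assumes i: "i \<in> {1..DIM('a)}"
  shows "index_degree G i \<in> {1..step G}" "e i \<in> layer G (index_degree G i)"
proof -
  define j where "j = (LEAST j. i \<le> layer_sum_dim G j)"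
  have le: "i \<le> layer_sum_dim G j" unfolding j_def by (rule LeastI) (rule index_le_layer_sum_dim[OF i])
  have js: "j \<le> step G" unfolding j_def by (rule Least_le) (rule index_le_layer_sum_dim[OF i])
  have j0: "j \<noteq> 0"
  proof
    assume "j = 0"
    then show False using le i by (simp add: layer_sum_dim_def)
  qed
  have less: "layer_sum_dim G (j - 1) < i"
    using not_less_Least[of "j - 1" "\<lambda>j. i \<le> layer_sum_dim G j"] j0 unfolding j_def[symmetric] by simp
  have eq: "index_degree G i = j" unfolding index_degree_def
  proof (rule the_equality)
    show "j \<in> {1..step G} \<and> layer_sum_dim G (j - 1) < i \<and> i \<le> layer_sum_dim G j" using j0 js less le by auto
    fix k assume k: "k \<in> {1..step G} \<and> layer_sum_dim G (k - 1) < i \<and> i \<le> layer_sum_dim G k"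
    have "\<not> k < j"
    proof
      assume "k < j"
      then have "k \<le> j - 1" by simp
      then show False using layer_sum_dim_mono[of k "j - 1"] k less by linarith
    qed
    moreover have "\<not> j < k"
    proof
      assume "j < k"
      then have "j \<le> k - 1" by simp
      then show False using layer_sum_dim_mono[of j "k - 1"] k le by linarith
    qed
    ultimately show "k = j" by simp
  qed
  show "index_degree G i \<in> {1..step G}" unfolding eq using j0 js by auto
  have "e i \<in> span (e ` {layer_sum_dim G (j - 1)<..layer_sum_dim G j})" using less le by (intro span_base) auto
  then show "e i \<in> layer G (index_degree G i)"
    unfolding eq using gob j0 js unfolding graded_orthonormal_basis_def by auto
qed

text \<open>A coefficient family is an arbitrary function on sets, but a field of n-vectors reads
  only its values at n-element multi-indices. After this cut-off the family is itself the value of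
  the field at 0.\<close>

definition restrict_coeffs :: "nat \<Rightarrow> (nat set \<Rightarrow> real) \<Rightarrow> multivector" where
  "restrict_coeffs n c J = (if J \<subseteq> {1..DIM('a)} \<and> card J = n then c J else 0)"

lemma nvector_field_eq: "nvector_field G e n c x = ext_power e (lderiv x 0) (restrict_coeffs n c)"
proof
  fix K
  have "ext_power e (lderiv x 0) (restrict_coeffs n c) K
    = (\<Sum>I\<in>{I. I \<subseteq> {1..DIM('a)} \<and> card I = n}. restrict_coeffs n c I * wedge_list e (map (\<lambda>i. lderiv x 0 (e i)) (sorted_list_of_set I)) K)"
    unfolding ext_power_def by (rule sum.mono_neutral_right) (auto simp: restrict_coeffs_def)
  also have "\<dots> = nvector_field G e n c x K"
    unfolding nvector_field_def basis_nvector_def basis_field_eq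
    by (rule sum.cong) (auto simp: restrict_coeffs_def)
  finally show "nvector_field G e n c x K = ext_power e (lderiv x 0) (restrict_coeffs n c) K" by simp
qed

lemma nvector_field_zero: "nvector_field G e n c 0 = restrict_coeffs n c"
proof -
  have "lderiv 0 0 = (\<lambda>v. v)" by (simp add: fun_eq_iff)
  show ?thesis unfolding nvector_field_eq \<open>lderiv 0 0 = (\<lambda>v. v)\<close>
  proof (rule ext_power_ident[OF basis_orthonormal])
    show "J \<subseteq> {1..DIM('a)}" if "restrict_coeffs n c J \<noteq> 0" for J
      using that by (simp add: restrict_coeffs_def split: if_splits)
  qed
qed

text \<open>There are finitely many multi-indices, so \<open>Max\<close> is taken over a finite set;
  a nonzero coefficient is detected at the point 0, where the field coincides with its
  coefficients.\<close>

lemma le_max_degree: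
  assumes "restrict_coeffs n c J \<noteq> 0"
  shows "(\<Sum>i\<in>J. index_degree G i) \<le> max_degree G e n c"
proof -
  define A where "A = {M. nvector_field G e n (degree_part G M c) \<noteq> (\<lambda>_ _. 0)}"
  have "finite A"
  proof (rule finite_subset)
    show "A \<subseteq> (\<lambda>J. \<Sum>i\<in>J. index_degree G i) ` Pow {1..DIM('a)}"
    proof
      fix M assume "M \<in> A"
      have "restrict_coeffs n (degree_part G M c) \<noteq> (\<lambda>_. 0)"
      proof
        assume "restrict_coeffs n (degree_part G M c) = (\<lambda>_. 0)"
        then have "nvector_field G e n (degree_part G M c) = (\<lambda>_ _. 0)"
          by (intro ext) (simp only: nvector_field_eq ext_power_zero)
        then show False using \<open>M \<in> A\<close> by (simp add: A_def)
      qed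
      then obtain J where "restrict_coeffs n (degree_part G M c) J \<noteq> 0" by (auto simp: fun_eq_iff)
      then have "J \<subseteq> {1..DIM('a)}" "(\<Sum>i\<in>J. index_degree G i) = M"
        by (auto simp: restrict_coeffs_def degree_part_def split: if_splits)
      then show "M \<in> (\<lambda>J. \<Sum>i\<in>J. index_degree G i) ` Pow {1..DIM('a)}" by blast
    qed
  qed simp
  moreover have "(\<Sum>i\<in>J. index_degree G i) \<in> A"
  proof -
    have "nvector_field G e n (degree_part G (\<Sum>i\<in>J. index_degree G i) c) 0 J \<noteq> 0"
      using assms unfolding nvector_field_zero by (simp add: restrict_coeffs_def degree_part_def split: if_splits)
    then show ?thesis unfolding A_def by auto
  qed
  ultimately show ?thesis unfolding max_degree_def A_def[symmetric] by (rule Max_ge)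
qed

text \<open>Let \<open>\<tau>\<close> be the tangent vector translated to 0, \<open>j\<close> the
  highest degree of its components and \<open>v\<close> the component of degree \<open>j\<close>.
  The tangent n-vector annihilates \<open>t\<close>; translated to 0 and read in the highest
  possible degree, this says that \<open>v\<close> is annihilated by the part of degree
  \<open>max_degree\<close>. If \<open>\<tau>\<close> were not in the first layer, then
  \<open>j \<ge> 2\<close>, while horizontality puts \<open>v\<close> into the first layer.\<close>

lemma tangent_horizontal:
  assumes hp: "horizontal_point G e n S p" and t: "t \<in> tangent_space S p"
  shows "lderiv (- p) p t \<in> layer G 1"
proof (rule ccontr)
  define \<tau> where "\<tau> = lderiv (- p) p t"
  assume "\<not> ?thesis"
  then have not1: "\<tau> \<notin> layer G 1" by (simp add: \<tau>_def)
  obtain c ts where ts: "span (set ts) = tangent_space S p" "nvector_field G e n c p = wedge_list e ts"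
    and hs: "horizontal_subgroup G ((\<lambda>X. X 0) ` homogeneous_tangent_algebra G e n c)"
    using hp unfolding horizontal_point_def tangent_coeffs_def by blast
  note on = basis_orthonormal
  define b where "b = restrict_coeffs n c"
  have "ext_mult (vec_coeffs e t) (wedge_list e ts) = (\<lambda>_. 0)"
    by (rule wedge_list_span_zero) (use t ts(1) in simp)
  \<comment> \<open>The differential of translation by \<open>- p\<close> undoes that of translation
    by \<open>p\<close>, leaving the coefficients \<open>b\<close> of the invariant field in place
    of its value at \<open>p\<close>.\<close>
  then have "ext_power e (lderiv (- p) p) (ext_mult (vec_coeffs e t) (ext_power e (lderiv p 0) b)) = (\<lambda>_. 0)"
    unfolding ts(2)[symmetric] nvector_field_eq b_def by simp
  then have "ext_mult (vec_coeffs e \<tau>) (ext_power e (\<lambda>v. v) b) = (\<lambda>_. 0)"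
    unfolding ext_power_ext_mult[OF on linear_lderiv] ext_power_compose[OF on linear_lderiv] by (simp add: \<tau>_def)
  then have zero: "ext_mult (vec_coeffs e \<tau>) b = (\<lambda>_. 0)"
    by (subst (asm) ext_power_ident[OF on]) (auto simp: b_def restrict_coeffs_def split: if_splits)
  define j where "j = Max {j. lcomp \<tau> j \<noteq> 0}"
  have fin: "finite {j. lcomp \<tau> j \<noteq> 0}"
    by (rule finite_subset[of _ "{1..step G}"]) (use comp_outside in blast, simp)
  obtain j' where j': "j' \<noteq> 1" "lcomp \<tau> j' \<noteq> 0" using not1 unfolding in_layer_iff by blast
  have "j' \<in> {1..step G}" using j'(2) comp_outside by blast
  then have "2 \<le> j'" using j'(1) by auto
  then have j2: "2 \<le> j" using Max_ge[OF fin, of j'] j'(2) unfolding j_def by simp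
  have "j \<in> {j. lcomp \<tau> j \<noteq> 0}" unfolding j_def by (rule Max_in[OF fin]) (use j' in auto)
  then have jn: "lcomp \<tau> j \<noteq> 0" by simp
  define v where "v = lcomp \<tau> j"
  have vj: "v \<in> layer G j" unfolding v_def by (rule comp_decomposition)
  have inner: "x \<bullet> e i = lcomp x (index_degree G i) \<bullet> e i" if i: "i \<in> {1..DIM('a)}" for x i
  proof -
    have "x \<bullet> e i = (\<Sum>k = 1..step G. lcomp x k \<bullet> e i)"
      by (subst comp_decomposition(2)[of x]) (simp add: inner_sum_left)
    also have "\<dots> = (\<Sum>k = 1..step G. if k = index_degree G i then lcomp x (index_degree G i) \<bullet> e i else 0)"
      by (rule sum.cong) (use layer_orthogonal[OF _ comp_decomposition(1) index_degree_props(2)[OF i]] in auto)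
    also have "\<dots> = lcomp x (index_degree G i) \<bullet> e i" using index_degree_props(1)[OF i] by simp
    finally show ?thesis .
  qed
  \<comment> \<open>Selecting the coordinates of degree \<open>j\<close> of \<open>\<tau>\<close>
    gives \<open>v\<close>, since each basis vector sees only the component in its own layer;
    selecting coefficients likewise gives the projection used by the tangent algebra.\<close>
  have "ext_mult (\<lambda>i. if index_degree G i = j then vec_coeffs e \<tau> i else 0)
      (\<lambda>K. if (\<Sum>i\<in>K. index_degree G i) = max_degree G e n c then b K else 0) = (\<lambda>_. 0)"
  proof (rule ext_mult_top_degree[OF zero])
    show "(\<Sum>i\<in>K. index_degree G i) \<le> max_degree G e n c" if "b K \<noteq> 0" for K
      using that le_max_degree by (simp add: b_def)
    fix i assume "vec_coeffs e \<tau> i \<noteq> 0"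
    then have "i \<in> {1..DIM('a)}" "\<tau> \<bullet> e i \<noteq> 0" by (auto simp: vec_coeffs_def split: if_splits)
    then have "lcomp \<tau> (index_degree G i) \<bullet> e i \<noteq> 0" by (simp only: inner[symmetric] not_False_eq_True)
    then have "lcomp \<tau> (index_degree G i) \<noteq> 0" by (metis inner_zero_left)
    then show "index_degree G i \<le> j" unfolding j_def by (intro Max_ge[OF fin]) simp
  qed
  also have "(\<lambda>i. if index_degree G i = j then vec_coeffs e \<tau> i else 0) = vec_coeffs e v"
  proof
    fix i
    show "(if index_degree G i = j then vec_coeffs e \<tau> i else 0) = vec_coeffs e v i"
    proof (cases "i \<in> {1..DIM('a)}")
      case True
      have "lcomp v (index_degree G i) = (if index_degree G i = j then v else 0)" using vj by (rule comp_layer)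
      then have "v \<bullet> e i = (if index_degree G i = j then v \<bullet> e i else 0)"
        by (subst inner[OF True]) simp
      moreover have "\<tau> \<bullet> e i = v \<bullet> e i" if "index_degree G i = j"
        by (subst inner[OF True]) (simp only: that v_def)
      moreover have "vec_coeffs e x i = x \<bullet> e i" for x
        unfolding vec_coeffs_def using True by (simp only: if_True)
      ultimately show ?thesis by auto
    next
      case False
      then have "vec_coeffs e x i = 0" for x by (simp only: vec_coeffs_def if_False)
      then show ?thesis by simp
    qed
  qed
  also have "(\<lambda>K. if (\<Sum>i\<in>K. index_degree G i) = max_degree G e n c then b K else 0)
     = restrict_coeffs n (degree_part G (max_degree G e n c) c)"
    by (auto simp: fun_eq_iff b_def restrict_coeffs_def degree_part_def)
  finally have top: "ext_mult (vec_coeffs e v) (restrict_coeffs n (degree_part G (max_degree G e n c) c)) = (\<lambda>_. 0)" .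
  have "(\<lambda>p. lderiv p 0 v) \<in> homogeneous_tangent_algebra G e n c"
    unfolding homogeneous_tangent_algebra_def
  proof (intro CollectI conjI allI left_invariant_field_of_vector)
    fix x
    show "wedge (mv_of_vector e (lderiv x 0 v)) (nvector_field G e n (degree_part G (max_degree G e n c) c) x) = (\<lambda>_. 0)"
      unfolding wedge_mv_of_vector nvector_field_eq ext_power_ext_mult[OF on linear_lderiv, symmetric] top by simp
  qed
  then have "lderiv 0 0 v \<in> (\<lambda>X. X 0) ` homogeneous_tangent_algebra G e n c" by (rule image_eqI[rotated]) simp
  then have "v \<in> layer G 1" using hs unfolding horizontal_subgroup_def by auto
  then have "lcomp v j = 0" using j2 comp_layer[of v 1 j] by simp
  then show False using comp_layer[OF vj, of j] jn by (simp add: v_def)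
qed

end

end

section \<open>Stability of steered curves\<close>

context homogeneous_group
begin

definition low_part :: "nat \<Rightarrow> 'a \<Rightarrow> 'a" where
  "low_part j x = (\<Sum>i = 1..j. lcomp x i)"

lemma bounded_linear_low: "bounded_linear (low_part j)"
  unfolding low_part_def[abs_def] by (intro bounded_linear_sum bounded_linear_lcomp)

lemma comp_low: "lcomp (low_part j x) i = (if i \<le> j then lcomp x i else 0)"
proof -
  have "lcomp (low_part j x) i = (\<Sum>k = 1..j. lcomp (lcomp x k) i)"
    unfolding low_part_def by (rule linear_sum[OF linear_comp])
  also have "\<dots> = (\<Sum>k = 1..j. if k = i then lcomp x i else 0)"
    by (rule sum.cong) (auto simp: comp_layer[OF comp_decomposition(1)])
  also have "\<dots> = (if i \<le> j then lcomp x i else 0)"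
    using comp_outside[of 0 x] by (cases "i = 0") auto
  finally show ?thesis .
qed

lemma low_Suc: "low_part (Suc j) x = low_part j x + lcomp x (Suc j)"
  by (simp add: low_part_def)

lemma low_step [simp]: "low_part (step G) x = x"
  unfolding low_part_def by (rule comp_decomposition(2)[symmetric])

text \<open>This turns the stability estimate into an induction on the layers, with no a priori bound on the curve.\<close>

lemma comp_lderiv_low: "lcomp (lderiv (low_part j x) 0 v) (Suc j) = lcomp (lderiv x 0 v) (Suc j)"
proof -
  have "x - low_part j x \<in> filt (Suc j)" by (simp add: filt_def comp_diff comp_low)
  then have "lderiv x 0 v - lderiv (low_part j x) 0 v \<in> filt (Suc (Suc j))" by (intro lderiv_diff_filt) simp_all
  then have "lcomp (lderiv x 0 v - lderiv (low_part j x) 0 v) (Suc j) = 0" by (simp add: filt_def)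
  then show ?thesis by (simp add: comp_diff)
qed

text \<open>Translated to 0, the velocity of the curve at time t is the control
  \<open>v t\<close>.\<close>

definition steered :: "(real \<Rightarrow> 'a) \<Rightarrow> (real \<Rightarrow> 'a) \<Rightarrow> bool" where
  "steered \<rho> v \<longleftrightarrow> \<rho> 0 = 0 \<and> (\<forall>t\<in>{0..1}. (\<rho> has_vector_derivative lderiv (\<rho> t) 0 (v t)) (at t within {0..1}))"

text \<open>The velocity in layer j + 1 is a continuous function \<open>F\<close> of the lower
  layers and the control. On the line \<open>t *\<^sub>R v0\<close> with control \<open>v0\<close>
  it is the component of \<open>v0\<close>. The induction hypothesis keeps the lower layers close to
  that line, so by uniform continuity the error in layer j + 1 grows at speed at most
  \<open>\<eta> / 2\<close>.\<close>

lemma steered_stable_low: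
  assumes "0 < \<eta>"
  shows "\<exists>\<epsilon>>0. \<forall>v0 \<rho> v. norm v0 \<le> R \<longrightarrow> steered \<rho> v \<longrightarrow> (\<forall>t\<in>{0..1}. norm (v t - v0) \<le> \<epsilon>) \<longrightarrow>
    (\<forall>t\<in>{0..1}. norm (low_part j (\<rho> t - t *\<^sub>R v0)) \<le> \<eta>)"
  using assms
proof (induction j arbitrary: \<eta>)
  case 0
  then show ?case by (intro exI[of _ 1]) (simp add: low_part_def)
next
  case (Suc j)
  obtain B where B: "0 < B" "\<And>x. norm (low_part j x) \<le> norm x * B"
    using bounded_linear.pos_bounded[OF bounded_linear_low[of j]] by blast
  \<comment> \<open>Large enough for the low parts of the line (at most
    \<open>\<bar>R\<bar> * B\<close>) and of the curve (at most 1 more), and for both controls (at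
    most \<open>\<bar>R\<bar> + 1\<close>).\<close>
  define R' where "R' = \<bar>R\<bar> * B + \<bar>R\<bar> + 2"
  define F where "F z = lcomp (lderiv (fst z) 0 (snd z)) (Suc j)" for z
  have "continuous_on (cball 0 R' \<times> cball 0 R') F"
    unfolding F_def by (intro bounded_linear.continuous_on[OF bounded_linear_lcomp] continuous_intros)
  then have "uniformly_continuous_on (cball 0 R' \<times> cball 0 R') F"
    by (intro compact_uniformly_continuous compact_Times compact_cball)
  then obtain \<delta> where \<delta>: "0 < \<delta>" "\<And>z z'. z \<in> cball 0 R' \<times> cball 0 R' \<Longrightarrow> z' \<in> cball 0 R' \<times> cball 0 R'
      \<Longrightarrow> dist z' z < \<delta> \<Longrightarrow> dist (F z') (F z) < \<eta> / 2"
    unfolding uniformly_continuous_on_def using half_gt_zero[OF Suc.prems] by meson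
  \<comment> \<open>The bound \<open>\<eta> / 2\<close> is the share of the lower layers in the
    total error; with \<open>\<delta> / 3\<close> here and again for the controls, the arguments of
    \<open>F\<close> differ by less than \<open>\<delta>\<close>.\<close>
  define \<eta>' where "\<eta>' = min (\<eta> / 2) (min 1 (\<delta> / 3))"
  have \<eta>': "0 < \<eta>'" "\<eta>' \<le> \<eta> / 2" "\<eta>' \<le> 1" "\<eta>' \<le> \<delta> / 3" using Suc.prems \<delta>(1) by (auto simp: \<eta>'_def)
  obtain \<epsilon>0 where \<epsilon>0: "0 < \<epsilon>0" "\<And>v0 \<rho> v t. norm v0 \<le> R \<Longrightarrow> steered \<rho> v \<Longrightarrow> (\<forall>t\<in>{0..1}. norm (v t - v0) \<le> \<epsilon>0)
     \<Longrightarrow> t \<in> {0..1} \<Longrightarrow> norm (low_part j (\<rho> t - t *\<^sub>R v0)) \<le> \<eta>'"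
    using Suc.IH[OF \<eta>'(1)] by blast
  define \<epsilon> where "\<epsilon> = min \<epsilon>0 (min 1 (\<delta> / 3))"
  have \<epsilon>: "0 < \<epsilon>" "\<epsilon> \<le> \<epsilon>0" "\<epsilon> \<le> 1" "\<epsilon> \<le> \<delta> / 3" using \<epsilon>0(1) \<delta>(1) by (auto simp: \<epsilon>_def)
  have "norm (low_part (Suc j) (\<rho> t - t *\<^sub>R v0)) \<le> \<eta>"
    if v0: "norm v0 \<le> R" and st: "steered \<rho> v" and v: "\<forall>t\<in>{0..1}. norm (v t - v0) \<le> \<epsilon>" and t: "t \<in> {0..1}"
    for v0 \<rho> v t
  proof -
    have low_small: "norm (low_part j (\<rho> s - s *\<^sub>R v0)) \<le> \<eta>'" if "s \<in> {0..1}" for s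
      using \<epsilon>0(2)[OF v0 st _ that] v \<epsilon>(2) by force
    define E where "E s = lcomp (\<rho> s - s *\<^sub>R v0) (Suc j)" for s
    define E' where "E' s = lcomp (lderiv (\<rho> s) 0 (v s) - v0) (Suc j)" for s
    have der: "(E has_vector_derivative E' s) (at s within {0..1})" if "s \<in> {0..1}" for s
    proof -
      have "(\<rho> has_vector_derivative lderiv (\<rho> s) 0 (v s)) (at s within {0..1})"
        using st that by (simp add: steered_def)
      then have "((\<lambda>s. \<rho> s - s *\<^sub>R v0) has_vector_derivative lderiv (\<rho> s) 0 (v s) - v0) (at s within {0..1})"
        by (auto intro!: derivative_eq_intros)
      then show ?thesis unfolding E_def E'_def
        by (rule bounded_linear.has_vector_derivative[OF bounded_linear_lcomp])
    qed
    have bound: "norm (E' s) \<le> \<eta> / 2" if s: "s \<in> {0..1}" for s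
    proof -
      let ?z = "(low_part j (s *\<^sub>R v0), v0)" and ?z' = "(low_part j (\<rho> s), v s)"
      have nv: "norm (v s - v0) \<le> \<epsilon>" using v s by blast
      have nl: "norm (low_part j (\<rho> s) - low_part j (s *\<^sub>R v0)) \<le> \<eta>'"
        using low_small[OF s] linear_diff[OF bounded_linear.linear[OF bounded_linear_low]] by simp
      have sv: "norm (s *\<^sub>R v0) \<le> \<bar>R\<bar>"
        using s v0 mult_mono[of "\<bar>s\<bar>" 1 "norm v0" "\<bar>R\<bar>"] by auto
      have "norm (low_part j (s *\<^sub>R v0)) \<le> norm (s *\<^sub>R v0) * B" by (rule B(2))
      also have "\<dots> \<le> \<bar>R\<bar> * B" using sv B(1) by (intro mult_right_mono) auto
      finally have l1: "norm (low_part j (s *\<^sub>R v0)) \<le> \<bar>R\<bar> * B" .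
      have l2: "norm (low_part j (\<rho> s)) \<le> \<bar>R\<bar> * B + 1"
        using l1 nl \<eta>'(3) norm_triangle_sub[of "low_part j (\<rho> s)" "low_part j (s *\<^sub>R v0)"] by linarith
      have l3: "norm (v s) \<le> \<bar>R\<bar> + 1"
        using v0 nv \<epsilon>(3) norm_triangle_sub[of "v s" v0] by linarith
      have "0 \<le> \<bar>R\<bar> * B" using B(1) by simp
      then have mem: "?z \<in> cball 0 R' \<times> cball 0 R'" "?z' \<in> cball 0 R' \<times> cball 0 R'"
        using l1 l2 l3 v0 by (auto simp: R'_def)
      have "dist ?z' ?z \<le> norm (low_part j (\<rho> s) - low_part j (s *\<^sub>R v0)) + norm (v s - v0)"
        unfolding dist_Pair_Pair by (rule order_trans[OF sqrt_sum_squares_le_sum_abs]) (simp add: dist_norm)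
      then have "dist ?z' ?z < \<delta>" using nl nv \<eta>'(4) \<epsilon>(4) \<delta>(1) by linarith
      then have "dist (F ?z') (F ?z) < \<eta> / 2" by (rule \<delta>(2)[OF mem])
      moreover have "F ?z' = lcomp (lderiv (\<rho> s) 0 (v s)) (Suc j)" by (simp add: F_def comp_lderiv_low)
      moreover have "F ?z = lcomp v0 (Suc j)" by (simp add: F_def comp_lderiv_low lderiv_multiple)
      ultimately show ?thesis by (simp add: E'_def dist_norm comp_diff)
    qed
    have "norm (E t - E 0) \<le> \<eta> / 2 * norm (t - 0)"
    proof (rule differentiable_bound[where S = "{0..1}" and f' = "\<lambda>s h. h *\<^sub>R E' s"])
      show "(E has_derivative (\<lambda>h. h *\<^sub>R E' s)) (at s within {0..1})" if "s \<in> {0..1}" for s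
        using der[OF that] by (simp add: has_vector_derivative_def)
      show "onorm (\<lambda>h. h *\<^sub>R E' s) \<le> \<eta> / 2" if "s \<in> {0..1}" for s
      proof (rule onorm_le)
        show "norm (h *\<^sub>R E' s) \<le> \<eta> / 2 * norm h" for h
          using mult_left_mono[OF bound[OF that], of "\<bar>h\<bar>"] by (simp add: mult.commute)
      qed
    qed (use t in auto)
    moreover have "E 0 = 0" using st by (simp add: E_def steered_def)
    moreover have "\<eta> / 2 * norm (t - 0) \<le> \<eta> / 2" using t Suc.prems by (intro mult_left_le) auto
    ultimately have "norm (E t) \<le> \<eta> / 2" by simp
    moreover have "norm (low_part j (\<rho> t - t *\<^sub>R v0)) \<le> \<eta> / 2" using low_small[OF t] \<eta>'(2) by linarith
    moreover have "low_part (Suc j) (\<rho> t - t *\<^sub>R v0) = low_part j (\<rho> t - t *\<^sub>R v0) + E t" by (simp add: low_Suc E_def)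
    ultimately show ?thesis using norm_triangle_ineq[of "low_part j (\<rho> t - t *\<^sub>R v0)" "E t"] by simp
  qed
  then show ?case using \<epsilon>(1) by blast
qed

lemma steered_stable:
  assumes "0 < \<eta>"
  obtains \<epsilon> where "0 < \<epsilon>" "\<And>v0 \<rho> v. norm v0 \<le> R \<Longrightarrow> steered \<rho> v \<Longrightarrow> (\<And>t. t \<in> {0..1} \<Longrightarrow> norm (v t - v0) \<le> \<epsilon>)
    \<Longrightarrow> norm (\<rho> 1 - v0) \<le> \<eta>"
proof -
  obtain \<epsilon> where \<epsilon>: "0 < \<epsilon>" "\<And>v0 \<rho> v t. norm v0 \<le> R \<Longrightarrow> steered \<rho> v \<Longrightarrow> (\<forall>t\<in>{0..1}. norm (v t - v0) \<le> \<epsilon>)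
     \<Longrightarrow> t \<in> {0..1} \<Longrightarrow> norm (low_part (step G) (\<rho> t - t *\<^sub>R v0)) \<le> \<eta>"
    using steered_stable_low[OF assms, of R "step G"] by blast
  show ?thesis
  proof (rule that[OF \<epsilon>(1)])
    fix v0 \<rho> v assume "norm v0 \<le> R" "steered \<rho> v" "\<And>t. t \<in> {0..1} \<Longrightarrow> norm (v t - v0) \<le> \<epsilon>"
    then show "norm (\<rho> 1 - v0) \<le> \<eta>" using \<epsilon>(2)[of v0 \<rho> v 1] by simp
  qed
qed

end

section \<open>Charts of horizontal submanifolds\<close>

context homogeneous_group
begin

text \<open>The map \<open>g\<close> is the chart followed by \<open>A a0\<close>, the differential
  at \<open>a0\<close> of the parametrization, translated to the identity. The chart segment from x
  to y, translated to start at 0 and dilated by the inverse s of its length, is steered by a control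
  near the value of \<open>A a0\<close> on its unit direction. Its endpoint, the dilation by 1/s of
  the quotient of y by x, is therefore near that value, where \<open>d\<close> is known; scaling
  back by s gives the estimate.\<close>

lemma local_chart_estimate:
  fixes e :: "nat \<Rightarrow> 'a"
  assumes gob: "graded_orthonormal_basis G e" and md: "multiradial G d"
    and hs: "horizontal_submanifold G e n S" and p: "p \<in> S"
    and c: "0 < c" "\<forall>v\<in>layer G 1. d v 0 = c * norm v" and \<epsilon>: "0 < \<epsilon>"
  shows "\<exists>U (V :: 'a set) (g :: 'a \<Rightarrow> 'a). open U \<and> p \<in> U \<and> subspace V \<and> dim V = n \<and> g ` (S \<inter> U) \<subseteq> V \<and>
    (\<forall>x\<in>S \<inter> U. \<forall>y\<in>S \<inter> U. \<bar>d x y - c * dist (g x) (g y)\<bar> \<le> \<epsilon> * dist (g x) (g y))"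
proof -
  interpret M: Metric_space UNIV d by (rule hom_dist[OF md])
  obtain U \<Phi> \<Psi> W where U: "open U" "p \<in> U" "open (\<Phi> ` U)" "C1_on U \<Phi>" "C1_on (\<Phi> ` U) \<Psi>" "\<And>x. x \<in> U \<Longrightarrow> \<Psi> (\<Phi> x) = x"
    and W: "subspace W" "dim W = n" "\<Phi> ` (U \<inter> S) = \<Phi> ` U \<inter> W"
    using hs p unfolding horizontal_submanifold_def C1_embedded_submanifold_def by blast
  obtain D\<Phi> where "(\<forall>x\<in>U. (\<Phi> has_derivative blinfun_apply (D\<Phi> x)) (at x)) \<and> continuous_on U D\<Phi>"
    using U(4) unfolding C1_on_def by (rule exE)
  then have D\<Phi>: "\<And>x. x \<in> U \<Longrightarrow> (\<Phi> has_derivative blinfun_apply (D\<Phi> x)) (at x)" by blast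
  obtain D\<Psi> where "(\<forall>a\<in>\<Phi> ` U. (\<Psi> has_derivative blinfun_apply (D\<Psi> a)) (at a)) \<and> continuous_on (\<Phi> ` U) D\<Psi>"
    using U(5) unfolding C1_on_def by (rule exE)
  then have D\<Psi>: "\<And>a. a \<in> \<Phi> ` U \<Longrightarrow> (\<Psi> has_derivative blinfun_apply (D\<Psi> a)) (at a)" "continuous_on (\<Phi> ` U) D\<Psi>"
    by blast+
  \<comment> \<open>The derivative of the parametrization at \<open>a\<close>, translated to the
    identity. It maps \<open>W\<close> into the first layer when \<open>a \<in> W\<close> lies in
    the chart image.\<close>
  define A where "A a w = lderiv (- \<Psi> a) (\<Psi> a) (blinfun_apply (D\<Psi> a) w)" for a w
  have lderiv_A: "lderiv (\<Psi> a) 0 (A a w) = blinfun_apply (D\<Psi> a) w" for a w by (simp add: A_def)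
  define a0 where "a0 = \<Phi> p"
  have a0: "a0 \<in> \<Phi> ` U" "a0 \<in> W" "\<Psi> a0 = p" using U p W(3) by (auto simp: a0_def)
  have \<Psi>S: "\<Psi> a \<in> S \<inter> U" "\<Phi> (\<Psi> a) = a" if "a \<in> \<Phi> ` U" "a \<in> W" for a
  proof -
    have "a \<in> \<Phi> ` (U \<inter> S)" using that W(3) by blast
    then obtain x where "x \<in> U \<inter> S" "a = \<Phi> x" by blast
    then show "\<Psi> a \<in> S \<inter> U" "\<Phi> (\<Psi> a) = a" using U(6) by auto
  qed
  have A_hor: "A a w \<in> layer G 1" if a: "a \<in> \<Phi> ` U" "a \<in> W" and w: "w \<in> W" for a w
  proof -
    have "blinfun_apply (D\<Psi> a) w \<in> tangent_space S (\<Psi> a)"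
      unfolding tangent_space_def
    proof (intro CollectI exI[of _ "\<lambda>t. \<Psi> (a + t *\<^sub>R w)"] conjI)
      have "((\<lambda>t::real. a + t *\<^sub>R w) \<longlongrightarrow> a + 0 *\<^sub>R w) (at 0)" by (intro tendsto_intros)
      then have "\<forall>\<^sub>F t in at 0. a + t *\<^sub>R w \<in> \<Phi> ` U"
        by (rule topological_tendstoD) (use a U(3) in auto)
      then show "\<forall>\<^sub>F t in at 0. \<Psi> (a + t *\<^sub>R w) \<in> S"
      proof eventually_elim
        case (elim t)
        have "a + t *\<^sub>R w \<in> W" using a(2) w W(1) by (intro subspace_add subspace_scale)
        then show ?case using \<Psi>S(1) elim by blast
      qed
      have "((\<lambda>t::real. a + t *\<^sub>R w) has_derivative (\<lambda>h. h *\<^sub>R w)) (at 0)"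
        by (auto intro!: derivative_eq_intros)
      from has_derivative_compose[OF this, of \<Psi> "blinfun_apply (D\<Psi> a)"] D\<Psi>(1)[OF a(1)]
      show "((\<lambda>t. \<Psi> (a + t *\<^sub>R w)) has_vector_derivative blinfun_apply (D\<Psi> a) w) (at 0)"
        by (simp add: has_vector_derivative_def blinfun.scaleR_right)
    qed simp
    moreover have "horizontal_point G e n S (\<Psi> a)"
      using hs \<Psi>S(1)[OF a] unfolding horizontal_submanifold_def by blast
    ultimately show ?thesis unfolding A_def by (intro tangent_horizontal[OF gob])
  qed
  have linA: "linear (A a)" for a
  proof -
    have "linear (lderiv (- \<Psi> a) (\<Psi> a) \<circ> blinfun_apply (D\<Psi> a))"
      by (intro linear_compose linear_lderiv bounded_linear.linear blinfun.bounded_linear_right)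
    then show ?thesis by (simp add: A_def[abs_def] comp_def)
  qed
  have "inj (A a0)"
  proof (subst linear_injective_0[OF linA], intro allI impI)
    fix w assume "A a0 w = 0"
    then have "blinfun_apply (D\<Psi> a0) w = 0" using lderiv_A[of a0 w] linear_0[OF linear_lderiv] by simp
    \<comment> \<open>The chain rule for a composition that is the identity near \<open>a0\<close>:
      the derivative of \<open>\<Psi>\<close> has a left inverse.\<close>
    have "((\<lambda>a. \<Phi> (\<Psi> a)) has_derivative (\<lambda>w. blinfun_apply (D\<Phi> p) (blinfun_apply (D\<Psi> a0) w))) (at a0)"
      using has_derivative_compose[OF D\<Psi>(1)[OF a0(1)], of \<Phi> "blinfun_apply (D\<Phi> p)"] D\<Phi>[OF U(2)] a0(3) by simp
    moreover have "((\<lambda>a. \<Phi> (\<Psi> a)) has_derivative (\<lambda>w. w)) (at a0)"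
    proof (rule has_derivative_transform_within_open[OF has_derivative_ident U(3) a0(1)])
      show "a = \<Phi> (\<Psi> a)" if "a \<in> \<Phi> ` U" for a using that U(6) by auto
    qed
    ultimately have "(\<lambda>w. blinfun_apply (D\<Phi> p) (blinfun_apply (D\<Psi> a0) w)) = (\<lambda>w. w)"
      by (rule has_derivative_unique)
    from fun_cong[OF this, of w] show "w = 0" using \<open>blinfun_apply (D\<Psi> a0) w = 0\<close> by (simp add: blinfun.zero_right)
  qed
  then obtain m where m: "0 < m" "\<And>w. m * norm w \<le> norm (A a0 w)"
    using linear_inj_bounded_below_pos[OF linA, of a0] by blast
  obtain R where R: "0 < R" "\<And>w. norm (A a0 w) \<le> norm w * R"
    using bounded_linear.pos_bounded[OF linA[of a0, unfolded linear_conv_bounded_linear]] by blast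
  \<comment> \<open>The radius \<open>R + 1\<close> accommodates \<open>A a0 w\<close> and any
    endpoint within 1 of it. The tolerance \<open>\<epsilon> * m\<close> is later absorbed by
    \<open>m \<le> norm (A a0 w)\<close>, which makes the error relative.\<close>
  have "uniformly_continuous_on (cball 0 (R + 1)) (\<lambda>z. d z 0)"
    by (intro compact_uniformly_continuous continuous_on_subset[OF continuous_on_hom_norm[OF md]] compact_cball) simp
  then obtain \<eta>0 where \<eta>0: "0 < \<eta>0" "\<And>z z'. z \<in> cball 0 (R + 1) \<Longrightarrow> z' \<in> cball 0 (R + 1)
      \<Longrightarrow> dist z' z < \<eta>0 \<Longrightarrow> dist (d z' 0) (d z 0) < \<epsilon> * m"
    unfolding uniformly_continuous_on_def using mult_pos_pos[OF \<epsilon> m(1)] by meson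
  define \<eta> where "\<eta> = min 1 (\<eta>0 / 2)"
  have \<eta>: "0 < \<eta>" "\<eta> \<le> 1" "\<eta> < \<eta>0" using \<eta>0(1) by (auto simp: \<eta>_def)
  obtain \<epsilon>1 where \<epsilon>1: "0 < \<epsilon>1" "\<And>v0 \<rho> v. norm v0 \<le> R \<Longrightarrow> steered \<rho> v \<Longrightarrow> (\<And>t. t \<in> {0..1} \<Longrightarrow> norm (v t - v0) \<le> \<epsilon>1)
    \<Longrightarrow> norm (\<rho> 1 - v0) \<le> \<eta>"
    using steered_stable[OF \<eta>(1), of R] by blast
  obtain r0 where r0: "0 < r0" "cball a0 r0 \<subseteq> \<Phi> ` U"
    using U(3) a0(1) unfolding open_contains_cball by blast
  have cont\<Psi>: "continuous_on (\<Phi> ` U) \<Psi>"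
    by (rule has_derivative_continuous_on) (rule has_derivative_at_withinI[OF D\<Psi>(1)])
  have c1: "continuous_on (cball a0 r0 \<times> cball (0::'a) 1) (\<lambda>z. \<Psi> (fst z))"
    by (rule continuous_on_compose2[OF cont\<Psi>]) (use r0(2) in \<open>auto intro: continuous_intros\<close>)
  have c2: "continuous_on (cball a0 r0 \<times> cball (0::'a) 1) (\<lambda>z. D\<Psi> (fst z))"
    by (rule continuous_on_compose2[OF D\<Psi>(2)]) (use r0(2) in \<open>auto intro: continuous_intros\<close>)
  have "continuous_on (cball a0 r0 \<times> cball 0 1) (\<lambda>z. A (fst z) (snd z))"
    unfolding A_def by (intro continuous_intros c1 c2)
  then have "uniformly_continuous_on (cball a0 r0 \<times> cball 0 1) (\<lambda>z. A (fst z) (snd z))"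
    by (intro compact_uniformly_continuous compact_Times compact_cball)
  then obtain r1 where r1: "0 < r1" "\<And>z z'. z \<in> cball a0 r0 \<times> cball 0 1 \<Longrightarrow> z' \<in> cball a0 r0 \<times> cball 0 1
      \<Longrightarrow> dist z' z < r1 \<Longrightarrow> dist (A (fst z') (snd z')) (A (fst z) (snd z)) < \<epsilon>1"
    unfolding uniformly_continuous_on_def using \<epsilon>1(1) by meson
  define r where "r = min r0 r1"
  have r: "0 < r" "r \<le> r0" "r \<le> r1" using r0(1) r1(1) by (auto simp: r_def)
  have A_near: "norm (A a w - A a0 w) \<le> \<epsilon>1" if "a \<in> ball a0 r" "norm w \<le> 1" for a w
  proof -
    have "dist (A (fst (a, w)) (snd (a, w))) (A (fst (a0, w)) (snd (a0, w))) < \<epsilon>1"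
      using that r r0 by (intro r1(2)) (auto simp: dist_Pair_Pair dist_commute)
    then show ?thesis by (simp add: dist_norm)
  qed
  \<comment> \<open>The chart image is restricted to a ball: by convexity the segment between two of
    its points stays where the control is nearly constant.\<close>
  define U' where "U' = U \<inter> \<Phi> -` ball a0 r"
  have cont\<Phi>: "continuous_on U \<Phi>"
    by (rule has_derivative_continuous_on) (rule has_derivative_at_withinI[OF D\<Phi>])
  have openU': "open U'" unfolding U'_def using cont\<Phi> U(1) by (intro continuous_open_preimage) auto
  have pU': "p \<in> U'" using U(2) r(1) by (simp add: U'_def a0_def)
  have sub: "subspace (A a0 ` W)" using linA W(1) by (rule linear_subspace_image)
  have dim: "dim (A a0 ` W) = n" using dim_image_eq[OF linA inj_on_subset[OF \<open>inj (A a0)\<close> subset_UNIV]] W(2) by simp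
  have chart: "\<Phi> x \<in> \<Phi> ` U" "\<Phi> x \<in> W" "\<Phi> x \<in> ball a0 r" "\<Psi> (\<Phi> x) = x" if "x \<in> S \<inter> U'" for x
  proof -
    have "x \<in> U \<inter> S" using that by (auto simp: U'_def)
    then show "\<Phi> x \<in> \<Phi> ` U" "\<Phi> x \<in> W" "\<Psi> (\<Phi> x) = x" using W(3) U(6) by auto
    show "\<Phi> x \<in> ball a0 r" using that by (simp add: U'_def)
  qed
  then have img: "(\<lambda>x. A a0 (\<Phi> x)) ` (S \<inter> U') \<subseteq> A a0 ` W" by blast
  have est: "\<bar>d x y - c * dist (A a0 (\<Phi> x)) (A a0 (\<Phi> y))\<bar> \<le> \<epsilon> * dist (A a0 (\<Phi> x)) (A a0 (\<Phi> y))"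
    if xy: "x \<in> S \<inter> U'" "y \<in> S \<inter> U'" for x y
  proof -
    define a b where "a = \<Phi> x" and "b = \<Phi> y"
    have ab: "a \<in> W" "b \<in> W" "a \<in> ball a0 r" "b \<in> ball a0 r" "\<Psi> a = x" "\<Psi> b = y"
      using chart[OF xy(1)] chart[OF xy(2)] by (simp_all add: a_def b_def)
    have dist_ab: "dist (A a0 a) (A a0 b) = norm (A a0 (b - a))"
      by (simp add: linear_diff[OF linA] dist_norm norm_minus_commute)
    show ?thesis
    proof (cases "a = b")
      case True
      then have "x = y" using ab by simp
      then show ?thesis by simp
    next
      case False
      define s where "s = norm (b - a)"
      have s: "0 < s" using False by (simp add: s_def)
      define w where "w = (1 / s) *\<^sub>R (b - a)"
      have w: "norm w = 1" "w \<in> W" "b - a = s *\<^sub>R w"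
        using s ab W(1) by (auto simp: w_def s_def intro: subspace_scale subspace_diff)
      define at' where "at' t = a + t *\<^sub>R (b - a)" for t :: real
      have at': "at' t \<in> ball a0 r" "at' t \<in> W" "at' t \<in> \<Phi> ` U" if "t \<in> {0..1}" for t
      proof -
        have "at' t = (1 - t) *\<^sub>R a + t *\<^sub>R b" by (simp add: at'_def algebra_simps)
        then show "at' t \<in> ball a0 r" using convexD[OF convex_ball ab(3,4), of "1 - t" t] that by simp
        then show "at' t \<in> \<Phi> ` U" using r(2) r0(2) by auto
        show "at' t \<in> W" unfolding at'_def using ab W(1) by (intro subspace_add subspace_scale subspace_diff)
      qed
      define \<sigma> where "\<sigma> t = (- x) \<otimes> \<Psi> (at' t)" for t
      \<comment> \<open>Rescaling to unit size makes one stability constant serve all pairs of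
        points, however close.\<close>
      define \<rho> where "\<rho> t = dilation G (1 / s) (\<sigma> t)" for t
      define v where "v t = A (at' t) w" for t
      have "steered \<rho> v" unfolding steered_def
      proof (intro conjI ballI)
        have "\<sigma> 0 = 0" using ab(5) by (simp add: \<sigma>_def at'_def)
        then show "\<rho> 0 = 0" by (simp add: \<rho>_def linear_0[OF linear_dilation])
        fix t :: real assume t: "t \<in> {0..1}"
        have "(at' has_derivative (\<lambda>h. h *\<^sub>R (b - a))) (at t)"
          unfolding at'_def[abs_def] by (auto intro!: derivative_eq_intros)
        from has_derivative_compose[OF this D\<Psi>(1)[OF at'(3)[OF t]]]
        have "((\<lambda>t. \<Psi> (at' t)) has_vector_derivative blinfun_apply (D\<Psi> (at' t)) (b - a)) (at t)"
          by (simp add: has_vector_derivative_def blinfun.scaleR_right)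
        also have "blinfun_apply (D\<Psi> (at' t)) (b - a) = lderiv (\<Psi> (at' t)) 0 (s *\<^sub>R v t)"
          by (simp only: w(3) v_def lderiv_A linear_scale[OF linear_lderiv] blinfun.scaleR_right)
        finally have "(\<sigma> has_vector_derivative lderiv (- x) (\<Psi> (at' t)) (lderiv (\<Psi> (at' t)) 0 (s *\<^sub>R v t))) (at t)"
          unfolding \<sigma>_def[abs_def] by (rule mult_has_vector_derivative)
        also have "lderiv (- x) (\<Psi> (at' t)) (lderiv (\<Psi> (at' t)) 0 (s *\<^sub>R v t)) = lderiv (\<sigma> t) 0 (s *\<^sub>R v t)"
          unfolding \<sigma>_def lderiv_mult by simp
        finally have "(\<rho> has_vector_derivative dilation G (1 / s) (lderiv (\<sigma> t) 0 (s *\<^sub>R v t))) (at t)"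
          unfolding \<rho>_def[abs_def]
          by (rule bounded_linear.has_vector_derivative[OF linear_dilation[unfolded linear_conv_bounded_linear]])
        also have "dilation G (1 / s) (lderiv (\<sigma> t) 0 (s *\<^sub>R v t)) = lderiv (\<rho> t) 0 (dilation G (1 / s) (s *\<^sub>R v t))"
          by (simp only: \<rho>_def lderiv_dilation)
        \<comment> \<open>Horizontality enters here: in the first layer the dilation by 1/s exactly
          cancels the speed s. Components of higher degree would be multiplied by higher powers of
          1/s and blow up as y approaches x.\<close>
        also have "dilation G (1 / s) (s *\<^sub>R v t) = v t"
        proof -
          have "s *\<^sub>R v t \<in> layer G 1" unfolding v_def
            by (intro subspace_scale layer_subspace A_hor at' t w)
          then show ?thesis using s by (simp add: dilation_layer1)
        qed
        finally show "(\<rho> has_vector_derivative lderiv (\<rho> t) 0 (v t)) (at t within {0..1})"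
          by (rule has_vector_derivative_at_within)
      qed
      moreover have "norm (A a0 w) \<le> R" using R(2)[of w] w(1) by simp
      moreover have "norm (v t - A a0 w) \<le> \<epsilon>1" if "t \<in> {0..1}" for t
        unfolding v_def using at'(1)[OF that] w(1) by (intro A_near) auto
      ultimately have close: "norm (\<rho> 1 - A a0 w) \<le> \<eta>" using \<epsilon>1(2)[of "A a0 w" \<rho> v] by blast
      have "norm (\<rho> 1) \<le> R + 1"
        using close \<eta>(2) \<open>norm (A a0 w) \<le> R\<close> norm_triangle_sub[of "\<rho> 1" "A a0 w"] by linarith
      then have "dist (d (\<rho> 1) 0) (d (A a0 w) 0) < \<epsilon> * m"
        using \<open>norm (A a0 w) \<le> R\<close> close \<eta>(3) by (intro \<eta>0(2)) (auto simp: dist_norm)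
      also have "d (A a0 w) 0 = c * norm (A a0 w)" using c(2) A_hor[OF a0(1,2) w(2)] by blast
      finally have near: "\<bar>d (\<rho> 1) 0 - c * norm (A a0 w)\<bar> < \<epsilon> * m" by (simp add: dist_real_def)
      have "\<sigma> 1 = (- x) \<otimes> y" using ab(6) by (simp add: \<sigma>_def at'_def)
      then have "d (\<rho> 1) 0 = 1 / s * d x y"
        unfolding \<rho>_def dist_eq_norm[OF md, of x y] using s by (simp only: dilation_norm[OF md] zero_less_divide_1_iff)
      then have dxy: "d x y = s * d (\<rho> 1) 0" using s by simp
      have nA: "norm (A a0 (b - a)) = s * norm (A a0 w)" using s by (simp add: w(3) linear_scale[OF linA])
      have "d x y - c * norm (A a0 (b - a)) = s * (d (\<rho> 1) 0 - c * norm (A a0 w))"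
        unfolding nA by (subst dxy) (simp add: right_diff_distrib)
      then have "\<bar>d x y - c * norm (A a0 (b - a))\<bar> = s * \<bar>d (\<rho> 1) 0 - c * norm (A a0 w)\<bar>"
        using s by (simp only: abs_mult abs_of_pos)
      also have "\<dots> \<le> s * (\<epsilon> * m)" using near s by (intro mult_left_mono) auto
      also have "\<dots> \<le> s * (\<epsilon> * norm (A a0 w))" using m(2)[of w] w(1) s \<epsilon> by (intro mult_left_mono) auto
      also have "\<dots> = \<epsilon> * norm (A a0 (b - a))" by (simp add: nA)
      finally show ?thesis unfolding a_def[symmetric] b_def[symmetric] dist_ab .
    qed
  qed
  show ?thesis
    by (rule exI[of _ U'], rule exI[of _ "A a0 ` W"], rule exI[of _ "\<lambda>x. A a0 (\<Phi> x)"])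
      (intro conjI ballI openU' pU' sub dim img est)
qed

text \<open>Near each point the chart has bilipschitz constants \<open>c - \<epsilon>\<close> and
  \<open>c + \<epsilon>\<close>, whose ratio to the power \<open>n\<close> can be brought below any
  \<kappa> > 1. The local estimates combine to the global one with factor \<kappa>, which then tends
  to 1.\<close>

lemma spherical0_le_hausdorff0_horizontal:
  fixes e :: "nat \<Rightarrow> 'a"
  assumes gob: "graded_orthonormal_basis G e" and md: "multiradial G d" and n: "1 \<le> n"
    and hs: "horizontal_submanifold G e n S" and E: "E \<subseteq> S"
  shows "spherical0 d n E \<le> hausdorff0 d n E"
proof -
  interpret M: Metric_space UNIV d by (rule hom_dist[OF md])
  obtain c where c: "0 < c" "\<forall>v\<in>layer G 1. d v 0 = c * norm v" using hom_norm_layer1[OF md] by blast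
  have main: "spherical0 d n E \<le> ennreal \<kappa> * hausdorff0 d n E" if \<kappa>: "1 < \<kappa>" for \<kappa>
  proof -
    have "((\<lambda>\<epsilon>. ((c + \<epsilon>) / (c - \<epsilon>)) ^ n) \<longlongrightarrow> ((c + 0) / (c - 0)) ^ n) (at_right 0)"
      using c(1) by (intro tendsto_intros) auto
    then have "\<forall>\<^sub>F \<epsilon> in at_right 0. ((c + \<epsilon>) / (c - \<epsilon>)) ^ n < \<kappa>"
      using \<kappa> c(1) by (intro order_tendstoD(2)) auto
    moreover have "\<forall>\<^sub>F \<epsilon> in at_right (0::real). \<epsilon> \<in> {0<..<c}"
      using c(1) by (rule eventually_at_right_real)
    ultimately have "\<forall>\<^sub>F \<epsilon> in at_right (0::real). ((c + \<epsilon>) / (c - \<epsilon>)) ^ n < \<kappa> \<and> \<epsilon> \<in> {0<..<c}"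
      by (rule eventually_conj)
    then have "\<exists>\<epsilon>. ((c + \<epsilon>) / (c - \<epsilon>)) ^ n < \<kappa> \<and> \<epsilon> \<in> {0<..<c}"
      by (rule eventually_happens'[OF trivial_limit_at_right_real])
    then obtain \<epsilon> where \<epsilon>: "((c + \<epsilon>) / (c - \<epsilon>)) ^ n < \<kappa>" "0 < \<epsilon>" "\<epsilon> < c" by auto
    show ?thesis
    proof (rule spherical0_le_hausdorff0_of_local[OF M.Metric_space_axioms n _ _ E])
      show "0 < \<kappa>" using \<kappa> by simp
      fix x assume x: "x \<in> S"
      obtain U V and g :: "'a \<Rightarrow> 'a" where U: "open U" "x \<in> U" "subspace V" "dim V = n" "g ` (S \<inter> U) \<subseteq> V"
        and est: "\<forall>y\<in>S \<inter> U. \<forall>z\<in>S \<inter> U. \<bar>d y z - c * dist (g y) (g z)\<bar> \<le> \<epsilon> * dist (g y) (g z)"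
        using local_chart_estimate[OF gob md hs x c \<epsilon>(2)] by blast
      obtain r where r: "0 < r" "\<forall>y. d x y < r \<longrightarrow> y \<in> U" using hom_ball_subset_open[OF md U(1,2)] by blast
      have "spherical0 d n B \<le> ennreal \<kappa> * (diam_mass d n B)"
        if B: "B \<subseteq> S" "\<forall>y\<in>B. d x y < r" for B
      proof -
        have BU: "B \<subseteq> S \<inter> U" using B r(2) by blast
        have "spherical0 d n B \<le> ennreal (((c + \<epsilon>) / (c - \<epsilon>)) ^ n) * (diam_mass d n B)"
        proof (rule spherical0_le_ediam[OF M.Metric_space_axioms U(3,4) n])
          show "g ` B \<subseteq> V" using U(5) BU by blast
          fix y z assume "y \<in> B" "z \<in> B"
          then have "\<bar>d y z - c * dist (g y) (g z)\<bar> \<le> \<epsilon> * dist (g y) (g z)" using est BU by blast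
          then show "(c - \<epsilon>) * dist (g y) (g z) \<le> d y z" "d y z \<le> (c + \<epsilon>) * dist (g y) (g z)"
            by (simp_all only: left_diff_distrib distrib_right)
        qed (use \<epsilon> c(1) in auto)
        also have "\<dots> \<le> ennreal \<kappa> * (diam_mass d n B)"
          using \<epsilon>(1) by (intro mult_right_mono ennreal_leI) auto
        finally show ?thesis .
      qed
      then show "\<exists>r>0. \<forall>B. B \<subseteq> S \<longrightarrow> (\<forall>y\<in>B. d x y < r) \<longrightarrow>
        spherical0 d n B \<le> ennreal \<kappa> * (diam_mass d n B)" using r(1) by blast
    qed
  qed
  show ?thesis
  proof (cases "hausdorff0 d n E")
    case (real h)
    show ?thesis
    proof (rule ennreal_le_epsilon)
      fix t :: real assume t: "0 < t"
      \<comment> \<open>Makes \<open>\<kappa> * h \<le> h + t\<close>; the denominator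
        \<open>h + 1\<close> also covers \<open>h = 0\<close>.\<close>
      define \<kappa> where "\<kappa> = 1 + t / (h + 1)"
      have "1 < \<kappa>" using t real by (simp add: \<kappa>_def)
      then have "spherical0 d n E \<le> ennreal \<kappa> * hausdorff0 d n E" by (rule main)
      also have "\<dots> = ennreal (\<kappa> * h)" using \<open>1 < \<kappa>\<close> real by (simp add: ennreal_mult)
      also have "\<dots> \<le> ennreal (h + t)"
      proof (rule ennreal_leI)
        have "t / (h + 1) * h \<le> t" using t real by (simp add: field_simps)
        then show "\<kappa> * h \<le> h + t" by (simp add: \<kappa>_def distrib_right)
      qed
      also have "\<dots> = hausdorff0 d n E + ennreal t" using t real by simp
      finally show "spherical0 d n E \<le> hausdorff0 d n E + ennreal t" .
    qed
  qed simp
qed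

lemma hausdorff0_le_spherical0:
  assumes "multiradial G d"
  shows "hausdorff0 d n E \<le> spherical0 d n E"
  unfolding hausdorff0_def spherical0_def
  by (rule covering_measure_antimono_family) (use closed_hom_ball[OF assms] in blast)

end

theorem theorem1p6:
  fixes G :: "('a::euclidean_space, 'm) homgroup_scheme"
    and e :: "nat \<Rightarrow> 'a"
    and d :: "'a \<Rightarrow> 'a \<Rightarrow> real"
    and S :: "'a set"
    and n :: nat
  assumes "homogeneous_group G"
    and "graded_orthonormal_basis G e"
    and "multiradial G d"
    and "n \<ge> 1"
    and "horizontal_submanifold G e n S"
  shows "measure_restriction (hausdorff_measure G d n) S
       = measure_restriction (spherical_measure G d n) S"
proof
  fix E
  interpret homogeneous_group G by fact
  have "hausdorff0 d n (E \<inter> S) = spherical0 d n (E \<inter> S)"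
    by (rule antisym[OF hausdorff0_le_spherical0[OF assms(3)]
          spherical0_le_hausdorff0_horizontal[OF assms(2-5) Int_lower2]])
  then show "measure_restriction (hausdorff_measure G d n) S E = measure_restriction (spherical_measure G d n) S E"
    by (simp add: measure_restriction_def hausdorff_measure_def spherical_measure_def)
qed

end
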